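(* Let $\alpha>0$ and $N\ge2$ be fixed, and let $0\le a_1\le a_2\le\cdots\le a_N$ be fixed real numbers. For $\beta\ge1$ let $0\le\lambda_1(t)\le\cdots\le\lambda_N(t)$ (depending on $\beta$) be the beta Laguerre processes, i.e. the unique strong solution of $$d\lambda_i(t)=\frac{2}{\sqrt\beta}\sqrt{\lambda_i(t)}\,db_i(t)+\alpha\,dt+\sum_{j\ne i}\frac{2\lambda_i(t)}{\lambda_i(t)-\lambda_j(t)}\,dt,\qquad\lambda_i(0)=a_i,\quad i=1,\dots,N,$$ where $b_1,\dots,b_N$ are independent standard Brownian motions. Then there are deterministic continuous functions $x_1(t),\dots,x_N(t)$, depending on the parameter $\alpha$ (and on $N$ and the initial data) but not on $\beta$, such that for every $T>0$, as $\beta\to\infty$, $\lambda_i(t)$ converges to $x_i(t)$ in probability uniformly on $[0,T]$ for each $i=1,\dots,N$; that is, for every $\varepsilon>0$, $\lim_{\beta\to\infty}\mathbb P(\sup_{0\le t\le T}|\lambda_i(t)-x_i(t)|\ge\varepsilon)=0$.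
   Context: For $\beta\ge1$ the existence and uniqueness of the strong solution of the system of SDEs (with the constraint $0\le\lambda_1(t)\le\cdots\le\lambda_N(t)$) is known, and in this case the processes are almost surely non-colliding at any positive time. *)

theory Defs
  imports "HOL-Probability.Probability"
begin

text \<open>
  Continuous-time processes are functions \<open>X t \<omega>\<close> with \<open>t :: real\<close>; only times \<open>t \<ge> 0\<close> matter.
\<close>

definition adapted :: "(real \<Rightarrow> 'w measure) \<Rightarrow> (real \<Rightarrow> 'w \<Rightarrow> real) \<Rightarrow> bool" where
  "adapted F X \<longleftrightarrow> (\<forall>t\<ge>0. X t \<in> borel_measurable (F t))"

definition continuous_paths :: "'w measure \<Rightarrow> (real \<Rightarrow> 'w \<Rightarrow> real) \<Rightarrow> bool" where
  "continuous_paths M X \<longleftrightarrow> (\<forall>\<omega>\<in>space M. continuous_on {0..} (\<lambda>t. X t \<omega>))"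

definition standard_brownian_motion :: "'w measure \<Rightarrow> (real \<Rightarrow> 'w \<Rightarrow> real) \<Rightarrow> bool" where
  "standard_brownian_motion M B \<longleftrightarrow>
     prob_space M \<and>
     (\<forall>t\<ge>0. B t \<in> borel_measurable M) \<and>
     continuous_paths M B \<and>
     (AE \<omega> in M. B 0 \<omega> = 0) \<and>
     (\<forall>s t. 0 \<le> s \<and> s < t \<longrightarrow>
        distributed M lborel (\<lambda>\<omega>. B t \<omega> - B s \<omega>) (\<lambda>x. ennreal (normal_density 0 (sqrt (t - s)) x))) \<and>
     (\<forall>(n::nat) \<tau>. 0 \<le> \<tau> 0 \<and> (\<forall>k<n. \<tau> k < \<tau> (Suc k)) \<longrightarrow>
        prob_space.indep_vars M (\<lambda>_. borel) (\<lambda>k \<omega>. B (\<tau> (Suc k)) \<omega> - B (\<tau> k) \<omega>) {..<n})"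

text \<open>Independence of the family is independence of the whole paths, as random elements of the
  product space \<open>\<real>\<^bsup>[0,\<infinity>)\<^esup>\<close>.\<close>

definition independent_brownian_motions ::
  "'w measure \<Rightarrow> 'i set \<Rightarrow> ('i \<Rightarrow> real \<Rightarrow> 'w \<Rightarrow> real) \<Rightarrow> bool" where
  "independent_brownian_motions M I b \<longleftrightarrow>
     prob_space M \<and>
     (\<forall>i\<in>I. standard_brownian_motion M (b i)) \<and>
     prob_space.indep_vars M (\<lambda>_. PiM {0..} (\<lambda>_. borel)) (\<lambda>i \<omega>. \<lambda>t\<in>{0..}. b i t \<omega>) I"

text \<open>The filtration generated by the family \<open>b\<close>, augmented by the null sets of \<open>M\<close>.\<close>

definition brownian_filtration ::
  "'w measure \<Rightarrow> 'i set \<Rightarrow> ('i \<Rightarrow> real \<Rightarrow> 'w \<Rightarrow> real) \<Rightarrow> real \<Rightarrow> 'w measure" where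
  "brownian_filtration M I b t =
     sigma (space M)
       (null_sets M \<union> {b i s -` A \<inter> space M | i s A. i \<in> I \<and> 0 \<le> s \<and> s \<le> t \<and> A \<in> sets borel})"

text \<open>
  A simple process is \<open>\<Sum>k<n. \<xi> k * indicator {\<tau> k<..\<tau> (Suc k)}\<close> with each \<open>\<xi> k\<close> bounded and known
  at time \<open>\<tau> k\<close>; its stochastic integral up to time \<open>t\<close> is the sum of the \<open>\<xi> k\<close> times the increments
  of the integrator stopped at \<open>t\<close>.
\<close>

definition simple_process ::
  "'w measure \<Rightarrow> (real \<Rightarrow> 'w measure) \<Rightarrow> nat \<Rightarrow> (nat \<Rightarrow> real) \<Rightarrow> (nat \<Rightarrow> 'w \<Rightarrow> real) \<Rightarrow> bool" where
  "simple_process M F n \<tau> \<xi> \<longleftrightarrow>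
     0 \<le> \<tau> 0 \<and> (\<forall>k<n. \<tau> k < \<tau> (Suc k)) \<and>
     (\<forall>k<n. \<xi> k \<in> borel_measurable (F (\<tau> k))) \<and>
     (\<exists>C. \<forall>k<n. \<forall>\<omega>\<in>space M. \<bar>\<xi> k \<omega>\<bar> \<le> C)"

definition simple_value ::
  "nat \<Rightarrow> (nat \<Rightarrow> real) \<Rightarrow> (nat \<Rightarrow> 'w \<Rightarrow> real) \<Rightarrow> real \<Rightarrow> 'w \<Rightarrow> real" where
  "simple_value n \<tau> \<xi> s \<omega> = (\<Sum>k<n. \<xi> k \<omega> * indicator {\<tau> k<..\<tau> (Suc k)} s)"

definition simple_integral_process ::
  "(real \<Rightarrow> 'w \<Rightarrow> real) \<Rightarrow> nat \<Rightarrow> (nat \<Rightarrow> real) \<Rightarrow> (nat \<Rightarrow> 'w \<Rightarrow> real) \<Rightarrow> real \<Rightarrow> 'w \<Rightarrow> real" where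
  "simple_integral_process B n \<tau> \<xi> t \<omega> =
     (\<Sum>k<n. \<xi> k \<omega> * (B (min t (\<tau> (Suc k))) \<omega> - B (min t (\<tau> k)) \<omega>))"

text \<open>
  \<open>J t = \<integral>\<^sub>0\<^sup>t H dB\<close>, the Ito integral of a measurable adapted process \<open>H\<close> whose paths are almost
  surely locally square integrable: \<open>J\<close> is the limit, in probability and locally uniformly in time,
  of the integrals of simple processes \<open>H\<^sub>m\<close> with \<open>\<integral>\<^sub>0\<^sup>T (H\<^sub>m - H)\<^sup>2 ds \<rightarrow> 0\<close> in probability for all \<open>T\<close>.
  \<open>B\<close> is meant to be a Brownian motion with respect to the filtration \<open>F\<close>.
\<close>

definition has_ito_integral ::
  "'w measure \<Rightarrow> (real \<Rightarrow> 'w measure) \<Rightarrow> (real \<Rightarrow> 'w \<Rightarrow> real) \<Rightarrow>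
   (real \<Rightarrow> 'w \<Rightarrow> real) \<Rightarrow> (real \<Rightarrow> 'w \<Rightarrow> real) \<Rightarrow> bool" where
  "has_ito_integral M F B H J \<longleftrightarrow>
     (\<lambda>(s, \<omega>). H s \<omega>) \<in> borel_measurable (restrict_space lborel {0..} \<Otimes>\<^sub>M M) \<and>
     adapted F H \<and>
     (AE \<omega> in M. \<forall>T>0. (\<integral>\<^sup>+ s\<in>{0..T}. ennreal ((H s \<omega>)\<^sup>2) \<partial>lborel) < \<infinity>) \<and>
     adapted F J \<and> continuous_paths M J \<and>
     (\<exists>n \<tau> \<xi>.
        (\<forall>m::nat. simple_process M F (n m) (\<tau> m) (\<xi> m)) \<and>
        (\<forall>T>0. \<forall>\<epsilon>>0.
           (\<lambda>m. measure M {\<omega>\<in>space M. ennreal \<epsilon> \<le>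
                  (\<integral>\<^sup>+ s\<in>{0..T}. ennreal ((simple_value (n m) (\<tau> m) (\<xi> m) s \<omega> - H s \<omega>)\<^sup>2) \<partial>lborel)})
             \<longlonglongrightarrow> 0) \<and>
        (\<forall>T>0. \<forall>\<epsilon>>0.
           (\<lambda>m. measure M {\<omega>\<in>space M. \<epsilon> \<le>
                  (SUP t\<in>{0..T}. \<bar>simple_integral_process B (n m) (\<tau> m) (\<xi> m) t \<omega> - J t \<omega>\<bar>)})
             \<longlonglongrightarrow> 0))"

definition laguerre_drift :: "real \<Rightarrow> nat \<Rightarrow> (nat \<Rightarrow> real) \<Rightarrow> nat \<Rightarrow> real" where
  "laguerre_drift \<alpha> N y i = \<alpha> + (\<Sum>j\<in>{1..N} - {i}. 2 * y i / (y i - y j))"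

text \<open>
  \<open>l\<close> is a strong solution, driven by \<open>b\<close>, of
  \[ dl_i = (2 / \sqrt\beta) \sqrt{l_i} db_i + \alpha dt + \sum_{j \neq i} 2 l_i / (l_i - l_j) dt,
     \quad l_i(0) = a_i, \]
  with \<open>0 \<le> l\<^sub>1 \<le> \<dots> \<le> l\<^sub>N\<close>: it is adapted to the augmented filtration of \<open>b\<close>, has continuous paths,
  an almost surely locally integrable drift, and satisfies the integrated equation.  Since \<open>x / 0 = 0\<close>
  here, it is also required explicitly that almost surely the drift is a genuine quotient, that is
  that the particles are at distinct places, at Lebesgue-almost every time.
\<close>

definition beta_laguerre_process ::
  "real \<Rightarrow> real \<Rightarrow> nat \<Rightarrow> (nat \<Rightarrow> real) \<Rightarrow> 'w measure \<Rightarrow> (nat \<Rightarrow> real \<Rightarrow> 'w \<Rightarrow> real) \<Rightarrow>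
   (nat \<Rightarrow> real \<Rightarrow> 'w \<Rightarrow> real) \<Rightarrow> bool" where
  "beta_laguerre_process \<alpha> \<beta> N a M b l \<longleftrightarrow>
     independent_brownian_motions M {1..N} b \<and>
     (\<forall>i\<in>{1..N}. adapted (brownian_filtration M {1..N} b) (l i) \<and> continuous_paths M (l i)) \<and>
     (AE \<omega> in M. \<forall>t\<ge>0. \<forall>i\<in>{1..N}. 0 \<le> l i t \<omega> \<and> (\<forall>j\<in>{1..N}. i \<le> j \<longrightarrow> l i t \<omega> \<le> l j t \<omega>)) \<and>
     (AE \<omega> in M. AE t in lborel. 0 < t \<longrightarrow> inj_on (\<lambda>i. l i t \<omega>) {1..N}) \<and>
     (\<forall>i\<in>{1..N}. AE \<omega> in M. l i 0 \<omega> = a i) \<and>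
     (\<forall>i\<in>{1..N}. AE \<omega> in M. \<forall>T>0.
        set_integrable lborel {0..T} (\<lambda>s. laguerre_drift \<alpha> N (\<lambda>j. l j s \<omega>) i)) \<and>
     (\<forall>i\<in>{1..N}. \<exists>J.
        has_ito_integral M (brownian_filtration M {1..N} b) (b i)
          (\<lambda>s \<omega>. 2 / sqrt \<beta> * sqrt (l i s \<omega>)) J \<and>
        (AE \<omega> in M. \<forall>t\<ge>0.
           l i t \<omega> = a i + J t \<omega> + (LBINT s:{0..t}. laguerre_drift \<alpha> N (\<lambda>j. l j s \<omega>) i)))"

end

theory Submission
  imports Defs "HOL-Real_Asymp.Real_Asymp"
begin

text \<open>
  The drift \<open>f\<close> satisfies \<open>\<Sum>\<^sub>i \<psi> (y\<^sub>i - z\<^sub>i) (f\<^sub>i y - f\<^sub>i z) \<le> N\<^sup>2\<close> for \<open>\<psi> = arsinh (\<cdot> / h)\<close>,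
  uniformly in \<open>h\<close>, while the primitive of \<open>\<psi>\<close> blows up away from \<open>0\<close> as \<open>h \<rightarrow> 0\<close>. As in the
  Yamada--Watanabe argument this forces two solutions of the noiseless equation with the same initial
  value to coincide. The estimate is pathwise and survives a perturbation of the equation by any
  uniformly small path, since \<open>\<integral> |f|\<close> is bounded a priori. So it is enough that the martingale part
  tends to \<open>0\<close> uniformly on \<open>[0, T]\<close> in probability, which follows from Lenglart's inequality. The
  processes for different \<open>\<beta>\<close> may live on different probability spaces, because only individual paths
  are compared; the limit is built from such paths, so that no existence theorem for the limiting
  differential equation is required.
\<close>

section \<open>Contractivity of the drift\<close>

text \<open>With the sign function in place of arsinh it would be a pure contraction, but a
  perturbed path reveals y - z only up to a small error, and a wrong sign would be multiplied by a
  drift without pointwise bound. Since arsinh(x / h) is Lipschitz with constant 1 / h, an error of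
  size eps costs eps / h times the integral of |f|, which is harmless once eps \<le> h. The
  primitive grows like |x| log(|x| / h), so a bound on it that is uniform in h leaves no room for a
  fixed nonzero x. The integral of |f| is finite because the interaction only pushes particles
  apart: weighting the particles by their rank dominates |f| by a linear functional of f, and the
  time integral of f is read off from the endpoints of the path.\<close>

lemma arsinh_diff_le:
  fixes x y :: real
  assumes "0 < x" "x \<le> y"
  shows "arsinh y - arsinh x \<le> (y - x) / x"
proof (cases "x = y")
  case False
  then have "x < y" using assms by simp
  have "\<exists>z. x < z \<and> z < y \<and> arsinh y - arsinh x = (y - x) * (1 / sqrt (z\<^sup>2 + 1))"
    using \<open>x < y\<close> by (rule MVT2) (rule arsinh_real_has_field_derivative)
  then obtain z where z: "x < z" "arsinh y - arsinh x = (y - x) * (1 / sqrt (z\<^sup>2 + 1))" by blast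
  have "x \<le> sqrt (z\<^sup>2 + 1)"
    using z assms by (intro real_le_rsqrt) (smt (verit) power_mono)
  then have "1 / sqrt (z\<^sup>2 + 1) \<le> 1 / x" using assms by (intro divide_left_mono) (auto intro!: mult_pos_pos add_nonneg_pos)
  then have "(y - x) * (1 / sqrt (z\<^sup>2 + 1)) \<le> (y - x) * (1 / x)"
    using \<open>x < y\<close> by (intro mult_left_mono) auto
  then show ?thesis using z by simp
qed simp

lemma arsinh_mono: "(x::real) \<le> y \<Longrightarrow> arsinh x \<le> arsinh y"
  using arsinh_less_iff_real[of y x] by linarith

lemma arsinh_lipschitz: "\<bar>arsinh x - arsinh y\<bar> \<le> \<bar>x - y\<bar>" for x y :: real
proof -
  have *: "arsinh y - arsinh x \<le> y - x" if "x < y" for x y :: real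
  proof -
    have "\<exists>z. x < z \<and> z < y \<and> arsinh y - arsinh x = (y - x) * (1 / sqrt (z\<^sup>2 + 1))"
      using that by (rule MVT2) (rule arsinh_real_has_field_derivative)
    then obtain z where z: "arsinh y - arsinh x = (y - x) * (1 / sqrt (z\<^sup>2 + 1))" by blast
    have "1 / sqrt (z\<^sup>2 + 1) \<le> 1" by (simp add: divide_le_eq_1 add_nonneg_pos)
    then have "(y - x) * (1 / sqrt (z\<^sup>2 + 1)) \<le> (y - x) * 1"
      using that by (intro mult_left_mono) auto
    then show ?thesis using z by simp
  qed
  show ?thesis
    using *[of x y] *[of y x] arsinh_mono[of x y] arsinh_mono[of y x]
    by (cases x y rule: linorder_cases) auto
qed

text \<open>As \<open>s - r\<close> is the smaller gap, \<open>p - r \<le> q - s\<close> and the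
  first factor is nonnegative. The second is at most \<open>(p - r) / (q - p)\<close>, which is
  harmful only for \<open>p > r\<close>; there it is linear in \<open>p - r\<close>, and this
  compensates the factor \<open>1 / (p - r)\<close> in the bound for the arsinh increment.\<close>

lemma pair_dissipation_aux:
  fixes h p q r s :: real
  assumes "0 < h" "0 \<le> p" "p < q" "0 \<le> r" "r < s" "s - r \<le> q - p"
  shows "(arsinh ((q - s) / h) - arsinh ((p - r) / h)) * (p / (q - p) - r / (s - r)) \<le> 1"
proof -
  define P where "P = arsinh ((q - s) / h) - arsinh ((p - r) / h)"
  have P0: "0 \<le> P" unfolding P_def using arsinh_mono[of "(p - r) / h" "(q - s) / h"] assms
    by (simp add: divide_right_mono)
  have key: "p / (q - p) - r / (s - r) \<le> (p - r) / (q - p)"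
  proof -
    have "r / (q - p) \<le> r / (s - r)" using assms by (intro divide_left_mono mult_pos_pos) auto
    then show ?thesis by (simp add: diff_divide_distrib)
  qed
  show ?thesis
  proof (cases "p \<le> r")
    case True
    then have "(p - r) / (q - p) \<le> 0" using assms by (simp add: divide_le_0_iff)
    then have "p / (q - p) - r / (s - r) \<le> 0" using key by linarith
    then have "P * (p / (q - p) - r / (s - r)) \<le> 0" using P0 by (rule mult_nonneg_nonpos[rotated])
    then show ?thesis unfolding P_def by linarith
  next
    case False
    define d where "d = p - r"
    have d: "d > 0" using False d_def by simp
    \<comment> \<open>The bound of \<open>arsinh_diff_le\<close> is homogeneous of degree 0, so
      \<open>h\<close> cancels; this is the source of all later independence of
      \<open>h\<close>.\<close>
    have "P \<le> ((q - s) / h - (p - r) / h) / ((p - r) / h)"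
      unfolding P_def using assms d d_def by (intro arsinh_diff_le divide_right_mono) auto
    also have "\<dots> = ((q - s) - d) / d" using assms d unfolding d_def by (simp add: field_simps)
    finally have P1: "P \<le> ((q - p) - (s - r)) / d" unfolding d_def by (simp add: algebra_simps)
    have "P * (p / (q - p) - r / (s - r)) \<le> P * (d / (q - p))"
      using key P0 d_def by (intro mult_left_mono) auto
    also have "\<dots> \<le> ((q - p) - (s - r)) / d * (d / (q - p))"
      using P1 d assms by (intro mult_right_mono) auto
    also have "\<dots> = ((q - p) - (s - r)) / (q - p)" using d by simp
    also have "\<dots> \<le> 1" using assms by simp
    finally show ?thesis unfolding P_def .
  qed
qed

text \<open>Exchanging the two configurations changes the sign of both factors, arsinh being odd, so
  the configuration with the smaller gap may be taken as the second one.\<close>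

lemma pair_dissipation:
  fixes h p q r s :: real
  assumes "0 < h" "0 \<le> p" "p < q" "0 \<le> r" "r < s"
  shows "(arsinh ((q - s) / h) - arsinh ((p - r) / h)) * (p / (q - p) - r / (s - r)) \<le> 1"
proof (cases "s - r \<le> q - p")
  case True
  then show ?thesis using pair_dissipation_aux assms by blast
next
  case False
  have e: "(r - p) / h = - ((p - r) / h)" "(s - q) / h = - ((q - s) / h)"
    by (simp_all add: minus_divide_left)
  have "(arsinh ((s - q) / h) - arsinh ((r - p) / h)) * (r / (s - r) - p / (q - p)) \<le> 1"
    using assms False by (intro pair_dissipation_aux) auto
  then show ?thesis unfolding e arsinh_minus_real by (simp add: algebra_simps)
qed

lemma sum_offdiag_swap:
  fixes F :: "nat \<Rightarrow> nat \<Rightarrow> real"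
  assumes "finite I"
  shows "(\<Sum>i\<in>I. \<Sum>j\<in>I - {i}. F i j) = (\<Sum>i\<in>I. \<Sum>j\<in>I - {i}. F j i)"
proof -
  have *: "(\<Sum>i\<in>I. \<Sum>j\<in>I - {i}. F i j) = (\<Sum>i\<in>I. \<Sum>j\<in>I. if i = j then 0 else F i j)"
    for F :: "nat \<Rightarrow> nat \<Rightarrow> real"
  proof (rule sum.cong[OF refl])
    fix i assume "i \<in> I"
    then show "(\<Sum>j\<in>I - {i}. F i j) = (\<Sum>j\<in>I. if i = j then 0 else F i j)"
      using assms by (simp add: sum.remove[of I i])
  qed
  have "(\<Sum>i\<in>I. \<Sum>j\<in>I. if i = j then 0 else F i j) = (\<Sum>j\<in>I. \<Sum>i\<in>I. if j = i then 0 else F i j)"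
    by (subst sum.swap) (intro sum.cong refl, auto)
  then show ?thesis unfolding *[of F] *[of "\<lambda>i j. F j i"] .
qed

lemma sum_offdiag_symm:
  fixes F :: "nat \<Rightarrow> nat \<Rightarrow> real"
  assumes "finite I"
  shows "2 * (\<Sum>i\<in>I. \<Sum>j\<in>I - {i}. F i j) = (\<Sum>i\<in>I. \<Sum>j\<in>I - {i}. F i j + F j i)"
  using sum_offdiag_swap[OF assms, of F] by (simp add: sum.distrib)

text \<open>Strict order is split into weak order and injectivity because the processes provide the
  former at all times and the latter only at almost every time.\<close>

definition ordered_config :: "nat \<Rightarrow> (nat \<Rightarrow> real) \<Rightarrow> bool" where
  "ordered_config N y \<longleftrightarrow> (\<forall>i\<in>{1..N}. 0 \<le> y i \<and> (\<forall>j\<in>{1..N}. i \<le> j \<longrightarrow> y i \<le> y j)) \<and> inj_on y {1..N}"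

lemma ordered_configD:
  assumes "ordered_config N y" "i \<in> {1..N}" "j \<in> {1..N}" "i < j"
  shows "0 \<le> y i" "y i < y j"
proof -
  show "0 \<le> y i" using assms unfolding ordered_config_def by auto
  have "y i \<le> y j" using assms unfolding ordered_config_def by auto
  moreover have "y i \<noteq> y j" using assms inj_on_eq_iff[of y "{1..N}" i j] unfolding ordered_config_def by force
  ultimately show "y i < y j" by simp
qed

text \<open>The drift is cooperative and its components have constant sum, hence it contracts the
  \<open>\<ell>\<^sup>1\<close>-distance; with the sign function smoothed to \<open>arsinh (\<cdot> / h)\<close> this survives up to an
  error that does not depend on \<open>h\<close>, because \<open>x * arsinh' x\<close> is bounded.\<close>

lemma drift_dissipation:
  assumes y: "ordered_config N y" and z: "ordered_config N z" and h: "0 < h"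
  shows "(\<Sum>i=1..N. arsinh ((y i - z i) / h) * (laguerre_drift \<alpha> N y i - laguerre_drift \<alpha> N z i)) \<le> (real N)\<^sup>2"
proof -
  define p where "p i = arsinh ((y i - z i) / h)" for i
  define g where "g i j = 2 * y i / (y i - y j) - 2 * z i / (z i - z j)" for i j
  \<comment> \<open>In each configuration the two quotients of a pair add up to 2, a constant that
    cancels in the difference.\<close>
  have swap: "g j i = - g i j" if "i \<in> {1..N}" "j \<in> {1..N}" "i < j" for i j
    using ordered_configD[OF y that] ordered_configD[OF z that] unfolding g_def
    by (simp add: divide_simps) (simp add: algebra_simps)
  have lt: "p i * g i j + p j * g j i \<le> 2" if "i \<in> {1..N}" "j \<in> {1..N}" "i < j" for i j
  proof -
    have *: "g i j = - 2 * (y i / (y j - y i) - z i / (z j - z i))"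
      using ordered_configD[OF y that] ordered_configD[OF z that] unfolding g_def
      by (simp add: divide_simps) (simp add: algebra_simps)
    have "(p j - p i) * (y i / (y j - y i) - z i / (z j - z i)) \<le> 1"
      unfolding p_def using ordered_configD[OF y that] ordered_configD[OF z that] h
      by (intro pair_dissipation)
    moreover have "p i * g i j + p j * g j i = 2 * ((p j - p i) * (y i / (y j - y i) - z i / (z j - z i)))"
      unfolding swap[OF that] unfolding * by algebra
    ultimately show ?thesis by linarith
  qed
  have le: "p i * g i j + p j * g j i \<le> 2" if "i \<in> {1..N}" "j \<in> {1..N} - {i}" for i j
    using lt[of i j] lt[of j i] that by (cases i j rule: linorder_cases) auto
  have "(\<Sum>i=1..N. p i * (laguerre_drift \<alpha> N y i - laguerre_drift \<alpha> N z i))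
      = (\<Sum>i=1..N. \<Sum>j\<in>{1..N} - {i}. p i * g i j)"
    unfolding laguerre_drift_def g_def sum_distrib_left[symmetric] sum_subtractf by simp
  moreover have "2 * (\<Sum>i=1..N. \<Sum>j\<in>{1..N} - {i}. p i * g i j) \<le> (\<Sum>i=1..N. \<Sum>j\<in>{1..N} - {i}. 2)"
    by (subst sum_offdiag_symm, simp) (intro sum_mono le)
  moreover have "(\<Sum>i=1..N. \<Sum>j\<in>{1..N} - {i}. 2) \<le> (\<Sum>i=1..N. real N * 2)"
    by (intro sum_mono order_trans[OF sum_bounded_above[where K=2]]) (auto simp: card_Diff_singleton_if)
  ultimately show ?thesis unfolding p_def by (simp add: power2_eq_square)
qed

text \<open>The singularities cancel pairwise: the two quotients of a pair add up to 2. Hence the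
  total mass grows at a bounded rate, however close the particles are.\<close>

lemma sum_laguerre_drift:
  assumes y: "ordered_config N y"
  shows "(\<Sum>i=1..N. laguerre_drift \<alpha> N y i) \<le> N * \<alpha> + (real N)\<^sup>2"
proof -
  define g where "g i j = 2 * y i / (y i - y j)" for i j
  have lt: "g i j + g j i = 2" if "i \<in> {1..N}" "j \<in> {1..N}" "i < j" for i j
    using ordered_configD[OF y that] unfolding g_def
      by (simp add: divide_simps) (simp add: algebra_simps)
  have eq: "g i j + g j i = 2" if "i \<in> {1..N}" "j \<in> {1..N} - {i}" for i j
    using lt[of i j] lt[of j i] that by (cases i j rule: linorder_cases) auto
  have "2 * (\<Sum>i=1..N. \<Sum>j\<in>{1..N} - {i}. g i j) = (\<Sum>i=1..N. \<Sum>j\<in>{1..N} - {i}. 2)"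
    by (subst sum_offdiag_symm, simp) (intro sum.cong refl eq)
  moreover have "(\<Sum>i=1..N. \<Sum>j\<in>{1..N} - {i}. 2) \<le> (\<Sum>i=1..N. real N * 2)"
    by (intro sum_mono order_trans[OF sum_bounded_above[where K=2]]) (auto simp: card_Diff_singleton_if)
  ultimately show ?thesis unfolding laguerre_drift_def g_def[symmetric]
    by (simp add: sum.distrib power2_eq_square)
qed

text \<open>In a pair \<open>i < j\<close> the lower particle is pushed down and the upper one up by
  \<open>g j i \<ge> 2\<close>, with \<open>g i j = 2 - g j i\<close>. The ranks differ by at least
  1, so \<open>i * g i j + j * g j i\<close> keeps a full copy of \<open>g j i\<close> and dominates
  both absolute values. The factor 2 comes from undoing the symmetrization.\<close>

lemma sum_abs_laguerre_drift:
  assumes y: "ordered_config N y" and \<alpha>: "\<alpha> \<ge> 0"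
  shows "(\<Sum>i=1..N. \<bar>laguerre_drift \<alpha> N y i\<bar>) \<le> N * \<alpha> + 2 * (\<Sum>i=1..N. i * laguerre_drift \<alpha> N y i)"
proof -
  define g where "g i j = 2 * y i / (y i - y j)" for i j
  have lt: "i * g i j + j * g j i \<ge> \<bar>g i j\<bar> \<and> i * g i j + j * g j i \<ge> \<bar>g j i\<bar>"
    if "i \<in> {1..N}" "j \<in> {1..N}" "i < j" for i j
  proof -
    note o = ordered_configD[OF y that]
    have 1: "g i j = 2 - g j i"
      using o unfolding g_def by (simp add: divide_simps) (simp add: algebra_simps)
    have 2: "g j i \<ge> 2" using o unfolding g_def by (simp add: field_simps)
    have 3: "g i j \<le> 0" using 1 2 by simp
    have "i * g i j + j * g j i = 2 * i + (real j - real i) * g j i"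
      unfolding 1 by (simp add: algebra_simps)
    moreover have "(real j - real i) * g j i \<ge> 1 * g j i"
      using that 2 by (intro mult_right_mono) auto
    ultimately have "i * g i j + j * g j i \<ge> g j i" by simp
    then show ?thesis using 1 2 3 by auto
  qed
  have le: "\<bar>g i j\<bar> \<le> i * g i j + j * g j i" if "i \<in> {1..N}" "j \<in> {1..N} - {i}" for i j
    using lt[of i j] lt[of j i] that by (cases i j rule: linorder_cases) auto
  have f: "laguerre_drift \<alpha> N y i = \<alpha> + (\<Sum>j\<in>{1..N} - {i}. g i j)" for i
    unfolding laguerre_drift_def g_def by simp
  have "(\<Sum>i=1..N. \<bar>laguerre_drift \<alpha> N y i\<bar>) \<le> (\<Sum>i=1..N. \<alpha> + (\<Sum>j\<in>{1..N} - {i}. \<bar>g i j\<bar>))"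
    unfolding f using \<alpha> sum_abs by (intro sum_mono order_trans[OF abs_triangle_ineq] add_mono) auto
  also have "\<dots> = N * \<alpha> + (\<Sum>i=1..N. \<Sum>j\<in>{1..N} - {i}. \<bar>g i j\<bar>)" by (simp add: sum.distrib)
  also have "\<dots> \<le> N * \<alpha> + (\<Sum>i=1..N. \<Sum>j\<in>{1..N} - {i}. i * g i j + j * g j i)"
    by (intro add_left_mono sum_mono le)
  also have "\<dots> = N * \<alpha> + 2 * (\<Sum>i=1..N. \<Sum>j\<in>{1..N} - {i}. i * g i j)"
    by (subst sum_offdiag_symm) auto
  also have "\<dots> = N * \<alpha> + 2 * (\<Sum>i=1..N. i * (\<Sum>j\<in>{1..N} - {i}. g i j))"
    by (simp add: sum_distrib_left)
  also have "\<dots> \<le> N * \<alpha> + 2 * (\<Sum>i=1..N. i * laguerre_drift \<alpha> N y i)"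
    unfolding f using \<alpha> by (intro add_left_mono mult_left_mono sum_mono) auto
  finally show ?thesis .
qed

section \<open>Stability under perturbation by a small path\<close>

lemma set_lebesgue_integral_combine:
  fixes f :: "real \<Rightarrow> real"
  assumes f: "set_integrable lborel {0..T} f" and "0 \<le> u" "u \<le> c" "c \<le> v" "v \<le> T"
  shows "(LBINT s:{u..v}. f s) = (LBINT s:{u..c}. f s) + (LBINT s:{c..v}. f s)"
proof -
  have "set_integrable lborel {u..v} f" "set_integrable lborel {u..c} f" "set_integrable lborel {c..v} f"
    using assms by (auto intro: set_integrable_subset[OF f])
  note this[THEN set_borel_integral_eq_integral(1)] this[THEN set_borel_integral_eq_integral(2)]
  then show ?thesis
    using Henstock_Kurzweil_Integration.integral_combine[of u c v f] assms by simp
qed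

lemma continuous_on_set_lebesgue_integral:
  fixes f :: "real \<Rightarrow> real"
  assumes f: "set_integrable lborel {0..T} f"
  shows "continuous_on {0..T} (\<lambda>t. LBINT s:{0..t}. f s)"
proof -
  have "(LBINT s:{0..t}. f s) = integral {0..t} f" if "t \<in> {0..T}" for t
    using that by (intro set_borel_integral_eq_integral(2) set_integrable_subset[OF f]) auto
  moreover have "continuous_on {0..T} (\<lambda>t. integral {0..t} f)"
    by (rule indefinite_integral_continuous_1[OF set_borel_integral_eq_integral(1)[OF f]])
  ultimately show ?thesis by (subst continuous_on_cong) auto
qed

text \<open>A chain rule for the convex function \<open>G\<close> with \<open>G' = \<psi>\<close> along the absolutely continuous
  \<open>w\<close>; the argument of \<open>\<psi>\<close> may be replaced by a uniform approximation \<open>d\<close> of \<open>w\<close>.\<close>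

lemma convex_chain_le:
  fixes G \<psi> g d w :: "real \<Rightarrow> real"
  assumes conv: "\<And>x y. G y - G x \<le> \<psi> y * (y - x)"
    and lip: "\<And>x y. \<bar>\<psi> x - \<psi> y\<bar> \<le> L * \<bar>x - y\<bar>" and L: "0 \<le> L"
    and g: "set_integrable lborel {0..T} g"
    and pg: "set_integrable lborel {0..T} (\<lambda>s. \<psi> (d s) * g s)"
    and w: "\<And>t. t \<in> {0..T} \<Longrightarrow> w t = (LBINT s:{0..t}. g s)"
    and d: "\<And>t. t \<in> {0..T} \<Longrightarrow> \<bar>d t - w t\<bar> \<le> \<epsilon>" and \<epsilon>: "0 < \<epsilon>" and T: "0 \<le> T"
  shows "G (w T) - G 0 \<le> (LBINT s:{0..T}. \<psi> (d s) * g s) + 2 * L * \<epsilon> * (LBINT s:{0..T}. \<bar>g s\<bar>)"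
proof -
  have ag: "set_integrable lborel {0..T} (\<lambda>s. \<bar>g s\<bar>)"
    using set_integrable_abs[OF g] by simp
  define h where "h s = \<psi> (d s) * g s + 2 * L * \<epsilon> * \<bar>g s\<bar>" for s
  have hi: "set_integrable lborel {0..T} h"
    unfolding h_def by (intro set_integral_add(1) pg set_integrable_mult_right ag)
  have wc: "continuous_on {0..T} w"
    using continuous_on_set_lebesgue_integral[OF g] w by (subst continuous_on_cong) auto
  \<comment> \<open>Both sides are additive in the interval, so it is enough to treat short
    intervals and to glue them by \<open>Bolzano\<close>. The bounds \<open>0 \<le> u\<close> and
    \<open>v \<le> T\<close> belong to the predicate because short intervals around an endpoint may
    leave \<open>{0..T}\<close>.\<close>
  have "0 \<le> (0::real) \<longrightarrow> T \<le> T \<longrightarrow> G (w T) - G (w 0) \<le> (LBINT s:{0..T}. h s)"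
  proof (rule Bolzano[where P = "\<lambda>u v. 0 \<le> u \<longrightarrow> v \<le> T \<longrightarrow> G (w v) - G (w u) \<le> (LBINT s:{u..v}. h s)"])
    show "0 \<le> T" by fact
  next
    fix a b c :: real
    assume 1: "0 \<le> a \<longrightarrow> b \<le> T \<longrightarrow> G (w b) - G (w a) \<le> (LBINT s:{a..b}. h s)"
      "0 \<le> b \<longrightarrow> c \<le> T \<longrightarrow> G (w c) - G (w b) \<le> (LBINT s:{b..c}. h s)" "a \<le> b" "b \<le> c"
    show "0 \<le> a \<longrightarrow> c \<le> T \<longrightarrow> G (w c) - G (w a) \<le> (LBINT s:{a..c}. h s)"
    proof (intro impI)
      assume "0 \<le> a" "c \<le> T"
      then show "G (w c) - G (w a) \<le> (LBINT s:{a..c}. h s)"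
        using 1 set_lebesgue_integral_combine[OF hi, of a b c] by auto
    qed
  next
    fix x :: real
    assume x: "0 \<le> x" "x \<le> T"
    have "\<exists>r>0. \<forall>s\<in>{0..T}. dist s x < r \<longrightarrow> dist (w s) (w x) < \<epsilon> / 2"
      using wc x \<epsilon> unfolding continuous_on_iff by (metis atLeastAtMost_iff half_gt_zero)
    then obtain r where r: "r > 0" "\<And>s. s \<in> {0..T} \<Longrightarrow> \<bar>s - x\<bar> < r \<Longrightarrow> \<bar>w s - w x\<bar> < \<epsilon> / 2"
      unfolding dist_real_def by blast
    show "\<exists>r>0. \<forall>a b. a \<le> x \<and> x \<le> b \<and> b - a < r \<longrightarrow> 0 \<le> a \<longrightarrow> b \<le> T \<longrightarrow>
        G (w b) - G (w a) \<le> (LBINT s:{a..b}. h s)"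
    proof (intro exI[of _ r] conjI allI impI r)
      fix a b assume ab: "a \<le> x \<and> x \<le> b \<and> b - a < r" "0 \<le> a" "b \<le> T"
      have sub: "{a..b} \<subseteq> {0..T}" using ab by auto
      have gab: "set_integrable lborel {a..b} g" by (rule set_integrable_subset[OF g _ sub]) simp
      have "w b - w a = (LBINT s:{a..b}. g s)"
        using w[of a] w[of b] set_lebesgue_integral_combine[OF g, of 0 a b] ab by auto
      \<comment> \<open>The slope is frozen at the right endpoint; being constant on the interval,
        it can be moved under the integral.\<close>
      then have "G (w b) - G (w a) \<le> (LBINT s:{a..b}. \<psi> (w b) * g s)"
        using conv[of "w b" "w a"] by simp
      also have "\<dots> \<le> (LBINT s:{a..b}. h s)"
      proof (rule set_integral_mono)
        show "set_integrable lborel {a..b} (\<lambda>s. \<psi> (w b) * g s)"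
          using gab by (intro set_integrable_mult_right) auto
        show "set_integrable lborel {a..b} h" by (rule set_integrable_subset[OF hi _ sub]) simp
        fix s assume s: "s \<in> {a..b}"
        \<comment> \<open>Moving from \<open>w b\<close> to \<open>w x\<close> and from there to
          \<open>w s\<close> costs \<open>\<epsilon> / 2\<close> each, and replacing
          \<open>w s\<close> by \<open>d s\<close> costs \<open>\<epsilon>\<close>.\<close>
        have "\<bar>w b - d s\<bar> \<le> 2 * \<epsilon>"
          using r(2)[of s] r(2)[of b] d[of s] s ab by (smt (verit) atLeastAtMost_iff field_sum_of_halves)
        then have "L * \<bar>w b - d s\<bar> \<le> L * (2 * \<epsilon>)" using L by (rule mult_left_mono)
        then have "\<bar>\<psi> (w b) - \<psi> (d s)\<bar> \<le> 2 * L * \<epsilon>" using lip[of "w b" "d s"] by linarith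
        then have "\<bar>\<psi> (w b) - \<psi> (d s)\<bar> * \<bar>g s\<bar> \<le> 2 * L * \<epsilon> * \<bar>g s\<bar>" by (rule mult_right_mono) simp
        moreover have "(\<psi> (w b) - \<psi> (d s)) * g s \<le> \<bar>\<psi> (w b) - \<psi> (d s)\<bar> * \<bar>g s\<bar>"
          by (metis abs_ge_self abs_mult)
        ultimately show "\<psi> (w b) * g s \<le> h s" unfolding h_def by (simp add: algebra_simps)
      qed
      finally show "G (w b) - G (w a) \<le> (LBINT s:{a..b}. h s)" .
    qed
  qed
  moreover have "w 0 = 0"
  proof -
    have "AE s in lborel. indicator {0..0} s *\<^sub>R g s = 0"
      using AE_lborel_singleton[of 0] by eventually_elim (auto split: split_indicator)
    then have "(LBINT s:{0..0}. g s) = 0"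
      unfolding set_lebesgue_integral_def by (rule integral_eq_zero_AE)
    then show ?thesis using w[of 0] T by simp
  qed
  moreover have "(LBINT s:{0..T}. h s)
      = (LBINT s:{0..T}. \<psi> (d s) * g s) + 2 * L * \<epsilon> * (LBINT s:{0..T}. \<bar>g s\<bar>)"
    unfolding h_def using pg ag by (subst set_integral_add(2)) auto
  ultimately show ?thesis by simp
qed

lemma set_integrable_continuous_mult:
  fixes f g :: "real \<Rightarrow> real"
  assumes f: "continuous_on {u..v} f" and g: "set_integrable lborel {u..v} g"
  shows "set_integrable lborel {u..v} (\<lambda>s. f s * g s)"
proof -
  have "compact (f ` {u..v})" by (intro compact_continuous_image f) simp
  then obtain C where C: "\<And>s. s \<in> {u..v} \<Longrightarrow> \<bar>f s\<bar> \<le> C"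
    by (fastforce dest!: compact_imp_bounded simp: bounded_iff)
  have m: "(\<lambda>s. indicator {u..v} s *\<^sub>R f s) \<in> borel_measurable lborel"
    using borel_measurable_continuous_on_indicator[OF _ f] by simp
  have i: "integrable lborel (\<lambda>s. indicator {u..v} s *\<^sub>R g s)" using g unfolding set_integrable_def .
  have "integrable lborel (\<lambda>s. (indicator {u..v} s *\<^sub>R f s) * (indicator {u..v} s *\<^sub>R g s))"
  proof (rule Bochner_Integration.integrable_bound)
    show "integrable lborel (\<lambda>s. C * \<bar>indicator {u..v} s *\<^sub>R g s\<bar>)" using i by auto
    show "(\<lambda>s. (indicator {u..v} s *\<^sub>R f s) * (indicator {u..v} s *\<^sub>R g s)) \<in> borel_measurable lborel"
      using m borel_measurable_integrable[OF i] by (rule borel_measurable_times)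
    show "AE s in lborel. norm ((indicator {u..v} s *\<^sub>R f s) * (indicator {u..v} s *\<^sub>R g s))
        \<le> norm (C * \<bar>indicator {u..v} s *\<^sub>R g s\<bar>)"
      using C by (intro AE_I2) (auto split: split_indicator simp: abs_mult intro!: mult_right_mono order_trans[OF C])
  qed
  moreover have "(\<lambda>s. (indicator {u..v} s *\<^sub>R f s) * (indicator {u..v} s *\<^sub>R g s))
      = (\<lambda>s. indicator {u..v} s *\<^sub>R (f s * g s))" by (auto split: split_indicator)
  ultimately show ?thesis unfolding set_integrable_def by simp
qed

text \<open>The error stands outside the integral and is measured only in the supremum norm, because
  a path of the noise is small but cannot be differentiated. No probability space occurs, so paths
  from unrelated spaces can be compared.\<close>

definition perturbed_solution ::
  "real \<Rightarrow> nat \<Rightarrow> (nat \<Rightarrow> real) \<Rightarrow> real \<Rightarrow> real \<Rightarrow> (nat \<Rightarrow> real \<Rightarrow> real) \<Rightarrow> bool" where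
  "perturbed_solution \<alpha> N a T \<epsilon> y \<longleftrightarrow>
     (\<forall>i\<in>{1..N}. continuous_on {0..T} (y i)) \<and>
     (\<forall>i\<in>{1..N}. set_integrable lborel {0..T} (\<lambda>s. laguerre_drift \<alpha> N (\<lambda>j. y j s) i)) \<and>
     (\<forall>t\<in>{0..T}. \<forall>i\<in>{1..N}. 0 \<le> y i t \<and> (\<forall>j\<in>{1..N}. i \<le> j \<longrightarrow> y i t \<le> y j t)) \<and>
     (AE t in lborel. 0 < t \<longrightarrow> t \<le> T \<longrightarrow> inj_on (\<lambda>i. y i t) {1..N}) \<and>
     (\<forall>i\<in>{1..N}. \<forall>t\<in>{0..T}.
        \<bar>y i t - a i - (LBINT s:{0..t}. laguerre_drift \<alpha> N (\<lambda>j. y j s) i)\<bar> \<le> \<epsilon>)"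

lemma perturbed_solution_mono:
  assumes "perturbed_solution \<alpha> N a T \<epsilon> y" "T' \<le> T" "\<epsilon> \<le> \<epsilon>'"
  shows "perturbed_solution \<alpha> N a T' \<epsilon>' y"
proof -
  have sub: "{0..T'} \<subseteq> {0..T}" using assms by auto
  show ?thesis using assms(1) unfolding perturbed_solution_def
  proof (elim conjE, intro conjI)
    assume "\<forall>i\<in>{1..N}. continuous_on {0..T} (y i)"
    then show "\<forall>i\<in>{1..N}. continuous_on {0..T'} (y i)" using sub continuous_on_subset by blast
  next
    assume "\<forall>i\<in>{1..N}. set_integrable lborel {0..T} (\<lambda>s. laguerre_drift \<alpha> N (\<lambda>j. y j s) i)"
    then show "\<forall>i\<in>{1..N}. set_integrable lborel {0..T'} (\<lambda>s. laguerre_drift \<alpha> N (\<lambda>j. y j s) i)"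
      using sub by (auto intro: set_integrable_subset)
  next
    assume "AE t in lborel. 0 < t \<longrightarrow> t \<le> T \<longrightarrow> inj_on (\<lambda>i. y i t) {1..N}"
    then show "AE t in lborel. 0 < t \<longrightarrow> t \<le> T' \<longrightarrow> inj_on (\<lambda>i. y i t) {1..N}"
      using assms by (auto elim!: eventually_mono)
  next
    assume "\<forall>t\<in>{0..T}. \<forall>i\<in>{1..N}. 0 \<le> y i t \<and> (\<forall>j\<in>{1..N}. i \<le> j \<longrightarrow> y i t \<le> y j t)"
    then show "\<forall>t\<in>{0..T'}. \<forall>i\<in>{1..N}. 0 \<le> y i t \<and> (\<forall>j\<in>{1..N}. i \<le> j \<longrightarrow> y i t \<le> y j t)"
      using sub by blast
  next
    assume *: "\<forall>i\<in>{1..N}. \<forall>t\<in>{0..T}.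
        \<bar>y i t - a i - (LBINT s:{0..t}. laguerre_drift \<alpha> N (\<lambda>j. y j s) i)\<bar> \<le> \<epsilon>"
    show "\<forall>i\<in>{1..N}. \<forall>t\<in>{0..T'}.
        \<bar>y i t - a i - (LBINT s:{0..t}. laguerre_drift \<alpha> N (\<lambda>j. y j s) i)\<bar> \<le> \<epsilon>'"
    proof (intro ballI)
      fix i t assume "i \<in> {1..N}" "t \<in> {0..T'}"
      then have "\<bar>y i t - a i - (LBINT s:{0..t}. laguerre_drift \<alpha> N (\<lambda>j. y j s) i)\<bar> \<le> \<epsilon>"
        using * sub by blast
      then show "\<bar>y i t - a i - (LBINT s:{0..t}. laguerre_drift \<alpha> N (\<lambda>j. y j s) i)\<bar> \<le> \<epsilon>'"
        using assms(3) by simp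
    qed
  qed
qed

lemma perturbed_solution_ordered:
  assumes "perturbed_solution \<alpha> N a T \<epsilon> y"
  shows "AE t in lborel. t \<in> {0..T} \<longrightarrow> ordered_config N (\<lambda>i. y i t)"
proof -
  have "AE t in lborel. 0 < t \<longrightarrow> t \<le> T \<longrightarrow> inj_on (\<lambda>i. y i t) {1..N}"
    and o: "\<forall>t\<in>{0..T}. \<forall>i\<in>{1..N}. 0 \<le> y i t \<and> (\<forall>j\<in>{1..N}. i \<le> j \<longrightarrow> y i t \<le> y j t)"
    using assms unfolding perturbed_solution_def by blast+
  \<comment> \<open>Injectivity is known for positive times only, since initial values may coincide;
    time 0 is discarded as a null set.\<close>
  from this(1) AE_lborel_singleton[of "0::real"] show ?thesis
  proof eventually_elim
    case (elim t)
    show ?case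
    proof
      assume t: "t \<in> {0..T}"
      then have "inj_on (\<lambda>i. y i t) {1..N}" using elim by auto
      then show "ordered_config N (\<lambda>i. y i t)" using o t unfolding ordered_config_def by blast
    qed
  qed
qed

section \<open>A priori bounds for perturbed solutions\<close>

lemma set_lebesgue_integral_sum:
  fixes f :: "'i \<Rightarrow> 'a \<Rightarrow> real"
  assumes "\<And>i. i \<in> I \<Longrightarrow> set_integrable M A (f i)"
  shows "set_integrable M A (\<lambda>s. \<Sum>i\<in>I. f i s)"
    and "(LINT s:A|M. (\<Sum>i\<in>I. f i s)) = (\<Sum>i\<in>I. LINT s:A|M. f i s)"
proof -
  have *: "(\<lambda>s. indicator A s *\<^sub>R (\<Sum>i\<in>I. f i s)) = (\<lambda>s. \<Sum>i\<in>I. indicator A s *\<^sub>R f i s)"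
    by (simp add: sum_distrib_left)
  show "set_integrable M A (\<lambda>s. \<Sum>i\<in>I. f i s)"
    using assms unfolding set_integrable_def * by (rule Bochner_Integration.integrable_sum)
  show "(LINT s:A|M. (\<Sum>i\<in>I. f i s)) = (\<Sum>i\<in>I. LINT s:A|M. f i s)"
    using assms unfolding set_integrable_def set_lebesgue_integral_def *
    by (rule Bochner_Integration.integral_sum)
qed

lemma set_lebesgue_integral_le_const:
  fixes f :: "real \<Rightarrow> real"
  assumes "set_integrable lborel {0..t} f" "AE s in lborel. s \<in> {0..t} \<longrightarrow> f s \<le> C" "0 \<le> t"
  shows "(LBINT s:{0..t}. f s) \<le> C * t"
proof -
  have "(LBINT s:{0..t}. f s) \<le> (LBINT s:{0..t}. C)"
    using assms by (intro set_integral_mono_AE) (auto simp: set_integrable_def)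
  then show ?thesis using assms(3) by (simp add: set_lebesgue_integral_def mult.commute)
qed

text \<open>Summation over the particles removes the singular part of the drift, so only initial
  mass, noise \<open>J\<close> and elapsed time remain.\<close>

lemma sum_solution_le:
  assumes y: "\<And>i. i \<in> {1..N} \<Longrightarrow> y i = a i + J i + (LBINT s:{0..t}. laguerre_drift \<alpha> N (Y s) i)"
    and int: "\<And>i. i \<in> {1..N} \<Longrightarrow> set_integrable lborel {0..t} (\<lambda>s. laguerre_drift \<alpha> N (Y s) i)"
    and Y: "AE s in lborel. s \<in> {0..t} \<longrightarrow> ordered_config N (Y s)" and t: "0 \<le> t"
  shows "(\<Sum>i=1..N. y i) \<le> (\<Sum>i=1..N. a i) + (\<Sum>i=1..N. J i) + (N * \<alpha> + (real N)\<^sup>2) * t"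
proof -
  have "(\<Sum>i=1..N. y i) = (\<Sum>i=1..N. a i) + (\<Sum>i=1..N. J i)
      + (\<Sum>i=1..N. LBINT s:{0..t}. laguerre_drift \<alpha> N (Y s) i)"
    using y by (simp add: sum.distrib)
  also have "(\<Sum>i=1..N. LBINT s:{0..t}. laguerre_drift \<alpha> N (Y s) i)
      = (LBINT s:{0..t}. \<Sum>i=1..N. laguerre_drift \<alpha> N (Y s) i)"
    using int by (intro set_lebesgue_integral_sum(2)[symmetric])
  also have "\<dots> \<le> (N * \<alpha> + (real N)\<^sup>2) * t"
    using Y by (intro set_lebesgue_integral_le_const set_lebesgue_integral_sum(1) int t)
      (auto elim!: eventually_mono dest!: sum_laguerre_drift[where \<alpha>=\<alpha>])
  finally show ?thesis by simp
qed

lemma set_integrable_const_atLeastAtMost: "set_integrable lborel {u..v::real} (\<lambda>_. c :: real)"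
  by (intro borel_integrable_atLeastAtMost' continuous_on_const)

text \<open>\<open>sum_abs_laguerre_drift\<close> reduces the claim to the rank-weighted integrals
  of the drift. These are determined up to the error by the values at time \<open>T\<close>, and the
  total mass at time \<open>T\<close> is bounded by \<open>sum_solution_le\<close>.\<close>

lemma perturbed_solution_abs_drift:
  assumes y: "perturbed_solution \<alpha> N a T \<epsilon> y" and \<epsilon>: "\<epsilon> \<le> 1" and \<alpha>: "0 \<le> \<alpha>" and T: "0 \<le> T"
    and a: "\<And>i. i \<in> {1..N} \<Longrightarrow> 0 \<le> a i"
  shows "(\<Sum>i=1..N. LBINT s:{0..T}. \<bar>laguerre_drift \<alpha> N (\<lambda>j. y j s) i\<bar>)
    \<le> N * \<alpha> * T + 2 * real N * ((\<Sum>i=1..N. a i) + 2 * real N + (N * \<alpha> + (real N)\<^sup>2) * T)"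
proof -
  define f where "f i s = laguerre_drift \<alpha> N (\<lambda>j. y j s) i" for i s
  define J where "J i = y i T - a i - (LBINT s:{0..T}. f i s)" for i
  have int: "set_integrable lborel {0..T} (f i)" if "i \<in> {1..N}" for i
    using y that unfolding perturbed_solution_def f_def by blast
  have J: "\<bar>J i\<bar> \<le> 1" if "i \<in> {1..N}" for i
  proof -
    have "\<bar>J i\<bar> \<le> \<epsilon>" using y that T unfolding perturbed_solution_def J_def f_def by auto
    then show ?thesis using \<epsilon> by simp
  qed
  have y0: "0 \<le> y i T" if "i \<in> {1..N}" for i
    using y that T unfolding perturbed_solution_def by auto
  note o = perturbed_solution_ordered[OF y]
  have "(\<Sum>i=1..N. y i T) \<le> (\<Sum>i=1..N. a i) + (\<Sum>i=1..N. J i) + (N * \<alpha> + (real N)\<^sup>2) * T"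
    using int o T by (intro sum_solution_le[where Y = "\<lambda>s j. y j s"]) (auto simp: J_def f_def[symmetric])
  moreover have "(\<Sum>i=1..N. J i) \<le> (\<Sum>i=1..N. 1)"
    using J by (intro sum_mono) (auto simp: abs_le_iff)
  ultimately have sum_y: "(\<Sum>i=1..N. y i T) \<le> (\<Sum>i=1..N. a i) + N + (N * \<alpha> + (real N)\<^sup>2) * T" by simp
  have if_int: "set_integrable lborel {0..T} (\<lambda>s. i * f i s)" if "i \<in> {1..N}" for i
    using int[OF that] by (intro set_integrable_mult_right)
  have "(\<Sum>i=1..N. LBINT s:{0..T}. \<bar>f i s\<bar>) = (LBINT s:{0..T}. \<Sum>i=1..N. \<bar>f i s\<bar>)"
    using int by (intro set_lebesgue_integral_sum(2)[symmetric] set_integrable_abs)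
  also have "\<dots> \<le> (LBINT s:{0..T}. N * \<alpha> + 2 * (\<Sum>i=1..N. i * f i s))"
  proof (rule set_integral_mono_AE)
    show "set_integrable lborel {0..T} (\<lambda>s. \<Sum>i=1..N. \<bar>f i s\<bar>)"
      using int by (intro set_lebesgue_integral_sum(1) set_integrable_abs)
    show "set_integrable lborel {0..T} (\<lambda>s. N * \<alpha> + 2 * (\<Sum>i=1..N. i * f i s))"
      by (intro set_integral_add(1) set_integrable_const_atLeastAtMost
          set_integrable_mult_right[OF set_lebesgue_integral_sum(1)[OF if_int]])
    show "AE s\<in>{0..T} in lborel. (\<Sum>i=1..N. \<bar>f i s\<bar>) \<le> N * \<alpha> + 2 * (\<Sum>i=1..N. i * f i s)"
      using o unfolding f_def by eventually_elim (auto intro: sum_abs_laguerre_drift[OF _ \<alpha>, simplified])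
  qed
  also have "\<dots> = N * \<alpha> * T + 2 * (\<Sum>i=1..N. i * (LBINT s:{0..T}. f i s))"
  proof -
    have "set_integrable lborel {0..T} (\<lambda>s. 2 * (\<Sum>i=1..N. i * f i s))"
      by (intro set_integrable_mult_right[OF set_lebesgue_integral_sum(1)[OF if_int]])
    moreover have "set_integrable lborel {0..T} (\<lambda>s. N * \<alpha>)"
      by (rule set_integrable_const_atLeastAtMost)
    moreover have "(LBINT s:{0..T}. N * \<alpha>) = N * \<alpha> * T"
      using T by (simp add: set_lebesgue_integral_def)
    moreover have "(LBINT s:{0..T}. 2 * (\<Sum>i=1..N. i * f i s)) = 2 * (\<Sum>i=1..N. LBINT s:{0..T}. i * f i s)"
      by (subst set_integral_mult_right) (subst set_lebesgue_integral_sum(2)[OF if_int], auto)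
    moreover have "(\<Sum>i=1..N. LBINT s:{0..T}. i * f i s) = (\<Sum>i=1..N. i * (LBINT s:{0..T}. f i s))"
      using int by (intro sum.cong refl set_integral_mult_right)
    ultimately show ?thesis by (simp only: set_integral_add(2))
  qed
  \<comment> \<open>The integral is \<open>y i T - a i - J i\<close>, where
    \<open>a i \<ge> 0\<close> is dropped and the error is at most 1. As \<open>y i T + 1\<close> is
    nonnegative, its weight may be raised from \<open>i\<close> to \<open>N\<close>.\<close>
  also have "(\<Sum>i=1..N. i * (LBINT s:{0..T}. f i s)) \<le> (\<Sum>i=1..N. N * (y i T + 1))"
  proof (rule sum_mono)
    fix i assume i: "i \<in> {1..N}"
    have "(LBINT s:{0..T}. f i s) \<le> y i T + 1" using J[OF i] a[OF i] unfolding J_def by linarith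
    then have "i * (LBINT s:{0..T}. f i s) \<le> i * (y i T + 1)" by (rule mult_left_mono) simp
    also have "\<dots> \<le> N * (y i T + 1)" using i y0[OF i] by (intro mult_right_mono) auto
    finally show "i * (LBINT s:{0..T}. f i s) \<le> N * (y i T + 1)" .
  qed
  also have "(\<Sum>i=1..N. N * (y i T + 1)) = N * ((\<Sum>i=1..N. y i T) + N)"
    unfolding sum_distrib_left[symmetric] by (simp add: sum.distrib)
  also have "\<dots> \<le> N * ((\<Sum>i=1..N. a i) + 2 * real N + (N * \<alpha> + (real N)\<^sup>2) * T)"
    using sum_y by (intro mult_left_mono) auto
  finally show ?thesis unfolding f_def by simp
qed

text \<open>The antiderivative of \<open>arsinh (x / h)\<close> with minimum \<open>- h\<close>,
  attained at 0; later estimates therefore use the nonnegative quantity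
  \<open>arsinh_primitive h x + h\<close>.\<close>

definition arsinh_primitive :: "real \<Rightarrow> real \<Rightarrow> real" where
  "arsinh_primitive h x = x * arsinh (x / h) - sqrt (x\<^sup>2 + h\<^sup>2)"

lemma arsinh_primitive_deriv:
  assumes "0 < h"
  shows "(arsinh_primitive h has_real_derivative arsinh (x / h)) (at x)"
proof -
  have *: "((\<lambda>x. arsinh (x / h)) has_real_derivative (1 / sqrt ((x / h)\<^sup>2 + 1)) * (1 / h)) (at x)"
    by (rule DERIV_chain'[where f = "\<lambda>x. x / h" and g = arsinh])
      (use assms in \<open>auto intro!: derivative_eq_intros arsinh_real_has_field_derivative\<close>)
  have p: "0 < x\<^sup>2 + h\<^sup>2" using assms by (simp add: add_nonneg_pos)
  have "(x / h)\<^sup>2 + 1 = (x\<^sup>2 + h\<^sup>2) / h\<^sup>2" using assms by (simp add: field_simps)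
  then have e: "sqrt ((x / h)\<^sup>2 + 1) = sqrt (x\<^sup>2 + h\<^sup>2) / h" using assms by (simp add: real_sqrt_divide)
  have s: "((\<lambda>x. sqrt (x\<^sup>2 + h\<^sup>2)) has_real_derivative x / sqrt (x\<^sup>2 + h\<^sup>2)) (at x)"
    using p by (auto intro!: derivative_eq_intros simp: field_simps)
  have "((\<lambda>x. x * arsinh (x / h) - sqrt (x\<^sup>2 + h\<^sup>2)) has_real_derivative
      (1 * arsinh (x / h) + (1 / sqrt ((x / h)\<^sup>2 + 1)) * (1 / h) * x) - x / sqrt (x\<^sup>2 + h\<^sup>2)) (at x)"
    by (intro DERIV_diff DERIV_mult * s DERIV_ident)
  moreover have "(1 / sqrt ((x / h)\<^sup>2 + 1)) * (1 / h) * x = x / sqrt (x\<^sup>2 + h\<^sup>2)"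
    unfolding e using assms by simp
  ultimately show ?thesis unfolding arsinh_primitive_def[abs_def] by (simp only: mult_1_left add_diff_cancel_right')
qed

lemma arsinh_primitive_convex:
  assumes h: "0 < h"
  shows "arsinh_primitive h y - arsinh_primitive h x \<le> arsinh (y / h) * (y - x)"
proof (cases x y rule: linorder_cases)
  case less
  then obtain z where z: "x < z" "z < y" "arsinh_primitive h y - arsinh_primitive h x = (y - x) * arsinh (z / h)"
    using MVT2[of x y "arsinh_primitive h" "\<lambda>x. arsinh (x / h)"] arsinh_primitive_deriv[OF h] by blast
  then have "(y - x) * arsinh (z / h) \<le> (y - x) * arsinh (y / h)"
    using less h by (intro mult_left_mono arsinh_mono divide_right_mono) auto
  then show ?thesis using z by (simp add: mult.commute)
next
  case greater
  then obtain z where z: "y < z" "z < x" "arsinh_primitive h x - arsinh_primitive h y = (x - y) * arsinh (z / h)"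
    using MVT2[of y x "arsinh_primitive h" "\<lambda>x. arsinh (x / h)"] arsinh_primitive_deriv[OF h] by blast
  then have "(x - y) * arsinh (y / h) \<le> (x - y) * arsinh (z / h)"
    using greater h by (intro mult_left_mono arsinh_mono divide_right_mono) auto
  then show ?thesis using z by (simp add: algebra_simps)
qed simp

text \<open>Coercivity: for fixed \<open>x \<noteq> 0\<close> the left side tends to infinity as
  \<open>h\<close> tends to 0.\<close>

lemma arsinh_primitive_ge:
  assumes h: "0 < h"
  shows "\<bar>x\<bar> * (arsinh (\<bar>x\<bar> / h) - 1) \<le> arsinh_primitive h x + h"
proof -
  have "sqrt (x\<^sup>2 + h\<^sup>2) \<le> \<bar>x\<bar> + h"
    using h by (intro real_le_lsqrt) (auto simp: power2_eq_square algebra_simps)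
  moreover have "x * arsinh (x / h) = \<bar>x\<bar> * arsinh (\<bar>x\<bar> / h)"
    by (cases "0 \<le> x") (auto simp: minus_divide_left[symmetric] arsinh_minus_real)
  ultimately show ?thesis unfolding arsinh_primitive_def by (simp add: algebra_simps)
qed

text \<open>The witness \<open>w\<close> is the difference of the integrated drifts, that is
  \<open>y - z\<close> without the two errors. It is absolutely continuous, as the chain rule
  requires, whereas the dissipation estimate holds along the true difference \<open>d\<close>; the
  two differ by at most \<open>2 * \<epsilon>\<close>. The term \<open>8 * K\<close> is the cost of
  this mismatch: a factor 4 times the integrated drifts of both paths, each bounded by
  \<open>K\<close>.\<close>

lemma perturbed_solutions_close_aux:
  assumes y: "perturbed_solution \<alpha> N a T \<epsilon> y" and z: "perturbed_solution \<alpha> N a T \<epsilon> z"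
    and \<epsilon>: "0 < \<epsilon>" "\<epsilon> \<le> 1" "\<epsilon> \<le> h" and \<alpha>: "0 \<le> \<alpha>" and T: "0 \<le> T"
    and a: "\<And>i. i \<in> {1..N} \<Longrightarrow> 0 \<le> a i"
  defines "K \<equiv> N * \<alpha> * T + 2 * real N * ((\<Sum>i=1..N. a i) + 2 * real N + (N * \<alpha> + (real N)\<^sup>2) * T)"
  assumes k: "k \<in> {1..N}"
  shows "\<exists>w. \<bar>y k T - z k T - w\<bar> \<le> 2 * \<epsilon> \<and> \<bar>w\<bar> * (arsinh (\<bar>w\<bar> / h) - 1) \<le> (real N)\<^sup>2 * T + 8 * K"
proof -
  have h: "0 < h" using \<epsilon> by simp
  define f where "f i s = laguerre_drift \<alpha> N (\<lambda>j. y j s) i" for i s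
  define e where "e i s = laguerre_drift \<alpha> N (\<lambda>j. z j s) i" for i s
  define g where "g i s = f i s - e i s" for i s
  define d where "d i s = y i s - z i s" for i s
  define w where "w i t = (LBINT s:{0..t}. g i s)" for i t
  have intf: "set_integrable lborel {0..T} (f i)" and inte: "set_integrable lborel {0..T} (e i)"
    if "i \<in> {1..N}" for i
    using y z that unfolding perturbed_solution_def f_def e_def by blast+
  have intg: "set_integrable lborel {0..T} (g i)" if "i \<in> {1..N}" for i
    unfolding g_def using intf inte that by (intro set_integral_diff(1)) auto
  have dw: "\<bar>d i t - w i t\<bar> \<le> 2 * \<epsilon>" if "i \<in> {1..N}" "t \<in> {0..T}" for i t
  proof -
    have "\<bar>y i t - a i - (LBINT s:{0..t}. f i s)\<bar> \<le> \<epsilon>" "\<bar>z i t - a i - (LBINT s:{0..t}. e i s)\<bar> \<le> \<epsilon>"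
      using y z that unfolding perturbed_solution_def f_def e_def by blast+
    moreover have "w i t = (LBINT s:{0..t}. f i s) - (LBINT s:{0..t}. e i s)"
      unfolding w_def g_def using that
      by (intro set_integral_diff(2) set_integrable_subset[OF intf] set_integrable_subset[OF inte]) auto
    ultimately show ?thesis unfolding d_def by linarith
  qed
  have dc: "continuous_on {0..T} (\<lambda>s. arsinh (d i s / h))" if "i \<in> {1..N}" for i
  proof -
    have "continuous_on {0..T} (y i)" "continuous_on {0..T} (z i)"
      using y z that unfolding perturbed_solution_def by blast+
    then show ?thesis using h unfolding d_def by (intro continuous_intros) auto
  qed
  have pg: "set_integrable lborel {0..T} (\<lambda>s. arsinh (d i s / h) * g i s)" if "i \<in> {1..N}" for i
    by (rule set_integrable_continuous_mult[OF dc[OF that] intg[OF that]])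
  have lip: "\<bar>arsinh (u / h) - arsinh (v / h)\<bar> \<le> (1 / h) * \<bar>u - v\<bar>" for u v
    using arsinh_lipschitz[of "u / h" "v / h"] h by (simp add: diff_divide_distrib[symmetric])
  have arith: "u - u0 \<le> p + x \<Longrightarrow> x \<le> 4 * q \<Longrightarrow> q \<le> r \<Longrightarrow> r = v + v' \<Longrightarrow> u0 = - h
    \<Longrightarrow> u + h \<le> p + 4 * (v + v')" for u u0 p x q r v v' :: real
    by simp
  have step: "arsinh_primitive h (w i T) + h \<le> (LBINT s:{0..T}. arsinh (d i s / h) * g i s)
      + 4 * ((LBINT s:{0..T}. \<bar>f i s\<bar>) + (LBINT s:{0..T}. \<bar>e i s\<bar>))" if i: "i \<in> {1..N}" for i
  proof -
    have "arsinh_primitive h (w i T) - arsinh_primitive h 0 \<le> (LBINT s:{0..T}. arsinh (d i s / h) * g i s)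
        + 2 * (1 / h) * (2 * \<epsilon>) * (LBINT s:{0..T}. \<bar>g i s\<bar>)"
      using h \<epsilon> T
      by (intro convex_chain_le arsinh_primitive_convex lip intg[OF i] pg[OF i] dw[OF i]) (auto simp: w_def)
    \<comment> \<open>Here \<open>1 / h\<close> is the Lipschitz constant and
      \<open>2 * \<epsilon>\<close> the mismatch; the condition \<open>\<epsilon> \<le> h\<close>
      makes the product independent of both.\<close>
    moreover have "2 * (1 / h) * (2 * \<epsilon>) * (LBINT s:{0..T}. \<bar>g i s\<bar>) \<le> 4 * (LBINT s:{0..T}. \<bar>g i s\<bar>)"
    proof (rule mult_right_mono)
      show "2 * (1 / h) * (2 * \<epsilon>) \<le> 4" using h \<epsilon> by (simp add: field_simps)
      show "0 \<le> (LBINT s:{0..T}. \<bar>g i s\<bar>)" unfolding set_lebesgue_integral_def by (intro Bochner_Integration.integral_nonneg) auto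
    qed
    moreover have "(LBINT s:{0..T}. \<bar>g i s\<bar>) \<le> (LBINT s:{0..T}. \<bar>f i s\<bar> + \<bar>e i s\<bar>)"
      using intg[OF i] intf[OF i] inte[OF i]
      by (intro set_integral_mono set_integral_add(1) set_integrable_abs) (auto simp: g_def)
    moreover have "(LBINT s:{0..T}. \<bar>f i s\<bar> + \<bar>e i s\<bar>) = (LBINT s:{0..T}. \<bar>f i s\<bar>) + (LBINT s:{0..T}. \<bar>e i s\<bar>)"
      using intf[OF i] inte[OF i] by (intro set_integral_add(2) set_integrable_abs)
    moreover have "arsinh_primitive h 0 = - h" using h by (simp add: arsinh_primitive_def)
    ultimately show ?thesis by (rule arith)
  qed
  have nonneg: "0 \<le> arsinh_primitive h v + h" for v
    using arsinh_primitive_convex[OF h, of 0 v] h by (simp add: arsinh_primitive_def)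
  \<comment> \<open>Dissipation is available only for the sum over all particles; nonnegativity of
    the summands gives back a single one.\<close>
  have "arsinh_primitive h (w k T) + h \<le> (\<Sum>i=1..N. arsinh_primitive h (w i T) + h)"
    using k nonneg by (intro member_le_sum) auto
  also have "\<dots> \<le> (\<Sum>i=1..N. (LBINT s:{0..T}. arsinh (d i s / h) * g i s)
      + 4 * ((LBINT s:{0..T}. \<bar>f i s\<bar>) + (LBINT s:{0..T}. \<bar>e i s\<bar>)))"
    by (intro sum_mono step)
  also have "\<dots> = (\<Sum>i=1..N. (LBINT s:{0..T}. arsinh (d i s / h) * g i s))
      + 4 * ((\<Sum>i=1..N. LBINT s:{0..T}. \<bar>f i s\<bar>) + (\<Sum>i=1..N. LBINT s:{0..T}. \<bar>e i s\<bar>))"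
    by (simp add: sum.distrib sum_distrib_left)
  also have "(\<Sum>i=1..N. (LBINT s:{0..T}. arsinh (d i s / h) * g i s))
      = (LBINT s:{0..T}. \<Sum>i=1..N. arsinh (d i s / h) * g i s)"
    by (intro set_lebesgue_integral_sum(2)[symmetric] pg)
  also have "\<dots> \<le> (real N)\<^sup>2 * T"
  proof (intro set_lebesgue_integral_le_const set_lebesgue_integral_sum(1) pg T)
    show "AE s in lborel. s \<in> {0..T} \<longrightarrow> (\<Sum>i=1..N. arsinh (d i s / h) * g i s) \<le> (real N)\<^sup>2"
      using perturbed_solution_ordered[OF y] perturbed_solution_ordered[OF z]
      unfolding g_def f_def e_def d_def
      by eventually_elim (use drift_dissipation[OF _ _ h] in fastforce)
  qed
  also have "(\<Sum>i=1..N. LBINT s:{0..T}. \<bar>f i s\<bar>) \<le> K"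
    unfolding K_def f_def by (rule perturbed_solution_abs_drift[OF y \<epsilon>(2) \<alpha> T]) (rule a)
  also have "(\<Sum>i=1..N. LBINT s:{0..T}. \<bar>e i s\<bar>) \<le> K"
    unfolding K_def e_def by (rule perturbed_solution_abs_drift[OF z \<epsilon>(2) \<alpha> T]) (rule a)
  finally have "arsinh_primitive h (w k T) + h \<le> (real N)\<^sup>2 * T + 8 * K" by simp
  then have "\<bar>w k T\<bar> * (arsinh (\<bar>w k T\<bar> / h) - 1) \<le> (real N)\<^sup>2 * T + 8 * K"
    using arsinh_primitive_ge[OF h, of "w k T"] by linarith
  then show ?thesis using dw[OF k, of T] T unfolding d_def by auto
qed

lemma perturbed_solutions_close:
  assumes \<alpha>: "0 \<le> \<alpha>" and T: "0 \<le> T" and \<rho>: "0 < \<rho>" and a: "\<And>i. i \<in> {1..N} \<Longrightarrow> 0 \<le> a i"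
  obtains \<epsilon> where "0 < \<epsilon>"
    "\<And>y z i t. perturbed_solution \<alpha> N a T \<epsilon> y \<Longrightarrow> perturbed_solution \<alpha> N a T \<epsilon> z \<Longrightarrow>
       i \<in> {1..N} \<Longrightarrow> t \<in> {0..T} \<Longrightarrow> \<bar>y i t - z i t\<bar> \<le> \<rho>"
proof -
  define K where "K T = N * \<alpha> * T + 2 * real N * ((\<Sum>i=1..N. a i) + 2 * real N + (N * \<alpha> + (real N)\<^sup>2) * T)" for T
  define C where "C = (real N)\<^sup>2 * T + 8 * K T"
  have K_mono: "K t \<le> K T" if "t \<le> T" for t
    unfolding K_def using that \<alpha> by (intro add_mono mult_left_mono) auto
  have "0 \<le> K T" unfolding K_def using \<alpha> T a by (intro add_nonneg_nonneg mult_nonneg_nonneg sum_nonneg) auto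
  then have C0: "0 \<le> C" unfolding C_def using T by simp
  \<comment> \<open>Chosen so that \<open>arsinh (\<rho> / 2 / h) - 1 = 1 + 2 * C / \<rho>\<close>:
    a value \<open>\<bar>w\<bar> \<ge> \<rho> / 2\<close> would then give at least
    \<open>\<rho> / 2 + C\<close>, contradicting the bound \<open>C\<close>. The remaining
    \<open>\<rho> / 2\<close> is spent on \<open>2 * \<epsilon>\<close>, hence
    \<open>\<epsilon> \<le> \<rho> / 4\<close>.\<close>
  define S where "S = sinh (2 + 2 * C / \<rho>)"
  have S: "S > 0" unfolding S_def using C0 \<rho> by (simp add: add_pos_nonneg)
  define h where "h = \<rho> / (2 * S)"
  have h: "0 < h" unfolding h_def using S \<rho> by simp
  have ash: "arsinh (\<rho> / 2 / h) = 2 + 2 * C / \<rho>"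
    unfolding h_def using \<rho> S by (simp add: S_def arsinh_sinh_real)
  define \<epsilon> where "\<epsilon> = min 1 (min h (\<rho> / 4))"
  have \<epsilon>: "0 < \<epsilon>" "\<epsilon> \<le> 1" "\<epsilon> \<le> h" "\<epsilon> \<le> \<rho> / 4" using h \<rho> unfolding \<epsilon>_def by auto
  show ?thesis
  proof (rule that[OF \<epsilon>(1)])
    fix y z i t
    assume y: "perturbed_solution \<alpha> N a T \<epsilon> y" and z: "perturbed_solution \<alpha> N a T \<epsilon> z"
      and i: "i \<in> {1..N}" and t: "t \<in> {0..T}"
    \<comment> \<open>The auxiliary estimate concerns the final time only, so it is applied with
      horizon \<open>t\<close>; since the constant is monotone in the horizon, \<open>h\<close> and
      \<open>\<epsilon>\<close> need not depend on \<open>t\<close>.\<close>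
    have "\<exists>w. \<bar>y i t - z i t - w\<bar> \<le> 2 * \<epsilon> \<and> \<bar>w\<bar> * (arsinh (\<bar>w\<bar> / h) - 1) \<le> (real N)\<^sup>2 * t + 8 * K t"
      unfolding K_def using t a
      by (intro perturbed_solutions_close_aux[OF _ _ \<epsilon>(1-3) \<alpha> _ _ i]
          perturbed_solution_mono[OF y] perturbed_solution_mono[OF z]) auto
    then obtain w where w: "\<bar>y i t - z i t - w\<bar> \<le> 2 * \<epsilon>"
      "\<bar>w\<bar> * (arsinh (\<bar>w\<bar> / h) - 1) \<le> (real N)\<^sup>2 * t + 8 * K t" by blast
    have "(real N)\<^sup>2 * t + 8 * K t \<le> C"
      unfolding C_def using K_mono[of t] t by (intro add_mono mult_left_mono) auto
    then have wC: "\<bar>w\<bar> * (arsinh (\<bar>w\<bar> / h) - 1) \<le> C" using w by linarith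
    have "\<bar>w\<bar> < \<rho> / 2"
    proof (rule ccontr)
      assume "\<not> \<bar>w\<bar> < \<rho> / 2"
      then have ge: "\<rho> / 2 \<le> \<bar>w\<bar>" by simp
      have "1 + 2 * C / \<rho> \<le> arsinh (\<bar>w\<bar> / h) - 1"
        using arsinh_mono[OF divide_right_mono[OF ge, of h]] h ash by simp
      then have "\<rho> / 2 * (1 + 2 * C / \<rho>) \<le> \<bar>w\<bar> * (arsinh (\<bar>w\<bar> / h) - 1)"
        using ge \<rho> C0 by (intro mult_mono) auto
      moreover have "\<rho> / 2 * (1 + 2 * C / \<rho>) = \<rho> / 2 + C" using \<rho> by (simp add: field_simps)
      ultimately show False using wC \<rho> by linarith
    qed
    then show "\<bar>y i t - z i t\<bar> \<le> \<rho>" using w(1) \<epsilon>(4) by linarith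
  qed
qed

text \<open>By stability, perturbed solutions with vanishing error form a Cauchy sequence uniformly
  on compact intervals. Comparing any perturbed solution with the sequence and letting the index
  tend to infinity puts the limit \<open>x\<close> in the place of the second solution.\<close>

lemma perturbed_solution_limit:
  assumes \<alpha>: "0 \<le> \<alpha>" and a: "\<And>i. i \<in> {1..N} \<Longrightarrow> 0 \<le> a i"
    and ex: "\<And>T \<epsilon>. 0 < T \<Longrightarrow> 0 < \<epsilon> \<Longrightarrow> \<exists>y. perturbed_solution \<alpha> N a T \<epsilon> y"
  obtains x where "\<And>i. i \<in> {1..N} \<Longrightarrow> continuous_on {0..} (x i)"
    "\<And>T \<rho>. 0 < T \<Longrightarrow> 0 < \<rho> \<Longrightarrow> \<exists>\<epsilon>>0. \<forall>y. perturbed_solution \<alpha> N a T \<epsilon> y \<longrightarrow>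
       (\<forall>i\<in>{1..N}. \<forall>t\<in>{0..T}. \<bar>y i t - x i t\<bar> \<le> \<rho>)"
proof -
  \<comment> \<open>Horizon and accuracy improve together, so one sequence serves every
    \<open>T\<close> and every error from some index on.\<close>
  have "\<forall>n::nat. \<exists>y. perturbed_solution \<alpha> N a (Suc n) (1 / Suc n) y" using ex by simp
  then obtain Y where Y: "\<And>n. perturbed_solution \<alpha> N a (Suc n) (1 / Suc n) (Y n)" by metis
  have Y': "\<forall>\<^sub>F n in sequentially. perturbed_solution \<alpha> N a T \<epsilon> (Y n)" if "0 < \<epsilon>" for T \<epsilon>
  proof -
    have "\<forall>\<^sub>F n in sequentially. T \<le> real (Suc n)"
      by real_asymp
    moreover have "\<forall>\<^sub>F n in sequentially. 1 / real (Suc n) \<le> \<epsilon>"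
      using that by real_asymp
    ultimately show ?thesis by eventually_elim (rule perturbed_solution_mono[OF Y])
  qed
  have close: "\<exists>n0. \<forall>n\<ge>n0. \<forall>m\<ge>n0. \<forall>i\<in>{1..N}. \<forall>t\<in>{0..T}. \<bar>Y m i t - Y n i t\<bar> \<le> \<rho>"
    if T: "0 \<le> T" "0 < \<rho>" for T \<rho>
  proof -
    obtain \<epsilon> where \<epsilon>: "0 < \<epsilon>" "\<And>y z i t. perturbed_solution \<alpha> N a T \<epsilon> y \<Longrightarrow> perturbed_solution \<alpha> N a T \<epsilon> z \<Longrightarrow>
       i \<in> {1..N} \<Longrightarrow> t \<in> {0..T} \<Longrightarrow> \<bar>y i t - z i t\<bar> \<le> \<rho>"
      using perturbed_solutions_close[OF \<alpha> T, of N a] a by blast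
    then show ?thesis using Y'[OF \<epsilon>(1), of T] unfolding eventually_sequentially by blast
  qed
  define x where "x i t = lim (\<lambda>n. Y n i t)" for i t
  have conv: "(\<lambda>n. Y n i t) \<longlonglongrightarrow> x i t" if "i \<in> {1..N}" "0 \<le> t" for i t
  proof -
    have "Cauchy (\<lambda>n. Y n i t)"
    proof (rule metric_CauchyI)
      fix e :: real assume e: "0 < e"
      obtain n0 where n0: "\<forall>n\<ge>n0. \<forall>m\<ge>n0. \<forall>i\<in>{1..N}. \<forall>t\<in>{0..t}. \<bar>Y m i t - Y n i t\<bar> \<le> e / 2"
        using close[of t "e / 2"] \<open>0 \<le> t\<close> e by auto
      have "dist (Y m i t) (Y n i t) < e" if "m \<ge> n0" "n \<ge> n0" for m n
      proof -
        have "\<bar>Y m i t - Y n i t\<bar> \<le> e / 2"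
          using n0 that \<open>i \<in> {1..N}\<close> \<open>0 \<le> t\<close> by (meson atLeastAtMost_iff order_refl)
        then show ?thesis using e unfolding dist_real_def by linarith
      qed
      then show "\<exists>M. \<forall>m\<ge>M. \<forall>n\<ge>M. dist (Y m i t) (Y n i t) < e" by blast
    qed
    then show ?thesis unfolding x_def using Cauchy_convergent_iff convergent_LIMSEQ_iff by blast
  qed
  have unif: "\<exists>n0. \<forall>n\<ge>n0. \<forall>i\<in>{1..N}. \<forall>t\<in>{0..T}. \<bar>Y n i t - x i t\<bar> \<le> \<rho>" if T: "0 \<le> T" "0 < \<rho>" for T \<rho>
  proof -
    obtain n0 where n0: "\<forall>n\<ge>n0. \<forall>m\<ge>n0. \<forall>i\<in>{1..N}. \<forall>t\<in>{0..T}. \<bar>Y m i t - Y n i t\<bar> \<le> \<rho>"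
      using close[OF T] by blast
    have "\<bar>Y n i t - x i t\<bar> \<le> \<rho>" if "n \<ge> n0" "i \<in> {1..N}" "t \<in> {0..T}" for n i t
    proof -
      have "(\<lambda>m. \<bar>Y n i t - Y m i t\<bar>) \<longlonglongrightarrow> \<bar>Y n i t - x i t\<bar>"
        using that by (intro tendsto_intros conv) auto
      moreover have "\<forall>m\<ge>n0. \<bar>Y n i t - Y m i t\<bar> \<le> \<rho>" using n0 that by blast
      ultimately show ?thesis by (intro LIMSEQ_le_const2) auto
    qed
    then show ?thesis by blast
  qed
  show ?thesis
  proof (rule that)
    fix i assume i: "i \<in> {1..N}"
    have c: "continuous_on {0..T} (x i)" if T: "0 \<le> T" for T
    proof (rule uniform_limit_theorem[where F = sequentially and f = "\<lambda>n. Y n i"])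
      show "\<forall>\<^sub>F n in sequentially. continuous_on {0..T} (Y n i)"
        using Y'[OF zero_less_one, of T]
        by eventually_elim (use i in \<open>auto simp: perturbed_solution_def\<close>)
      show "uniform_limit {0..T} (\<lambda>n. Y n i) (x i) sequentially"
      proof (rule uniform_limitI)
        fix e :: real assume e: "0 < e"
        obtain n0 where n0: "\<forall>n\<ge>n0. \<forall>i\<in>{1..N}. \<forall>t\<in>{0..T}. \<bar>Y n i t - x i t\<bar> \<le> e / 2"
          using unif[OF T, of "e / 2"] e by auto
        have "\<forall>n\<ge>n0. \<forall>t\<in>{0..T}. dist (Y n i t) (x i t) < e"
          using n0 i e unfolding dist_real_def by (smt (verit) field_sum_of_halves)
        then show "\<forall>\<^sub>F n in sequentially. \<forall>t\<in>{0..T}. dist (Y n i t) (x i t) < e"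
          unfolding eventually_sequentially by blast
      qed
    qed simp
    show "continuous_on {0..} (x i)"
      unfolding continuous_on_eq_continuous_within
    proof
      fix t :: real assume t: "t \<in> {0..}"
      \<comment> \<open>Uniform convergence is known on bounded intervals only; continuity at
        \<open>t\<close> needs no more than a neighbourhood.\<close>
      have "at t within {0..} = at t within {0..t + 1}"
        using t by (intro at_within_nhd[of t "{..<t + 1}"]) auto
      moreover have "continuous (at t within {0..t + 1}) (x i)"
        using c[of "t + 1"] t unfolding continuous_on_eq_continuous_within by auto
      ultimately show "continuous (at t within {0..}) (x i)" by simp
    qed
  next
    fix T \<rho> :: real assume T: "0 < T" and \<rho>: "0 < \<rho>"
    obtain \<epsilon> where \<epsilon>: "0 < \<epsilon>" "\<And>y z i t. perturbed_solution \<alpha> N a T \<epsilon> y \<Longrightarrow> perturbed_solution \<alpha> N a T \<epsilon> z \<Longrightarrow>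
       i \<in> {1..N} \<Longrightarrow> t \<in> {0..T} \<Longrightarrow> \<bar>y i t - z i t\<bar> \<le> \<rho>"
      using perturbed_solutions_close[OF \<alpha> less_imp_le[OF T] \<rho>, of N a] a by blast
    obtain n0 where n0: "\<forall>n\<ge>n0. perturbed_solution \<alpha> N a T \<epsilon> (Y n)"
      using Y'[OF \<epsilon>(1), of T] unfolding eventually_sequentially by blast
    have "\<bar>y i t - x i t\<bar> \<le> \<rho>"
      if y: "perturbed_solution \<alpha> N a T \<epsilon> y" and i: "i \<in> {1..N}" and t: "t \<in> {0..T}" for y i t
    proof -
      have "(\<lambda>n. \<bar>y i t - Y n i t\<bar>) \<longlonglongrightarrow> \<bar>y i t - x i t\<bar>"
        using that by (intro tendsto_intros conv) auto
      moreover have "\<forall>n\<ge>n0. \<bar>y i t - Y n i t\<bar> \<le> \<rho>" using \<epsilon>(2)[OF y _ i t] n0 by blast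
      ultimately show ?thesis by (intro LIMSEQ_le_const2) auto
    qed
    then show "\<exists>\<epsilon>>0. \<forall>y. perturbed_solution \<alpha> N a T \<epsilon> y \<longrightarrow>
       (\<forall>i\<in>{1..N}. \<forall>t\<in>{0..T}. \<bar>y i t - x i t\<bar> \<le> \<rho>)" using \<epsilon>(1) by blast
  qed
qed

section \<open>Independence of Brownian increments from the past\<close>

text \<open>The definition of Brownian motion gives independence of increments along a finite grid.
  Sorting the cylinder times into such a grid turns the past values into partial sums of increments,
  which are independent of the last increment.\<close>

lemma brownian_past_cylinder_indep:
  assumes B: "standard_brownian_motion M B" and st: "0 \<le> s" "s < t"
    and J: "finite J" "J \<subseteq> {0..s}" and A: "\<And>r. r \<in> J \<Longrightarrow> A r \<in> sets borel" and C: "C \<in> sets borel"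
  shows "measure M {\<omega>\<in>space M. (\<forall>r\<in>J. B r \<omega> \<in> A r) \<and> B t \<omega> - B s \<omega> \<in> C}
    = measure M {\<omega>\<in>space M. \<forall>r\<in>J. B r \<omega> \<in> A r} * measure M {\<omega>\<in>space M. B t \<omega> - B s \<omega> \<in> C}"
proof -
  interpret prob_space M using B by (simp add: standard_brownian_motion_def)
  have meas: "B r \<in> borel_measurable M" if "0 \<le> r" for r
    using B that by (simp add: standard_brownian_motion_def)
  define A' where "A' r = (if r \<in> J then A r else UNIV)" for r
  have A': "A' r \<in> sets borel" for r using A by (simp add: A'_def)
  \<comment> \<open>With 0 as first grid point the partial sums are \<open>B r - B 0\<close>; with
    \<open>s\<close> as last one the next increment is the one from \<open>s\<close> to
    \<open>t\<close>.\<close>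
  define K where "K = insert 0 (insert s J)"
  have K: "finite K" "K \<subseteq> {0..s}" "0 \<in> K" "s \<in> K" using J st by (auto simp: K_def)
  define xs where "xs = sorted_list_of_set K"
  define n where "n = length xs"
  have xs: "sorted xs" "distinct xs" "set xs = K" using K by (auto simp: xs_def)
  have n: "n > 0" using xs K unfolding n_def by auto
  have nth_less: "xs ! i < xs ! j" if "i < j" "j < n" for i j
    using xs that sorted_nth_mono[OF xs(1), of i j] nth_eq_iff_index_eq[OF xs(2), of i j] unfolding n_def by force
  have nth_K: "xs ! i \<in> K" if "i < n" for i using xs that unfolding n_def by (metis nth_mem)
  have ex_nth: "\<exists>i<n. xs ! i = r" if "r \<in> K" for r using xs that unfolding n_def by (metis in_set_conv_nth)
  have x0: "xs ! 0 = 0"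
  proof -
    obtain i where i: "i < n" "xs ! i = 0" using ex_nth K by blast
    have "0 \<le> xs ! 0" using nth_K[OF n] K by auto
    then show ?thesis using nth_less[of 0 i] i by (cases "i = 0") auto
  qed
  have xl: "xs ! (n - 1) = s"
  proof -
    obtain i where i: "i < n" "xs ! i = s" using ex_nth K by blast
    have "xs ! (n - 1) \<le> s" using nth_K[of "n - 1"] n K by auto
    moreover have "i < n - 1 \<or> i = n - 1" using i by linarith
    ultimately show ?thesis using nth_less[of i "n - 1"] i by auto
  qed
  \<comment> \<open>The point after the grid is \<open>\<tau> n = t\<close>, so the increment with
    index \<open>n - 1\<close> runs from \<open>s\<close> to \<open>t\<close>.\<close>
  define \<tau> where "\<tau> k = (if k < n then xs ! k else t + real (k - n))" for k
  have \<tau>0: "0 \<le> \<tau> 0" using n x0 by (simp add: \<tau>_def)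
  have \<tau>_mono: "\<tau> k < \<tau> (Suc k)" if "k < n" for k
  proof (cases "Suc k < n")
    case False
    then have "k = n - 1" using that by simp
    then show ?thesis using n xl st by (auto simp: \<tau>_def)
  qed (use nth_less in \<open>auto simp: \<tau>_def\<close>)
  define D where "D k \<omega> = B (\<tau> (Suc k)) \<omega> - B (\<tau> k) \<omega>" for k \<omega>
  have ind: "indep_vars (\<lambda>_. borel) D {..<n}"
    using B \<tau>0 \<tau>_mono unfolding standard_brownian_motion_def D_def[abs_def] by blast
  have Dl: "D (n - 1) \<omega> = B t \<omega> - B s \<omega>" for \<omega>
    using n xl by (simp add: D_def \<tau>_def)
  have tele: "(\<Sum>j<k. D j \<omega>) = B (xs ! k) \<omega> - B 0 \<omega>" if "k < n" for k \<omega>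
    unfolding D_def sum_lessThan_telescope[of "\<lambda>j. B (\<tau> j) \<omega>"] using that n x0 by (simp add: \<tau>_def)
  define S where "S = {f \<in> space (PiM {..<n - 1} (\<lambda>_. borel :: real measure)). \<forall>k<n. (\<Sum>j<k. f j) \<in> A' (xs ! k)}"
  have S: "S \<in> sets (PiM {..<n - 1} (\<lambda>_. borel))"
  proof -
    have "{f \<in> space (PiM {..<n - 1} (\<lambda>_. borel :: real measure)). \<forall>k\<in>{..<n}. (\<Sum>j<k. f j) \<in> A' (xs ! k)}
      \<in> sets (PiM {..<n - 1} (\<lambda>_. borel))"
    proof (intro sets.sets_Collect_finite_All)
      fix k assume k: "k \<in> {..<n}"
      have "(\<lambda>f. \<Sum>j<k. f j) \<in> borel_measurable (PiM {..<n - 1} (\<lambda>_. borel :: real measure))"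
        using k by (intro borel_measurable_sum measurable_component_singleton) auto
      from measurable_sets[OF this A'[of "xs ! k"]]
      show "{f \<in> space (PiM {..<n - 1} (\<lambda>_. borel :: real measure)). (\<Sum>j<k. f j) \<in> A' (xs ! k)}
        \<in> sets (PiM {..<n - 1} (\<lambda>_. borel))" by (simp add: vimage_def Int_def conj_commute)
    qed simp
    then show ?thesis unfolding S_def by (simp only: Ball_def lessThan_iff)
  qed
  define R where "R = {f \<in> space (PiM {n - 1} (\<lambda>_. borel :: real measure)). f (n - 1) \<in> C}"
  have R: "R \<in> sets (PiM {n - 1} (\<lambda>_. borel))"
  proof -
    have "(\<lambda>f. f (n - 1)) \<in> borel_measurable (PiM {n - 1} (\<lambda>_. borel :: real measure))"
      by (intro measurable_component_singleton) auto
    from measurable_sets[OF this C] show ?thesis unfolding R_def by (simp add: vimage_def Int_def conj_commute)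
  qed
  have "indep_var (PiM {..<n - 1} (\<lambda>_. borel)) (\<lambda>\<omega>. restrict (\<lambda>i. D i \<omega>) {..<n - 1})
      (PiM {n - 1} (\<lambda>_. borel)) (\<lambda>\<omega>. restrict (\<lambda>i. D i \<omega>) {n - 1})"
    using n by (intro indep_var_restrict[OF ind]) auto
  note eq = indep_varD[OF this S R]
  have Smem: "restrict (\<lambda>i. D i \<omega>) {..<n - 1} \<in> S \<longleftrightarrow> (\<forall>k<n. B (xs ! k) \<omega> - B 0 \<omega> \<in> A' (xs ! k))" for \<omega>
  proof -
    have "(\<Sum>j<k. restrict (\<lambda>i. D i \<omega>) {..<n - 1} j) = B (xs ! k) \<omega> - B 0 \<omega>" if "k < n" for k
      using that tele[OF that, of \<omega>] by (subst sum.cong[OF refl, of _ _ "\<lambda>j. D j \<omega>"]) auto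
    then show ?thesis unfolding S_def by (auto simp: space_PiM)
  qed
  have Rmem: "restrict (\<lambda>i. D i \<omega>) {n - 1} \<in> R \<longleftrightarrow> B t \<omega> - B s \<omega> \<in> C" for \<omega>
    unfolding R_def using Dl by (auto simp: space_PiM)
  have eq': "measure M {\<omega>\<in>space M. (\<forall>k<n. B (xs ! k) \<omega> - B 0 \<omega> \<in> A' (xs ! k)) \<and> B t \<omega> - B s \<omega> \<in> C}
    = measure M {\<omega>\<in>space M. \<forall>k<n. B (xs ! k) \<omega> - B 0 \<omega> \<in> A' (xs ! k)}
      * measure M {\<omega>\<in>space M. B t \<omega> - B s \<omega> \<in> C}"
    using eq by (simp add: vimage_def Int_def Smem[unfolded One_nat_def] Rmem[unfolded One_nat_def] conj_commute)
  \<comment> \<open>The start at 0 holds almost surely only, so the events expressed by increments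
    and by values agree up to a null set. Grid points outside \<open>J\<close> carry the trivial
    condition \<open>UNIV\<close>.\<close>
  have all_eq: "(\<forall>k<n. B (xs ! k) \<omega> - 0 \<in> A' (xs ! k)) \<longleftrightarrow> (\<forall>r\<in>J. B r \<omega> \<in> A r)" for \<omega>
  proof -
    have "(\<forall>k<n. B (xs ! k) \<omega> - 0 \<in> A' (xs ! k)) \<longleftrightarrow> (\<forall>r\<in>K. B r \<omega> \<in> A' r)"
      using nth_K ex_nth by (metis diff_zero)
    then show ?thesis unfolding K_def A'_def by auto
  qed
  have B0: "AE \<omega> in M. B 0 \<omega> = 0" using B by (simp add: standard_brownian_motion_def)
  have mJ: "{\<omega>\<in>space M. B r \<omega> \<in> A r} \<in> events" if "r \<in> J" for r
    using measurable_sets[OF meas A, of r r] that J by (auto simp: vimage_def Int_def conj_commute)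
  have mK: "{\<omega>\<in>space M. B (xs ! k) \<omega> - B 0 \<omega> \<in> A' (xs ! k)} \<in> events" if "k < n" for k
  proof -
    have "(\<lambda>\<omega>. B (xs ! k) \<omega> - B 0 \<omega>) \<in> borel_measurable M"
      using nth_K[OF that] K by (intro borel_measurable_diff meas) auto
    from measurable_sets[OF this A'] show ?thesis by (simp add: vimage_def Int_def conj_commute)
  qed
  have mC: "{\<omega>\<in>space M. B t \<omega> - B s \<omega> \<in> C} \<in> events"
  proof -
    have "(\<lambda>\<omega>. B t \<omega> - B s \<omega>) \<in> borel_measurable M"
      using st by (intro borel_measurable_diff meas) auto
    from measurable_sets[OF this C] show ?thesis by (simp add: vimage_def Int_def conj_commute)
  qed
  have m1: "{\<omega>\<in>space M. \<forall>r\<in>J. B r \<omega> \<in> A r} \<in> events"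
    using mJ J by (intro sets.sets_Collect_finite_All) auto
  have "{\<omega>\<in>space M. \<forall>k\<in>{..<n}. B (xs ! k) \<omega> - B 0 \<omega> \<in> A' (xs ! k)} \<in> events"
    using mK by (intro sets.sets_Collect_finite_All) auto
  then have m2: "{\<omega>\<in>space M. \<forall>k<n. B (xs ! k) \<omega> - B 0 \<omega> \<in> A' (xs ! k)} \<in> events"
    by (simp only: Ball_def lessThan_iff)
  have "measure M {\<omega>\<in>space M. \<forall>k<n. B (xs ! k) \<omega> - B 0 \<omega> \<in> A' (xs ! k)}
      = measure M {\<omega>\<in>space M. \<forall>r\<in>J. B r \<omega> \<in> A r}"
    using B0 by (intro measure_eq_AE m1 m2) (auto simp: all_eq[symmetric] elim!: eventually_mono)
  moreover have "measure M {\<omega>\<in>space M. (\<forall>k<n. B (xs ! k) \<omega> - B 0 \<omega> \<in> A' (xs ! k)) \<and> B t \<omega> - B s \<omega> \<in> C}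
      = measure M {\<omega>\<in>space M. (\<forall>r\<in>J. B r \<omega> \<in> A r) \<and> B t \<omega> - B s \<omega> \<in> C}"
    using B0 by (intro measure_eq_AE sets.sets_Collect_conj m1 m2 mC)
      (auto simp: all_eq[symmetric] elim!: eventually_mono)
  ultimately show ?thesis using eq' by simp
qed

text \<open>A Dynkin class argument. On cylinders, independence of the whole paths factorizes over
  the family, and only the factor of index \<open>i\<close> meets the increment; that factor is the
  preceding lemma.\<close>

lemma brownian_filtration_increment_indep:
  assumes b: "independent_brownian_motions M I b" and I: "finite I" "i \<in> I" and st: "0 \<le> s" "s < t"
    and A: "A \<in> sets (brownian_filtration M I b s)" and C: "C \<in> sets borel"
  shows "measure M (A \<inter> {\<omega>\<in>space M. b i t \<omega> - b i s \<omega> \<in> C})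
    = measure M A * measure M {\<omega>\<in>space M. b i t \<omega> - b i s \<omega> \<in> C}"
proof -
  interpret prob_space M using b by (simp add: independent_brownian_motions_def)
  have B: "standard_brownian_motion M (b j)" if "j \<in> I" for j
    using b that by (simp add: independent_brownian_motions_def)
  have meas: "b j r \<in> borel_measurable M" if "j \<in> I" "0 \<le> r" for j r
    using B that by (simp add: standard_brownian_motion_def)
  have ind: "indep_vars (\<lambda>_. PiM {0..} (\<lambda>_. borel)) (\<lambda>j \<omega>. \<lambda>r\<in>{0..}. b j r \<omega>) I"
    using b by (simp add: independent_brownian_motions_def)
  define D where "D = {\<omega>\<in>space M. b i t \<omega> - b i s \<omega> \<in> C}"
  have mD: "D \<in> events"
  proof -
    have "(\<lambda>\<omega>. b i t \<omega> - b i s \<omega>) \<in> borel_measurable M"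
      using st I by (intro borel_measurable_diff meas) auto
    from measurable_sets[OF this C] show ?thesis unfolding D_def by (simp add: vimage_def Int_def conj_commute)
  qed
  define cyl where "cyl J A = {\<omega>\<in>space M. \<forall>j\<in>I. \<forall>r\<in>J. b j r \<omega> \<in> A j r}" for J :: "real set" and A :: "'b \<Rightarrow> real \<Rightarrow> real set"
  define G where "G = null_sets M \<union>
    {cyl J A | J A. finite J \<and> J \<subseteq> {0..s} \<and> (\<forall>j\<in>I. \<forall>r\<in>J. A j r \<in> sets borel)}"
  have cyl_path: "{f \<in> space (PiM {0..} (\<lambda>_. borel :: real measure)). \<forall>r\<in>J. f r \<in> A r}
      \<in> sets (PiM {0..} (\<lambda>_. borel))"
    if "finite J" "J \<subseteq> {0..s}" "\<And>r. r \<in> J \<Longrightarrow> A r \<in> sets borel" for J :: "real set" and A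
  proof (intro sets.sets_Collect_finite_All)
    fix r assume r: "r \<in> J"
    have "(\<lambda>f. f r) \<in> borel_measurable (PiM {0..} (\<lambda>_. borel :: real measure))"
      using r that by (intro measurable_component_singleton) auto
    from measurable_sets[OF this that(3)[OF r]]
    show "{f \<in> space (PiM {0..} (\<lambda>_. borel :: real measure)). f r \<in> A r} \<in> sets (PiM {0..} (\<lambda>_. borel))"
      by (simp add: vimage_def Int_def conj_commute)
  qed (use that in simp)
  have cyl_M: "cyl J A \<in> events" if "finite J" "J \<subseteq> {0..s}" "\<And>j r. j \<in> I \<Longrightarrow> r \<in> J \<Longrightarrow> A j r \<in> sets borel" for J A
    unfolding cyl_def
  proof (intro sets.sets_Collect_finite_All)
    fix j r assume "j \<in> I" "r \<in> J"
    then show "{\<omega>\<in>space M. b j r \<omega> \<in> A j r} \<in> events"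
      using measurable_sets[OF meas that(3), of j r j r] that(2) by (auto simp: vimage_def Int_def conj_commute)
  qed (use that I in auto)
  have cyl_eq: "measure M (cyl J A \<inter> D) = measure M (cyl J A) * measure M D"
    if J: "finite J" "J \<subseteq> {0..s}" "\<And>j r. j \<in> I \<Longrightarrow> r \<in> J \<Longrightarrow> A j r \<in> sets borel" for J A
  proof -
    define E where "E j = {f \<in> space (PiM {0..} (\<lambda>_. borel :: real measure)). \<forall>r\<in>J. f r \<in> A j r}" for j
    define X where "X j \<omega> = (\<lambda>r\<in>{0..}. b j r \<omega>)" for j \<omega>
    have E: "E j \<in> sets (PiM {0..} (\<lambda>_. borel))" if "j \<in> I" for j
      unfolding E_def using that J by (intro cyl_path) auto
    define V where "V = {f \<in> space (PiM {0..} (\<lambda>_. borel :: real measure)). f t - f s \<in> C}"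
    have V: "V \<in> sets (PiM {0..} (\<lambda>_. borel))"
    proof -
      have "(\<lambda>f. f t - f s) \<in> borel_measurable (PiM {0..} (\<lambda>_. borel :: real measure))"
        using st by (intro borel_measurable_diff measurable_component_singleton) auto
      from measurable_sets[OF this C] show ?thesis unfolding V_def by (simp add: vimage_def Int_def conj_commute)
    qed
    have XE: "X j -` E j \<inter> space M = {\<omega>\<in>space M. \<forall>r\<in>J. b j r \<omega> \<in> A j r}" for j
      using J(2) unfolding X_def E_def by (auto simp: space_PiM)
    have XV: "X i -` V \<inter> space M = D" using st unfolding X_def V_def D_def by (auto simp: space_PiM)
    have one: "prob (X i -` (E i \<inter> V) \<inter> space M) = prob (X i -` E i \<inter> space M) * prob D"
    proof -
      have "X i -` (E i \<inter> V) \<inter> space M = (X i -` E i \<inter> space M) \<inter> (X i -` V \<inter> space M)" by auto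
      also have "\<dots> = {\<omega>\<in>space M. (\<forall>r\<in>J. b i r \<omega> \<in> A i r) \<and> b i t \<omega> - b i s \<omega> \<in> C}"
        unfolding XE XV D_def by auto
      finally show ?thesis
        using brownian_past_cylinder_indep[OF B[OF I(2)] st J(1,2) J(3)[OF I(2)] C] unfolding XE D_def by simp
    qed
    have ind': "indep_vars (\<lambda>_. PiM {0..} (\<lambda>_. borel)) X I" using ind unfolding X_def .
    have c: "cyl J A = (\<Inter>j\<in>I. X j -` E j \<inter> space M)" unfolding XE cyl_def using I by auto
    have p1: "prob (cyl J A) = (\<Prod>j\<in>I. prob (X j -` E j \<inter> space M))"
      unfolding c by (rule indep_varsD[OF ind']) (use I E in auto)
    \<comment> \<open>The increment event is itself an event of the path with index
      \<open>i\<close>, so intersecting with it alters a single factor of the product.\<close>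
    define E' where "E' j = (if j = i then E j \<inter> V else E j)" for j
    have "cyl J A \<inter> D = (\<Inter>j\<in>I. X j -` E j \<inter> space M) \<inter> (X i -` V \<inter> space M)"
      unfolding XV unfolding XE cyl_def using I by auto
    also have "\<dots> = (\<Inter>j\<in>I. X j -` E' j \<inter> space M)" unfolding E'_def using I by (auto split: if_splits)
    finally have "prob (cyl J A \<inter> D) = prob (\<Inter>j\<in>I. X j -` E' j \<inter> space M)" by simp
    also have "\<dots> = (\<Prod>j\<in>I. prob (X j -` E' j \<inter> space M))"
      by (rule indep_varsD[OF ind']) (use I E V in \<open>auto simp: E'_def\<close>)
    also have "\<dots> = prob (X i -` E' i \<inter> space M) * (\<Prod>j\<in>I - {i}. prob (X j -` E' j \<inter> space M))"
      using I by (simp add: prod.remove)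
    also have "\<dots> = prob D * (prob (X i -` E i \<inter> space M) * (\<Prod>j\<in>I - {i}. prob (X j -` E j \<inter> space M)))"
      using one by (simp add: E'_def)
    also have "\<dots> = prob D * prob (cyl J A)"
      unfolding p1 using I by (simp add: prod.remove)
    finally show ?thesis by simp
  qed
  have GM: "G \<subseteq> events" unfolding G_def using cyl_M by auto
  have G_int: "Int_stable G"
  proof (rule Int_stableI)
    fix a c assume ac: "a \<in> G" "c \<in> G"
    then have acM: "a \<in> events" "c \<in> events" using GM by auto
    show "a \<inter> c \<in> G"
    proof (cases "a \<in> null_sets M \<or> c \<in> null_sets M")
      case True
      then have "a \<inter> c \<in> null_sets M" using acM null_set_Int1 null_set_Int2 by blast
      then show ?thesis unfolding G_def by simp
    next
      case False
      then obtain J A J' A' where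
        J: "a = cyl J A" "finite J" "J \<subseteq> {0..s}" "\<forall>j\<in>I. \<forall>r\<in>J. A j r \<in> sets borel" and
        J': "c = cyl J' A'" "finite J'" "J' \<subseteq> {0..s}" "\<forall>j\<in>I. \<forall>r\<in>J'. A' j r \<in> sets borel"
        using ac unfolding G_def by blast
      define A2 where "A2 j r = (if r \<in> J then A j r else UNIV) \<inter> (if r \<in> J' then A' j r else UNIV)" for j r
      have "a \<inter> c = cyl (J \<union> J') A2" unfolding J J' cyl_def A2_def by auto
      moreover have "\<forall>j\<in>I. \<forall>r\<in>J \<union> J'. A2 j r \<in> sets borel" using J J' unfolding A2_def by auto
      ultimately show ?thesis using J J' unfolding G_def by blast
    qed
  qed
  have GP: "G \<subseteq> Pow (space M)" using GM sets.sets_into_space by blast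
  have "A \<in> sigma_sets (space M) G"
  proof -
    have "sets (brownian_filtration M I b s) = sigma_sets (space M)
       (null_sets M \<union> {b i r -` A \<inter> space M | i r A. i \<in> I \<and> 0 \<le> r \<and> r \<le> s \<and> A \<in> sets borel})"
      unfolding brownian_filtration_def using sets.sets_into_space[of _ M] by (subst sets_measure_of) auto
    moreover have "null_sets M \<union> {b i r -` A \<inter> space M | i r A. i \<in> I \<and> 0 \<le> r \<and> r \<le> s \<and> A \<in> sets borel} \<subseteq> G"
    proof -
      have "b k r -` A \<inter> space M \<in> G" if "k \<in> I" "0 \<le> r" "r \<le> s" "A \<in> sets borel" for k r A
      proof -
        have "b k r -` A \<inter> space M = cyl {r} (\<lambda>j _. if j = k then A else UNIV)"
          using that unfolding cyl_def by (auto split: if_splits)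
        moreover have "\<forall>j\<in>I. \<forall>r'\<in>{r}. (if j = k then A else UNIV) \<in> sets borel" using that by auto
        ultimately show ?thesis using that unfolding G_def by fastforce
      qed
      then show ?thesis unfolding G_def by blast
    qed
    ultimately show ?thesis using A sigma_sets_mono' by blast
  qed
  then show ?thesis unfolding D_def[symmetric]
  proof (rule sigma_sets_induct_disjoint[where P = "\<lambda>a. prob (a \<inter> D) = prob a * prob D", OF G_int GP])
    fix a assume "a \<in> G"
    then consider "a \<in> null_sets M" | J A where "a = cyl J A" "finite J" "J \<subseteq> {0..s}" "\<forall>j\<in>I. \<forall>r\<in>J. A j r \<in> sets borel"
      unfolding G_def by blast
    then show "prob (a \<inter> D) = prob a * prob D"
    proof cases
      assume 1: "a \<in> null_sets M"
      then have "a \<inter> D \<in> null_sets M" using mD by (rule null_set_Int2)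
      then show ?thesis using 1 by (simp add: measure_eq_0_null_sets)
    qed (use cyl_eq in auto)
  next
    show "prob ({} \<inter> D) = prob {} * prob D" by simp
  next
    fix a assume a: "a \<in> sigma_sets (space M) G" "prob (a \<inter> D) = prob a * prob D"
    have aM: "a \<in> events" using a(1) sets.sigma_sets_subset[OF GM] by blast
    have "(space M - a) \<inter> D = D - a \<inter> D" using sets.sets_into_space[OF mD] by auto
    then have "prob ((space M - a) \<inter> D) = prob D - prob (a \<inter> D)"
      using mD aM by (simp add: finite_measure_Diff)
    then show "prob ((space M - a) \<inter> D) = prob (space M - a) * prob D"
      using aM a(2) by (simp add: prob_compl algebra_simps)
  next
    fix a :: "nat \<Rightarrow> 'a set"
    assume a: "disjoint_family a" "range a \<subseteq> sigma_sets (space M) G" "\<And>k. prob (a k \<inter> D) = prob (a k) * prob D"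
    have aM: "range a \<subseteq> events" using a(2) sets.sigma_sets_subset[OF GM] by blast
    have "(\<lambda>k. prob (a k)) sums prob (\<Union>k. a k)" by (rule finite_measure_UNION[OF aM a(1)])
    then have 1: "(\<lambda>k. prob (a k) * prob D) sums (prob (\<Union>k. a k) * prob D)" by (rule sums_mult2)
    have "(\<lambda>k. prob (a k \<inter> D)) sums prob (\<Union>k. a k \<inter> D)"
      using aM mD a(1) by (intro finite_measure_UNION) (auto simp: disjoint_family_on_def)
    then have "(\<lambda>k. prob (a k) * prob D) sums prob ((\<Union>k. a k) \<inter> D)" using a(3) by simp
    then show "prob ((\<Union>k. a k) \<inter> D) = prob (\<Union>k. a k) * prob D" using 1 sums_unique2 by blast
  qed
qed

section \<open>A maximal inequality for Ito integrals\<close>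

text \<open>Independence of increments from the past is stated on events. Tested against variables
  known at time \<open>s\<close> it yields the martingale identities, without conditional
  expectations.\<close>

locale brownian_in_filtration = prob_space M
  for M :: "'w measure" and F :: "real \<Rightarrow> 'w measure" and B :: "real \<Rightarrow> 'w \<Rightarrow> real" +
  assumes space_F: "0 \<le> t \<Longrightarrow> space (F t) = space M"
    and sets_F: "0 \<le> t \<Longrightarrow> sets (F t) \<subseteq> sets M"
    and F_mono: "0 \<le> s \<Longrightarrow> s \<le> t \<Longrightarrow> sets (F s) \<subseteq> sets (F t)"
    and B_F: "0 \<le> t \<Longrightarrow> B t \<in> borel_measurable (F t)"
    and B_continuous: "continuous_paths M B"
    and B_normal: "0 \<le> s \<Longrightarrow> s < t \<Longrightarrow>
      distributed M lborel (\<lambda>\<omega>. B t \<omega> - B s \<omega>) (\<lambda>x. ennreal (normal_density 0 (sqrt (t - s)) x))"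
    and B_indep: "0 \<le> s \<Longrightarrow> s < t \<Longrightarrow> A \<in> sets (F s) \<Longrightarrow> C \<in> sets borel \<Longrightarrow>
      prob (A \<inter> {\<omega>\<in>space M. B t \<omega> - B s \<omega> \<in> C}) = prob A * prob {\<omega>\<in>space M. B t \<omega> - B s \<omega> \<in> C}"
begin

lemma measurable_F_M: "f \<in> borel_measurable (F t) \<Longrightarrow> 0 \<le> t \<Longrightarrow> f \<in> borel_measurable M"
  by (rule borel_measurable_subalgebra[OF sets_F space_F])

lemma measurable_F_mono: "f \<in> borel_measurable (F s) \<Longrightarrow> 0 \<le> s \<Longrightarrow> s \<le> t \<Longrightarrow> f \<in> borel_measurable (F t)"
  by (rule borel_measurable_subalgebra[OF F_mono]) (auto simp only: space_F intro: order_trans)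

lemma B_M: "0 \<le> t \<Longrightarrow> B t \<in> borel_measurable M"
  by (rule measurable_F_M[OF B_F])

lemma increment_indep_var:
  assumes st: "0 \<le> s" "s < t" and \<xi>: "\<xi> \<in> borel_measurable (F s)"
  shows "indep_var borel \<xi> borel (\<lambda>\<omega>. B t \<omega> - B s \<omega>)"
  unfolding indep_var_eq
proof (intro conjI)
  have \<xi>M: "\<xi> \<in> borel_measurable M" by (rule measurable_F_M[OF \<xi> st(1)])
  have DM: "(\<lambda>\<omega>. B t \<omega> - B s \<omega>) \<in> borel_measurable M" using st by (intro borel_measurable_diff B_M) auto
  show "random_variable borel \<xi>" "random_variable borel (\<lambda>\<omega>. B t \<omega> - B s \<omega>)" by fact+
  have sig: "sigma_sets (space M) {f -` A \<inter> space M | A. A \<in> sets borel} = {f -` A \<inter> space M | A. A \<in> sets borel}"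
    for f :: "'w \<Rightarrow> real"
    using sets_vimage_algebra[of "space M" f borel] sets_vimage_algebra2[of f "space M" borel] by simp
  show "indep_set (sigma_sets (space M) {\<xi> -` A \<inter> space M | A. A \<in> sets borel})
     (sigma_sets (space M) {(\<lambda>\<omega>. B t \<omega> - B s \<omega>) -` A \<inter> space M | A. A \<in> sets borel})"
    unfolding sig indep_sets2_eq
  proof (intro conjI ballI)
    show "{\<xi> -` A \<inter> space M | A. A \<in> sets borel} \<subseteq> events" using measurable_sets[OF \<xi>M] by auto
    show "{(\<lambda>\<omega>. B t \<omega> - B s \<omega>) -` A \<inter> space M | A. A \<in> sets borel} \<subseteq> events"
      using measurable_sets[OF DM] by auto
    fix a c assume "a \<in> {\<xi> -` A \<inter> space M | A. A \<in> sets borel}"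
      "c \<in> {(\<lambda>\<omega>. B t \<omega> - B s \<omega>) -` A \<inter> space M | A. A \<in> sets borel}"
    then obtain A C where A: "a = \<xi> -` A \<inter> space M" "A \<in> sets borel"
      and C: "c = {\<omega>\<in>space M. B t \<omega> - B s \<omega> \<in> C}" "C \<in> sets borel" by auto
    have "a \<in> sets (F s)" using measurable_sets[OF \<xi> A(2)] A(1) space_F st by simp
    then show "prob (a \<inter> c) = prob a * prob c" unfolding C(1) by (rule B_indep[OF st _ C(2)])
  qed
qed

lemma increment_moments:
  assumes st: "0 \<le> s" "s < t"
  shows "integrable M (\<lambda>\<omega>. B t \<omega> - B s \<omega>)" "(\<integral>\<omega>. B t \<omega> - B s \<omega> \<partial>M) = 0"
    "integrable M (\<lambda>\<omega>. (B t \<omega> - B s \<omega>)\<^sup>2)" "(\<integral>\<omega>. (B t \<omega> - B s \<omega>)\<^sup>2 \<partial>M) = t - s"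
proof -
  have p: "0 < sqrt (t - s)" using st by simp
  note D = B_normal[OF st]
  show "integrable M (\<lambda>\<omega>. B t \<omega> - B s \<omega>)"
    using distributed_integrable[OF D, of "\<lambda>x. x"] integrable_normal_moment[OF p, of 0 1] by simp
  show e: "(\<integral>\<omega>. B t \<omega> - B s \<omega> \<partial>M) = 0" by (rule normal_distributed_expectation[OF p D])
  show "integrable M (\<lambda>\<omega>. (B t \<omega> - B s \<omega>)\<^sup>2)"
    using distributed_integrable[OF D, of "\<lambda>x. x\<^sup>2"] integrable_normal_moment[OF p, of 0 2] by simp
  show "(\<integral>\<omega>. (B t \<omega> - B s \<omega>)\<^sup>2 \<partial>M) = t - s"
    using normal_distributed_variance[OF p D] e p by simp
qed

text \<open>These identities replace conditional expectation given \<open>F s\<close>: the increment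
  has conditional mean 0 and conditional second moment \<open>t - s\<close>, both tested against
  \<open>\<xi>\<close>.\<close>

lemma increment_product:
  assumes st: "0 \<le> s" "s < t" and \<xi>: "\<xi> \<in> borel_measurable (F s)" and int: "integrable M \<xi>"
  shows "integrable M (\<lambda>\<omega>. \<xi> \<omega> * (B t \<omega> - B s \<omega>))" "(\<integral>\<omega>. \<xi> \<omega> * (B t \<omega> - B s \<omega>) \<partial>M) = 0"
    "integrable M (\<lambda>\<omega>. \<xi> \<omega> * (B t \<omega> - B s \<omega>)\<^sup>2)"
    "(\<integral>\<omega>. \<xi> \<omega> * (B t \<omega> - B s \<omega>)\<^sup>2 \<partial>M) = (t - s) * (\<integral>\<omega>. \<xi> \<omega> \<partial>M)"
proof -
  note ind = increment_indep_var[OF st \<xi>]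
  have ind2: "indep_var borel \<xi> borel (\<lambda>\<omega>. (B t \<omega> - B s \<omega>)\<^sup>2)"
    using indep_var_compose[OF ind, of "\<lambda>x. x" borel "\<lambda>x. x\<^sup>2" borel] by (simp add: comp_def)
  note m = increment_moments[OF st]
  show "integrable M (\<lambda>\<omega>. \<xi> \<omega> * (B t \<omega> - B s \<omega>))" by (rule indep_var_integrable[OF ind int m(1)])
  show "(\<integral>\<omega>. \<xi> \<omega> * (B t \<omega> - B s \<omega>) \<partial>M) = 0" using indep_var_lebesgue_integral[OF ind int m(1)] m(2) by simp
  show "integrable M (\<lambda>\<omega>. \<xi> \<omega> * (B t \<omega> - B s \<omega>)\<^sup>2)" by (rule indep_var_integrable[OF ind2 int m(3)])
  show "(\<integral>\<omega>. \<xi> \<omega> * (B t \<omega> - B s \<omega>)\<^sup>2 \<partial>M) = (t - s) * (\<integral>\<omega>. \<xi> \<omega> \<partial>M)"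
    using indep_var_lebesgue_integral[OF ind2 int m(3)] m(4) by simp
qed

text \<open>When the last increment is added, the cross term vanishes, since
  \<open>X n * c n\<close> is known at time \<open>\<sigma> n\<close>; boundedness of
  \<open>c\<close> makes this product integrable. The other conjuncts are what the induction needs
  to carry along.\<close>

lemma ito_isometry_discrete:
  assumes \<sigma>: "0 \<le> \<sigma> 0" "\<And>k. k < n \<Longrightarrow> \<sigma> k < \<sigma> (Suc k)"
    and c: "\<And>k. k < n \<Longrightarrow> c k \<in> borel_measurable (F (\<sigma> k))"
    and bd: "\<And>k \<omega>. k < n \<Longrightarrow> \<omega> \<in> space M \<Longrightarrow> \<bar>c k \<omega>\<bar> \<le> K"
  defines "X \<equiv> \<lambda>m \<omega>. \<Sum>k<m. c k \<omega> * (B (\<sigma> (Suc k)) \<omega> - B (\<sigma> k) \<omega>)"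
  shows "X n \<in> borel_measurable (F (\<sigma> n)) \<and> integrable M (\<lambda>\<omega>. (X n \<omega>)\<^sup>2) \<and>
    (\<integral>\<omega>. (X n \<omega>)\<^sup>2 \<partial>M) = (\<integral>\<omega>. (\<Sum>k<n. (c k \<omega>)\<^sup>2 * (\<sigma> (Suc k) - \<sigma> k)) \<partial>M) \<and> 0 \<le> \<sigma> n \<and>
    integrable M (\<lambda>\<omega>. \<Sum>k<n. (c k \<omega>)\<^sup>2 * (\<sigma> (Suc k) - \<sigma> k))"
  using \<sigma>(2) c bd
proof (induction n)
  case 0
  then show ?case using \<sigma>(1) by (simp add: X_def)
next
  case (Suc n)
  have IH: "X n \<in> borel_measurable (F (\<sigma> n))" "integrable M (\<lambda>\<omega>. (X n \<omega>)\<^sup>2)"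
    "(\<integral>\<omega>. (X n \<omega>)\<^sup>2 \<partial>M) = (\<integral>\<omega>. (\<Sum>k<n. (c k \<omega>)\<^sup>2 * (\<sigma> (Suc k) - \<sigma> k)) \<partial>M)" "0 \<le> \<sigma> n"
    "integrable M (\<lambda>\<omega>. \<Sum>k<n. (c k \<omega>)\<^sup>2 * (\<sigma> (Suc k) - \<sigma> k))"
    using Suc by auto
  have lt: "\<sigma> n < \<sigma> (Suc n)" using Suc by simp
  define D where "D \<omega> = B (\<sigma> (Suc n)) \<omega> - B (\<sigma> n) \<omega>" for \<omega>
  have cn: "c n \<in> borel_measurable (F (\<sigma> n))" "\<And>\<omega>. \<omega> \<in> space M \<Longrightarrow> \<bar>c n \<omega>\<bar> \<le> K" using Suc by auto
  have cM: "c n \<in> borel_measurable M" using measurable_F_M[OF cn(1) IH(4)] .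
  have XM: "X n \<in> borel_measurable M" using measurable_F_M[OF IH(1) IH(4)] .
  have DF: "D \<in> borel_measurable (F (\<sigma> (Suc n)))" unfolding D_def
    using IH(4) lt by (intro borel_measurable_diff B_F measurable_F_mono[OF B_F]) auto
  have c2: "integrable M (\<lambda>\<omega>. (c n \<omega>)\<^sup>2)"
  proof (rule integrable_const_bound[where B = "K\<^sup>2"])
    show "AE \<omega> in M. norm ((c n \<omega>)\<^sup>2) \<le> K\<^sup>2"
    proof (intro AE_I2)
      fix \<omega> assume "\<omega> \<in> space M"
      then have "\<bar>c n \<omega>\<bar> \<le> K" by (rule cn(2))
      then show "norm ((c n \<omega>)\<^sup>2) \<le> K\<^sup>2" using power_mono[of "\<bar>c n \<omega>\<bar>" K 2] by simp
    qed
    show "(\<lambda>\<omega>. (c n \<omega>)\<^sup>2) \<in> borel_measurable M" using cM by (intro borel_measurable_power)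
  qed
  have Xi: "integrable M (X n)" by (rule square_integrable_imp_integrable[OF XM IH(2)])
  have Xc: "integrable M (\<lambda>\<omega>. X n \<omega> * c n \<omega>)"
  proof (rule Bochner_Integration.integrable_bound)
    show "integrable M (\<lambda>\<omega>. K * \<bar>X n \<omega>\<bar>)" using Xi by auto
    show "(\<lambda>\<omega>. X n \<omega> * c n \<omega>) \<in> borel_measurable M" using cM XM by (intro borel_measurable_times)
    show "AE \<omega> in M. norm (X n \<omega> * c n \<omega>) \<le> norm (K * \<bar>X n \<omega>\<bar>)"
    proof (intro AE_I2)
      fix \<omega> assume "\<omega> \<in> space M"
      then have *: "\<bar>c n \<omega>\<bar> * \<bar>X n \<omega>\<bar> \<le> K * \<bar>X n \<omega>\<bar>" using cn(2) by (intro mult_right_mono) auto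
      note *
      also have "K * \<bar>X n \<omega>\<bar> \<le> norm (K * \<bar>X n \<omega>\<bar>)" by simp
      finally show "norm (X n \<omega> * c n \<omega>) \<le> norm (K * \<bar>X n \<omega>\<bar>)" by (simp add: abs_mult mult.commute)
    qed
  qed
  have c2F: "(\<lambda>\<omega>. (c n \<omega>)\<^sup>2) \<in> borel_measurable (F (\<sigma> n))" using cn(1) by (intro borel_measurable_power)
  have XcF: "(\<lambda>\<omega>. X n \<omega> * c n \<omega>) \<in> borel_measurable (F (\<sigma> n))" using cn(1) IH(1) by (intro borel_measurable_times)
  note p1 = increment_product[OF IH(4) lt c2F c2, folded D_def]
  note p2 = increment_product[OF IH(4) lt XcF Xc, folded D_def]
  have Xs: "X (Suc n) \<omega> = X n \<omega> + c n \<omega> * D \<omega>" for \<omega> by (simp add: X_def D_def)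
  have sq: "(X (Suc n) \<omega>)\<^sup>2 = (X n \<omega>)\<^sup>2 + (2 * (X n \<omega> * c n \<omega> * D \<omega>) + (c n \<omega>)\<^sup>2 * (D \<omega>)\<^sup>2)" for \<omega>
    unfolding Xs by (simp add: power2_eq_square algebra_simps)
  have m: "X (Suc n) \<in> borel_measurable (F (\<sigma> (Suc n)))"
    unfolding Xs[abs_def] using IH(4) lt DF
    by (intro borel_measurable_add borel_measurable_times measurable_F_mono[OF IH(1)] measurable_F_mono[OF cn(1)]) auto
  have i2: "integrable M (\<lambda>\<omega>. 2 * (X n \<omega> * c n \<omega> * D \<omega>) + (c n \<omega>)\<^sup>2 * (D \<omega>)\<^sup>2)"
    using p1(3) p2(1) by auto
  have "(\<integral>\<omega>. (X (Suc n) \<omega>)\<^sup>2 \<partial>M) = (\<integral>\<omega>. (X n \<omega>)\<^sup>2 \<partial>M)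
      + (\<integral>\<omega>. 2 * (X n \<omega> * c n \<omega> * D \<omega>) + (c n \<omega>)\<^sup>2 * (D \<omega>)\<^sup>2 \<partial>M)"
    unfolding sq by (rule Bochner_Integration.integral_add[OF IH(2) i2])
  also have "(\<integral>\<omega>. 2 * (X n \<omega> * c n \<omega> * D \<omega>) + (c n \<omega>)\<^sup>2 * (D \<omega>)\<^sup>2 \<partial>M)
      = (\<integral>\<omega>. 2 * (X n \<omega> * c n \<omega> * D \<omega>) \<partial>M) + (\<integral>\<omega>. (c n \<omega>)\<^sup>2 * (D \<omega>)\<^sup>2 \<partial>M)"
    using p1(3) p2(1) by (intro Bochner_Integration.integral_add) auto
  also have "\<dots> = (\<integral>\<omega>. (c n \<omega>)\<^sup>2 * (\<sigma> (Suc n) - \<sigma> n) \<partial>M)" using p1(4) p2(2) by simp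
  finally have "(\<integral>\<omega>. (X (Suc n) \<omega>)\<^sup>2 \<partial>M) = (\<integral>\<omega>. (\<Sum>k<Suc n. (c k \<omega>)\<^sup>2 * (\<sigma> (Suc k) - \<sigma> k)) \<partial>M)"
    unfolding IH(3) using IH(5) c2 by (simp add: Bochner_Integration.integral_add)
  moreover have "integrable M (\<lambda>\<omega>. (X (Suc n) \<omega>)\<^sup>2)"
    unfolding sq by (intro Bochner_Integration.integrable_add IH(2) i2)
  moreover have "integrable M (\<lambda>\<omega>. \<Sum>k<Suc n. (c k \<omega>)\<^sup>2 * (\<sigma> (Suc k) - \<sigma> k))"
    using IH(5) c2 by simp
  ultimately show ?case using m IH(4) lt by auto
qed

text \<open>Truncating the coefficients stops the martingale when it exceeds \<open>R\<close> or when its quadratic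
  variation is about to exceed \<open>\<delta>\<close>, so that Chebyshev's inequality applies without any integrability
  assumption on the quadratic variation.\<close>

lemma discrete_martingale_tail:
  assumes \<sigma>: "0 \<le> \<sigma> 0" "\<And>k. k < n \<Longrightarrow> \<sigma> k < \<sigma> (Suc k)"
    and c: "\<And>k. k < n \<Longrightarrow> c k \<in> borel_measurable (F (\<sigma> k))"
    and bd: "\<And>k \<omega>. k < n \<Longrightarrow> \<omega> \<in> space M \<Longrightarrow> \<bar>c k \<omega>\<bar> \<le> K"
    and R: "0 < R" and \<delta>: "0 < \<delta>"
  defines "X \<equiv> \<lambda>m \<omega>. \<Sum>k<m. c k \<omega> * (B (\<sigma> (Suc k)) \<omega> - B (\<sigma> k) \<omega>)"
  defines "V \<equiv> \<lambda>m \<omega>. \<Sum>k<m. (c k \<omega>)\<^sup>2 * (\<sigma> (Suc k) - \<sigma> k)"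
  shows "prob ({\<omega>\<in>space M. \<exists>k\<le>n. R \<le> \<bar>X k \<omega>\<bar>} - {\<omega>\<in>space M. \<delta> < V n \<omega>}) \<le> \<delta> / R\<^sup>2"
proof -
  have \<sigma>_mono: "\<sigma> j \<le> \<sigma> k" if "j \<le> k" "k \<le> n" for j k
    using that
  proof (induction k)
    case (Suc k)
    show ?case
    proof (cases "j = Suc k")
      case False
      have "j \<le> k" "k \<le> n" using Suc.prems False by simp_all
      then have "\<sigma> j \<le> \<sigma> k" by (rule Suc.IH)
      also have "\<dots> \<le> \<sigma> (Suc k)" using Suc.prems by (intro less_imp_le \<sigma>(2)) linarith
      finally show ?thesis .
    qed simp
  qed simp
  have \<sigma>_nonneg: "0 \<le> \<sigma> k" if "k \<le> n" for k using order_trans[OF \<sigma>(1) \<sigma>_mono[of 0 k]] that by simp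
  have cF: "c j \<in> borel_measurable (F (\<sigma> k))" if "j \<le> k" "k < n" for j k
    by (rule measurable_F_mono[OF c]; (rule \<sigma>_nonneg \<sigma>_mono)?) (use that in linarith)+
  have BF: "B (\<sigma> j) \<in> borel_measurable (F (\<sigma> k))" if "j \<le> k" "k \<le> n" for j k
    by (rule measurable_F_mono[OF B_F]; (rule \<sigma>_nonneg \<sigma>_mono)?) (use that in linarith)+
  have XF: "X j \<in> borel_measurable (F (\<sigma> k))" if "j \<le> k" "k \<le> n" for j k
    unfolding X_def
  proof (intro borel_measurable_sum borel_measurable_times borel_measurable_diff)
    fix i assume i: "i \<in> {..<j}"
    show "c i \<in> borel_measurable (F (\<sigma> k))"
      by (rule measurable_F_mono[OF c]; (rule \<sigma>_nonneg \<sigma>_mono)?) (use i that in auto)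
    show "B (\<sigma> (Suc i)) \<in> borel_measurable (F (\<sigma> k))" "B (\<sigma> i) \<in> borel_measurable (F (\<sigma> k))"
      using i that by (auto intro!: BF)
  qed
  have VF: "V j \<in> borel_measurable (F (\<sigma> k))" if "j \<le> Suc k" "k < n" for j k
    unfolding V_def
    using that by (intro borel_measurable_sum borel_measurable_times borel_measurable_power borel_measurable_const cF) auto
  \<comment> \<open>Looking one step ahead in \<open>V\<close> is legitimate: its next term involves
    \<open>c k\<close> and a deterministic length, both known at time \<open>\<sigma> k\<close>.
    This prevents the stopped quadratic variation from overshooting \<open>\<delta>\<close>.\<close>
  define G where "G k \<omega> \<longleftrightarrow> (\<forall>j\<in>{..k}. \<bar>X j \<omega>\<bar> < R) \<and> V (Suc k) \<omega> \<le> \<delta>" for k \<omega>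
  define c' where "c' k \<omega> = (if G k \<omega> then c k \<omega> else 0)" for k \<omega>
  define X' where "X' m \<omega> = (\<Sum>k<m. c' k \<omega> * (B (\<sigma> (Suc k)) \<omega> - B (\<sigma> k) \<omega>))" for m \<omega>
  define V' where "V' m \<omega> = (\<Sum>k<m. (c' k \<omega>)\<^sup>2 * (\<sigma> (Suc k) - \<sigma> k))" for m \<omega>
  have c'F: "c' k \<in> borel_measurable (F (\<sigma> k))" if k: "k < n" for k
  proof -
    have "{\<omega>\<in>space (F (\<sigma> k)). G k \<omega>} \<in> sets (F (\<sigma> k))"
      unfolding G_def
    proof (intro sets.sets_Collect_conj sets.sets_Collect_finite_All)
      fix j assume j: "j \<in> {..k}"
      have "(\<lambda>\<omega>. \<bar>X j \<omega>\<bar>) \<in> borel_measurable (F (\<sigma> k))" using j k by (intro borel_measurable_abs XF) auto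
      then show "{\<omega>\<in>space (F (\<sigma> k)). \<bar>X j \<omega>\<bar> < R} \<in> sets (F (\<sigma> k))" by (rule borel_measurable_less) simp
    next
      show "{\<omega>\<in>space (F (\<sigma> k)). V (Suc k) \<omega> \<le> \<delta>} \<in> sets (F (\<sigma> k))"
        by (rule borel_measurable_le[OF VF[OF order_refl k]]) simp
    qed simp
    then show ?thesis unfolding c'_def[abs_def] using c[OF k] by (intro measurable_If) auto
  qed
  have c'bd: "\<bar>c' k \<omega>\<bar> \<le> \<bar>K\<bar>" if "k < n" "\<omega> \<in> space M" for k \<omega>
    using bd[OF that] unfolding c'_def by auto
  have iso: "X' n \<in> borel_measurable (F (\<sigma> n)) \<and> integrable M (\<lambda>\<omega>. (X' n \<omega>)\<^sup>2) \<and>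
    (\<integral>\<omega>. (X' n \<omega>)\<^sup>2 \<partial>M) = (\<integral>\<omega>. V' n \<omega> \<partial>M) \<and> 0 \<le> \<sigma> n \<and> integrable M (\<lambda>\<omega>. V' n \<omega>)"
    unfolding X'_def V'_def using \<sigma> c'F c'bd by (rule ito_isometry_discrete)
  have V_step: "V j \<omega> \<le> V k \<omega>" if "j \<le> k" "k \<le> n" for j k \<omega>
    unfolding V_def
  proof (rule sum_mono2)
    fix b assume "b \<in> {..<k} - {..<j}"
    then have "\<sigma> b < \<sigma> (Suc b)" using that by (intro \<sigma>(2)) auto
    then show "0 \<le> (c b \<omega>)\<^sup>2 * (\<sigma> (Suc b) - \<sigma> b)" by simp
  qed (use that in auto)
  have V'_le: "V' m \<omega> \<le> \<delta>" if "m \<le> n" for m \<omega>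
    using that
  proof (induction m)
    case 0 then show ?case using \<delta> by (simp add: V'_def)
  next
    case (Suc m)
    show ?case
    proof (cases "G m \<omega>")
      case True
      have "V' (Suc m) \<omega> \<le> V (Suc m) \<omega>"
        unfolding V'_def V_def using Suc.prems \<sigma>(2)
        by (intro sum_mono mult_right_mono) (auto simp: c'_def less_imp_le)
      then show ?thesis using True unfolding G_def by linarith
    next
      case False
      then show ?thesis using Suc by (simp add: V'_def c'_def)
    qed
  qed
  have X'M: "X' n \<in> borel_measurable M" using iso measurable_F_M by auto
  \<comment> \<open>Up to the first index of exceedance nothing has been truncated, because
    \<open>V\<close> is monotone and ends below \<open>\<delta>\<close>; from that index on every
    coefficient is 0. So \<open>X'\<close> is frozen at the exceeding value, and a maximum over
    \<open>k\<close> becomes a statement about the final time.\<close>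
  have stop: "R \<le> \<bar>X' n \<omega>\<bar>" if ex: "\<exists>k\<le>n. R \<le> \<bar>X k \<omega>\<bar>" and V: "V n \<omega> \<le> \<delta>" for \<omega>
  proof -
    define k where "k = (LEAST k. R \<le> \<bar>X k \<omega>\<bar>)"
    have k: "R \<le> \<bar>X k \<omega>\<bar>" unfolding k_def using ex by (metis LeastI)
    have kn: "k \<le> n" unfolding k_def using ex by (meson Least_le order_trans)
    have less: "\<bar>X j \<omega>\<bar> < R" if "j < k" for j
      using not_less_Least[of j "\<lambda>k. R \<le> \<bar>X k \<omega>\<bar>"] that unfolding k_def[symmetric] by linarith
    have "c' j \<omega> = c j \<omega>" if "j < k" for j
    proof -
      have "V (Suc j) \<omega> \<le> \<delta>" 
        using order_trans[OF V_step[of "Suc j" n \<omega>] V] that kn by linarith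
      then have "G j \<omega>" unfolding G_def using less that by auto
      then show ?thesis by (simp add: c'_def)
    qed
    then have 1: "X' k \<omega> = X k \<omega>" unfolding X'_def X_def by (intro sum.cong) auto
    have "\<not> G j \<omega>" if "k \<le> j" for j using k that unfolding G_def by (auto intro!: bexI[of _ k])
    then have "c' j \<omega> = 0" if "k \<le> j" for j using that by (simp add: c'_def)
    then have "X' n \<omega> = X' k \<omega>" unfolding X'_def using kn by (intro sum.mono_neutral_right) auto
    then show ?thesis using 1 k by simp
  qed
  have ev2: "{\<omega>\<in>space M. R\<^sup>2 \<le> (X' n \<omega>)\<^sup>2} \<in> events" 
    by (rule borel_measurable_le[OF _ borel_measurable_power[OF X'M]]) simp
  have "{\<omega>\<in>space M. \<exists>k\<le>n. R \<le> \<bar>X k \<omega>\<bar>} - {\<omega>\<in>space M. \<delta> < V n \<omega>}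
      \<subseteq> {\<omega>\<in>space M. R\<^sup>2 \<le> (X' n \<omega>)\<^sup>2}"
  proof
    fix \<omega> assume "\<omega> \<in> {\<omega>\<in>space M. \<exists>k\<le>n. R \<le> \<bar>X k \<omega>\<bar>} - {\<omega>\<in>space M. \<delta> < V n \<omega>}"
    then have \<omega>: "\<omega> \<in> space M" "\<exists>k\<le>n. R \<le> \<bar>X k \<omega>\<bar>" "V n \<omega> \<le> \<delta>" by (auto simp: not_less)
    then have "R \<le> \<bar>X' n \<omega>\<bar>" by (intro stop)
    then have "R\<^sup>2 \<le> (X' n \<omega>)\<^sup>2" using R power_mono[of R "\<bar>X' n \<omega>\<bar>" 2] by simp
    then show "\<omega> \<in> {\<omega>\<in>space M. R\<^sup>2 \<le> (X' n \<omega>)\<^sup>2}" using \<omega> by simp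
  qed
  then have "prob ({\<omega>\<in>space M. \<exists>k\<le>n. R \<le> \<bar>X k \<omega>\<bar>} - {\<omega>\<in>space M. \<delta> < V n \<omega>})
      \<le> prob {\<omega>\<in>space M. R\<^sup>2 \<le> (X' n \<omega>)\<^sup>2}"
    using ev2 by (rule finite_measure_mono)
  also have "\<dots> \<le> (\<integral>\<omega>. (X' n \<omega>)\<^sup>2 \<partial>M) / R\<^sup>2"
  proof (rule integral_Markov_inequality_measure[where A = "{}"])
    show "integrable M (\<lambda>\<omega>. (X' n \<omega>)\<^sup>2)" using iso by blast
  qed (use R in simp_all)
  also have "\<dots> \<le> \<delta> / R\<^sup>2"
  proof (rule divide_right_mono)
    have "(\<integral>\<omega>. V' n \<omega> \<partial>M) \<le> (\<integral>\<omega>. \<delta> \<partial>M)" 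
      using iso by (intro integral_mono V'_le) simp_all
    then show "(\<integral>\<omega>. (X' n \<omega>)\<^sup>2 \<partial>M) \<le> \<delta>" using iso by (simp add: prob_space)
  qed simp
  finally show ?thesis .
qed

end

section \<open>Measurability of suprema of continuous paths\<close>

lemma continuous_exceeds_iff_rational:
  fixes f :: "real \<Rightarrow> real"
  assumes f: "continuous_on {0..} f" and T: "0 < T"
  shows "(\<exists>t\<in>{0..T}. R < \<bar>f t\<bar>) \<longleftrightarrow> (\<exists>t\<in>{0..T} \<inter> \<rat>. R < \<bar>f t\<bar>)"
proof
  assume "\<exists>t\<in>{0..T}. R < \<bar>f t\<bar>"
  then obtain t where t: "t \<in> {0..T}" "R < \<bar>f t\<bar>" by blast
  have "continuous_on {0..} (\<lambda>s. \<bar>f s\<bar>)" using f by (intro continuous_intros)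
  then obtain r where r: "r > 0" "\<And>s. s \<in> {0..} \<Longrightarrow> dist s t < r \<Longrightarrow> dist \<bar>f s\<bar> \<bar>f t\<bar> < \<bar>f t\<bar> - R"
    using t unfolding continuous_on_iff by (metis atLeast_iff atLeastAtMost_iff diff_gt_0_iff_gt)
  \<comment> \<open>The rational time is sought to the left of \<open>t\<close> so as not to pass
    \<open>T\<close>, and to the right only when \<open>t = 0\<close>.\<close>
  have "\<exists>s\<in>\<rat>. max 0 (t - r) < s \<and> s < (if t = 0 then min r T else t)"
    using t r T by (intro Rats_dense_in_real) auto
  then obtain s where s: "s \<in> \<rat>" "max 0 (t - r) < s" "s < (if t = 0 then min r T else t)" by blast
  have s': "s \<in> {0..T}" "dist s t < r" using s t by (auto simp: dist_real_def split: if_splits)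
  have "R < \<bar>f s\<bar>" using r(2)[of s] s' unfolding dist_real_def by auto
  then show "\<exists>t\<in>{0..T} \<inter> \<rat>. R < \<bar>f t\<bar>" using s s' by blast
qed blast

text \<open>A strict excess is an open condition on the time and can be tested at rational times; a
  weak bound on the supremum is not, and is therefore written as countably many strict ones.\<close>

lemma le_SUP_abs_iff:
  fixes f :: "real \<Rightarrow> real"
  assumes f: "continuous_on {0..} f" and T: "0 < T"
  shows "R \<le> (SUP t\<in>{0..T}. \<bar>f t\<bar>) \<longleftrightarrow> (\<forall>j::nat. \<exists>t\<in>{0..T}. R - 1 / Suc j < \<bar>f t\<bar>)"
proof -
  have "compact ((\<lambda>t. \<bar>f t\<bar>) ` {0..T})"
    by (intro compact_continuous_image continuous_intros continuous_on_subset[OF f]) auto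
  then have bdd: "bdd_above ((\<lambda>t. \<bar>f t\<bar>) ` {0..T})"
    by (intro bounded_imp_bdd_above compact_imp_bounded)
  have less: "x < (SUP t\<in>{0..T}. \<bar>f t\<bar>) \<longleftrightarrow> (\<exists>t\<in>{0..T}. x < \<bar>f t\<bar>)" for x
    using T by (intro less_cSUP_iff bdd) auto
  have "R \<le> S \<longleftrightarrow> (\<forall>j::nat. R - 1 / Suc j < S)" for S :: real
  proof
    assume *: "\<forall>j::nat. R - 1 / Suc j < S"
    show "R \<le> S"
    proof (rule ccontr)
      assume "\<not> R \<le> S"
      then obtain j where "1 / real (Suc j) < R - S" using nat_approx_posE[of "R - S"] by auto
      then show False using *[rule_format, of j] by linarith
    qed
  next
    assume "R \<le> S"
    then show "\<forall>j::nat. R - 1 / Suc j < S"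
      by (metis diff_less_eq divide_pos_pos less_add_same_cancel1 of_nat_0_less_iff order_le_less_trans zero_less_Suc zero_less_one add.commute)
  qed
  then show ?thesis by (simp only: less)
qed

lemma exceeds_measurable:
  assumes X: "\<And>t. 0 \<le> t \<Longrightarrow> X t \<in> borel_measurable M" "continuous_paths M X" and T: "0 < T"
  shows "{\<omega>\<in>space M. \<exists>t\<in>{0..T}. R < \<bar>X t \<omega>\<bar>} \<in> sets M"
proof -
  have "{\<omega>\<in>space M. \<exists>t\<in>{0..T}. R < \<bar>X t \<omega>\<bar>} = {\<omega>\<in>space M. \<exists>t\<in>{0..T} \<inter> \<rat>. R < \<bar>X t \<omega>\<bar>}"
  proof (intro Collect_cong conj_cong refl)
    fix \<omega> assume "\<omega> \<in> space M"
    then have "continuous_on {0..} (\<lambda>t. X t \<omega>)" using X(2) unfolding continuous_paths_def by blast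
    from continuous_exceeds_iff_rational[OF this T]
    show "(\<exists>t\<in>{0..T}. R < \<bar>X t \<omega>\<bar>) \<longleftrightarrow> (\<exists>t\<in>{0..T} \<inter> \<rat>. R < \<bar>X t \<omega>\<bar>)" .
  qed
  also have "\<dots> = (\<Union>t\<in>{0..T} \<inter> \<rat>. {\<omega>\<in>space M. R < \<bar>X t \<omega>\<bar>})" by blast
  also have "\<dots> \<in> sets M"
  proof (rule sets.countable_UN')
    show "countable ({0..T} \<inter> \<rat>)" using countable_rat by blast
    show "(\<lambda>t. {\<omega>\<in>space M. R < \<bar>X t \<omega>\<bar>}) ` ({0..T} \<inter> \<rat>) \<subseteq> sets M"
      by (auto intro!: borel_measurable_less borel_measurable_abs X(1))
  qed
  finally show ?thesis .
qed

lemma le_SUP_abs_measurable: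
  assumes X: "\<And>t. 0 \<le> t \<Longrightarrow> X t \<in> borel_measurable M" "continuous_paths M X" and T: "0 < T"
  shows "{\<omega>\<in>space M. R \<le> (SUP t\<in>{0..T}. \<bar>X t \<omega>\<bar>)} \<in> sets M"
proof -
  have "{\<omega>\<in>space M. R \<le> (SUP t\<in>{0..T}. \<bar>X t \<omega>\<bar>)}
      = {\<omega>\<in>space M. \<forall>j::nat. \<exists>t\<in>{0..T}. R - 1 / Suc j < \<bar>X t \<omega>\<bar>}"
    using X(2) T unfolding continuous_paths_def by (intro Collect_cong conj_cong refl le_SUP_abs_iff) auto
  also have "\<dots> \<in> sets M"
    by (intro sets.sets_Collect_countable_All exceeds_measurable[OF X T])
  finally show ?thesis .
qed

section \<open>From discrete martingales to simple integrals\<close>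

context brownian_in_filtration
begin

lemma simple_process_times:
  assumes S: "simple_process M F n \<tau> \<xi>"
  shows "j \<le> k \<Longrightarrow> k \<le> n \<Longrightarrow> \<tau> j \<le> \<tau> k" "k \<le> n \<Longrightarrow> 0 \<le> \<tau> k"
proof -
  show mono: "\<tau> j \<le> \<tau> k" if "j \<le> k" "k \<le> n" for j k
    using that
  proof (induction k)
    case (Suc k)
    show ?case
    proof (cases "j = Suc k")
      case False
      have "j \<le> k" "k \<le> n" using Suc.prems False by simp_all
      then have "\<tau> j \<le> \<tau> k" by (rule Suc.IH)
      also have "\<dots> < \<tau> (Suc k)" using Suc.prems S by (simp add: simple_process_def)
      finally show ?thesis by simp
    qed simp
  qed simp
  have "0 \<le> \<tau> 0" using S by (simp add: simple_process_def)
  then show "k \<le> n \<Longrightarrow> 0 \<le> \<tau> k" using mono[of 0 k] by simp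
qed

lemma simple_integral_process_continuous:
  assumes S: "simple_process M F n \<tau> \<xi>"
  shows "continuous_paths M (simple_integral_process B n \<tau> \<xi>)"
  unfolding continuous_paths_def
proof
  fix \<omega> assume "\<omega> \<in> space M"
  then have B: "continuous_on {0..} (\<lambda>t. B t \<omega>)" using B_continuous unfolding continuous_paths_def by blast
  have "continuous_on {0..} (\<lambda>t. B (min t (\<tau> k)) \<omega>)" if "k \<le> n" for k
    using simple_process_times(2)[OF S that]
    by (intro continuous_on_compose2[OF B] continuous_intros) auto
  then show "continuous_on {0..} (\<lambda>t. simple_integral_process B n \<tau> \<xi> t \<omega>)"
    unfolding simple_integral_process_def by (intro continuous_intros) auto
qed

lemma simple_process_measurable:
  assumes S: "simple_process M F n \<tau> \<xi>" and k: "k < n"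
  shows "\<xi> k \<in> borel_measurable M"
  using S k simple_process_times(2)[OF S, of k]
  by (intro measurable_F_M[of _ "\<tau> k"]) (auto simp: simple_process_def)

lemma simple_integral_process_measurable:
  assumes S: "simple_process M F n \<tau> \<xi>" and t: "0 \<le> t"
  shows "simple_integral_process B n \<tau> \<xi> t \<in> borel_measurable M"
  unfolding simple_integral_process_def[abs_def]
proof (intro borel_measurable_sum borel_measurable_times borel_measurable_diff)
  fix k assume k: "k \<in> {..<n}"
  show "\<xi> k \<in> borel_measurable M" using simple_process_measurable[OF S] k by simp
  show "B (min t (\<tau> (Suc k))) \<in> borel_measurable M" "B (min t (\<tau> k)) \<in> borel_measurable M"
    using t k simple_process_times(2)[OF S] by (auto intro!: B_M)
qed

text \<open>On a grid that contains both the test times \<open>D\<close> and the jump times of the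
  integrand, the simple integral is a discrete martingale transform with one coefficient per cell,
  to which \<open>discrete_martingale_tail\<close> applies.\<close>

lemma simple_integral_tail_finite:
  assumes S: "simple_process M F n \<tau> \<xi>" and T: "0 < T" and D: "finite D" "D \<subseteq> {0..T}"
    and R: "0 < R" and \<delta>: "0 < \<delta>"
  shows "prob ({\<omega>\<in>space M. \<exists>t\<in>D. R \<le> \<bar>simple_integral_process B n \<tau> \<xi> t \<omega>\<bar>} -
      {\<omega>\<in>space M. ennreal \<delta> \<le> (\<integral>\<^sup>+ s\<in>{0..T}. ennreal ((simple_value n \<tau> \<xi> s \<omega>)\<^sup>2) \<partial>lborel)}) \<le> \<delta> / R\<^sup>2"
    (is "prob (?X - ?V) \<le> _")
proof -
  note \<tau> = simple_process_times[OF S]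
  obtain C where C: "\<And>k \<omega>. k < n \<Longrightarrow> \<omega> \<in> space M \<Longrightarrow> \<bar>\<xi> k \<omega>\<bar> \<le> C"
    using S unfolding simple_process_def by blast
  define K where "K = {0, T} \<union> D \<union> (\<tau> ` {..n} \<inter> {0..T})"
  have K: "finite K" "K \<subseteq> {0..T}" "0 \<in> K" "T \<in> K" using D T by (auto simp: K_def)
  define xs where "xs = sorted_list_of_set K"
  define m where "m = length xs - 1"
  define \<sigma> where "\<sigma> k = xs ! k" for k
  have xs: "sorted xs" "distinct xs" "set xs = K" using K by (auto simp: xs_def)
  have len: "length xs = Suc m" using K xs unfolding m_def by (cases xs) auto
  have \<sigma>_less: "\<sigma> i < \<sigma> j" if "i < j" "j \<le> m" for i j
    unfolding \<sigma>_def using xs that len sorted_nth_mono[OF xs(1), of i j] nth_eq_iff_index_eq[OF xs(2), of i j] by force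
  have \<sigma>_le: "\<sigma> i \<le> \<sigma> j" if "i \<le> j" "j \<le> m" for i j
    using \<sigma>_less[of i j] that by (cases "i = j") auto
  have \<sigma>_K: "\<sigma> i \<in> K" if "i \<le> m" for i unfolding \<sigma>_def using xs(3) that len nth_mem[of i xs] by simp
  have ex_\<sigma>: "\<exists>i\<le>m. \<sigma> i = r" if "r \<in> K" for r
    using xs(3) that len unfolding \<sigma>_def by (metis in_set_conv_nth less_Suc_eq_le)
  have \<sigma>0: "\<sigma> 0 = 0"
  proof -
    obtain i where i: "i \<le> m" "\<sigma> i = 0" using ex_\<sigma> K by blast
    have "0 \<le> \<sigma> 0" using \<sigma>_K[of 0] K by auto
    then show ?thesis using \<sigma>_le[of 0 i] i by auto
  qed
  have \<sigma>_T: "\<sigma> i \<le> T" and \<sigma>_nonneg: "0 \<le> \<sigma> i" if "i \<le> m" for i using \<sigma>_K[OF that] K by auto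
  \<comment> \<open>No jump time lies strictly inside a cell: those up to \<open>T\<close> are grid
    points, the others lie beyond the grid.\<close>
  have gap: "\<tau> k \<le> \<sigma> j \<or> \<sigma> (Suc j) \<le> \<tau> k" if "k \<le> n" "j < m" for k j
  proof (cases "\<tau> k \<in> K")
    case True
    then obtain i where i: "i \<le> m" "\<sigma> i = \<tau> k" using ex_\<sigma> by blast
    show ?thesis
    proof (cases "i \<le> j")
      case True
      then show ?thesis using \<sigma>_le[of i j] i that by auto
    next
      case False
      then show ?thesis using \<sigma>_le[of "Suc j" i] i that by auto
    qed
  next
    case False
    then have "T < \<tau> k" using \<tau>(2)[OF that(1)] that unfolding K_def by auto
    then show ?thesis using \<sigma>_T[of "Suc j"] that by auto
  qed
  \<comment> \<open>The cells are open on the left, so the value of the integrand on a cell is read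
    at its right end. It is nevertheless known at the left end: an active
    \<open>\<tau> k < \<sigma> (Suc j)\<close> satisfies
    \<open>\<tau> k \<le> \<sigma> j\<close>.\<close>
  define c where "c j \<omega> = simple_value n \<tau> \<xi> (\<sigma> (Suc j)) \<omega>" for j \<omega>
  have ind: "indicator {\<tau> k<..\<tau> (Suc k)} s = (indicator {\<tau> k<..\<tau> (Suc k)} (\<sigma> (Suc j)) :: real)"
    if "k < n" "j < m" "s \<in> {\<sigma> j<..\<sigma> (Suc j)}" for k j s
    using gap[of k j] gap[of "Suc k" j] that \<sigma>_less[of j "Suc j"] by (auto simp: indicator_def)
  have value_c: "simple_value n \<tau> \<xi> s \<omega> = c j \<omega>" if "j < m" "s \<in> {\<sigma> j<..\<sigma> (Suc j)}" for j s \<omega>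
    unfolding c_def simple_value_def using ind[OF _ that] by (intro sum.cong) auto
  have cF: "c j \<in> borel_measurable (F (\<sigma> j))" if j: "j < m" for j
    unfolding c_def[abs_def] simple_value_def
  proof (intro borel_measurable_sum)
    fix k assume "k \<in> {..<n}"
    then have k: "k < n" by simp
    show "(\<lambda>\<omega>. \<xi> k \<omega> * indicator {\<tau> k<..\<tau> (Suc k)} (\<sigma> (Suc j))) \<in> borel_measurable (F (\<sigma> j))"
    proof (cases "\<tau> k < \<sigma> (Suc j)")
      case True
      then have le: "\<tau> k \<le> \<sigma> j" using gap[of k j] k j by auto
      have "\<xi> k \<in> borel_measurable (F (\<tau> k))" using S k by (simp add: simple_process_def)
      then have "\<xi> k \<in> borel_measurable (F (\<sigma> j))"
        by (rule measurable_F_mono[OF _ _ le]) (use \<tau>(2)[of k] k in simp)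
      then show ?thesis by (intro borel_measurable_times borel_measurable_const)
    qed (simp add: indicator_def)
  qed
  have cbd: "\<bar>c j \<omega>\<bar> \<le> real n * \<bar>C\<bar>" if "\<omega> \<in> space M" for j \<omega>
  proof -
    have "\<bar>c j \<omega>\<bar> \<le> (\<Sum>k<n. \<bar>\<xi> k \<omega> * indicator {\<tau> k<..\<tau> (Suc k)} (\<sigma> (Suc j))\<bar>)"
      unfolding c_def simple_value_def by (rule sum_abs)
    also have "\<dots> \<le> (\<Sum>k<n. \<bar>C\<bar>)"
    proof (rule sum_mono)
      fix k assume "k \<in> {..<n}"
      then have "\<bar>\<xi> k \<omega>\<bar> \<le> C" using C that by simp
      then show "\<bar>\<xi> k \<omega> * indicator {\<tau> k<..\<tau> (Suc k)} (\<sigma> (Suc j))\<bar> \<le> \<bar>C\<bar>"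
        by (auto simp: indicator_def)
    qed
    finally show ?thesis by simp
  qed
  define X where "X k \<omega> = (\<Sum>j<k. c j \<omega> * (B (\<sigma> (Suc j)) \<omega> - B (\<sigma> j) \<omega>))" for k \<omega>
  define V where "V k \<omega> = (\<Sum>j<k. (c j \<omega>)\<^sup>2 * (\<sigma> (Suc j) - \<sigma> j))" for k \<omega>
  have X_eq: "X j \<omega> = simple_integral_process B n \<tau> \<xi> (\<sigma> j) \<omega>" if "j \<le> m" for j \<omega>
    using that
  proof (induction j)
    case 0
    show ?case using \<tau>(2) by (simp add: X_def simple_integral_process_def \<sigma>0 min_absorb1)
  next
    case (Suc j)
    have j: "j < m" using Suc.prems by simp
    have lt: "\<sigma> j < \<sigma> (Suc j)" using \<sigma>_less j by simp
    have incr: "\<xi> k \<omega> * (B (min (\<sigma> (Suc j)) (\<tau> (Suc k))) \<omega> - B (min (\<sigma> (Suc j)) (\<tau> k)) \<omega>)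
       = \<xi> k \<omega> * (B (min (\<sigma> j) (\<tau> (Suc k))) \<omega> - B (min (\<sigma> j) (\<tau> k)) \<omega>)
         + \<xi> k \<omega> * indicator {\<tau> k<..\<tau> (Suc k)} (\<sigma> (Suc j)) * (B (\<sigma> (Suc j)) \<omega> - B (\<sigma> j) \<omega>)"
      if k: "k < n" for k
    proof -
      have "\<tau> k \<le> \<tau> (Suc k)" using \<tau>(1) k by simp
      \<comment> \<open>The cell lies after, inside or before the interval on which the
        \<open>k\<close>-th coefficient acts.\<close>
      then consider "\<tau> (Suc k) \<le> \<sigma> j" "\<tau> k \<le> \<sigma> j" | "\<tau> k \<le> \<sigma> j" "\<sigma> (Suc j) \<le> \<tau> (Suc k)"
        | "\<sigma> (Suc j) \<le> \<tau> k" "\<sigma> (Suc j) \<le> \<tau> (Suc k)"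
        using gap[of k j] gap[of "Suc k" j] k j by linarith
      then show ?thesis
      proof cases
        case 1
        then show ?thesis using lt by (simp add: min_absorb2 indicator_def)
      next
        case 2
        then show ?thesis using lt by (simp add: min_absorb1 min_absorb2 indicator_def algebra_simps)
      next
        case 3
        then show ?thesis using lt by (simp add: min_absorb1 indicator_def)
      qed
    qed
    have "X (Suc j) \<omega> = simple_integral_process B n \<tau> \<xi> (\<sigma> j) \<omega> + c j \<omega> * (B (\<sigma> (Suc j)) \<omega> - B (\<sigma> j) \<omega>)"
      using Suc.IH j by (simp add: X_def)
    also have "\<dots> = simple_integral_process B n \<tau> \<xi> (\<sigma> (Suc j)) \<omega>"
      unfolding simple_integral_process_def c_def simple_value_def sum_distrib_right sum.distrib[symmetric]
      using incr by (intro sum.cong) auto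
    finally show ?case .
  qed
  have V_le: "ennreal (V m \<omega>) \<le> (\<integral>\<^sup>+ s\<in>{0..T}. ennreal ((simple_value n \<tau> \<xi> s \<omega>)\<^sup>2) \<partial>lborel)" for \<omega>
  proof -
    have "ennreal (V m \<omega>) = (\<Sum>j<m. ennreal ((c j \<omega>)\<^sup>2 * (\<sigma> (Suc j) - \<sigma> j)))"
      unfolding V_def using \<sigma>_le by (intro sum_ennreal[symmetric]) auto
    also have "\<dots> = (\<Sum>j<m. \<integral>\<^sup>+ s. ennreal ((c j \<omega>)\<^sup>2) * indicator {\<sigma> j<..\<sigma> (Suc j)} s \<partial>lborel)"
      using \<sigma>_le by (intro sum.cong refl) (simp add: nn_integral_cmult_indicator ennreal_mult)
    also have "\<dots> = (\<integral>\<^sup>+ s. (\<Sum>j<m. ennreal ((c j \<omega>)\<^sup>2) * indicator {\<sigma> j<..\<sigma> (Suc j)} s) \<partial>lborel)"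
      by (intro nn_integral_sum[symmetric]) auto
    also have "\<dots> \<le> (\<integral>\<^sup>+ s\<in>{0..T}. ennreal ((simple_value n \<tau> \<xi> s \<omega>)\<^sup>2) \<partial>lborel)"
    proof (rule nn_integral_mono)
      fix s :: real
      show "(\<Sum>j<m. ennreal ((c j \<omega>)\<^sup>2) * indicator {\<sigma> j<..\<sigma> (Suc j)} s)
        \<le> ennreal ((simple_value n \<tau> \<xi> s \<omega>)\<^sup>2) * indicator {0..T} s"
      proof (cases "\<exists>j<m. s \<in> {\<sigma> j<..\<sigma> (Suc j)}")
        case True
        then obtain j where j: "j < m" "s \<in> {\<sigma> j<..\<sigma> (Suc j)}" by blast
        have out: "s \<notin> {\<sigma> i<..\<sigma> (Suc i)}" if "i < m" "i \<noteq> j" for i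
        proof (cases "i < j")
          case True
          then show ?thesis using \<sigma>_le[of "Suc i" j] j by auto
        next
          case False
          then show ?thesis using \<sigma>_le[of "Suc j" i] j that by auto
        qed
        have "(\<Sum>i<m. ennreal ((c i \<omega>)\<^sup>2) * indicator {\<sigma> i<..\<sigma> (Suc i)} s)
            = ennreal ((c j \<omega>)\<^sup>2) * indicator {\<sigma> j<..\<sigma> (Suc j)} s
              + (\<Sum>i\<in>{..<m} - {j}. ennreal ((c i \<omega>)\<^sup>2) * indicator {\<sigma> i<..\<sigma> (Suc i)} s)"
          using j by (intro sum.remove) auto
        also have "(\<Sum>i\<in>{..<m} - {j}. ennreal ((c i \<omega>)\<^sup>2) * indicator {\<sigma> i<..\<sigma> (Suc i)} s) = 0"
          using out by (intro sum.neutral) (auto simp: indicator_def)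
        finally show ?thesis
          using j value_c[OF j, of \<omega>] \<sigma>_nonneg[of j] \<sigma>_T[of "Suc j"] by (auto simp: indicator_def)
      next
        case False
        then have "(\<Sum>j<m. ennreal ((c j \<omega>)\<^sup>2) * indicator {\<sigma> j<..\<sigma> (Suc j)} s) = 0"
          by (intro sum.neutral) (auto simp: indicator_def)
        then show ?thesis by simp
      qed
    qed
    finally show ?thesis .
  qed
  have sub: "{\<omega>\<in>space M. \<exists>t\<in>D. R \<le> \<bar>simple_integral_process B n \<tau> \<xi> t \<omega>\<bar>}
      \<subseteq> {\<omega>\<in>space M. \<exists>k\<le>m. R \<le> \<bar>X k \<omega>\<bar>}"
  proof
    fix \<omega> assume "\<omega> \<in> {\<omega>\<in>space M. \<exists>t\<in>D. R \<le> \<bar>simple_integral_process B n \<tau> \<xi> t \<omega>\<bar>}"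
    then obtain t where t: "\<omega> \<in> space M" "t \<in> D" "R \<le> \<bar>simple_integral_process B n \<tau> \<xi> t \<omega>\<bar>" by blast
    obtain k where "k \<le> m" "\<sigma> k = t" using ex_\<sigma>[of t] t unfolding K_def by blast
    then show "\<omega> \<in> {\<omega>\<in>space M. \<exists>k\<le>m. R \<le> \<bar>X k \<omega>\<bar>}" using t X_eq by auto
  qed
  have "{\<omega>\<in>space M. \<exists>k\<le>m. R \<le> \<bar>X k \<omega>\<bar>} = (\<Union>k\<in>{..m}. {\<omega>\<in>space M. R \<le> \<bar>X k \<omega>\<bar>})" by auto
  also have "\<dots> \<in> events"
  proof (intro sets.finite_UN)
    fix k assume "k \<in> {..m}"
    then have "X k = simple_integral_process B n \<tau> \<xi> (\<sigma> k)" "0 \<le> \<sigma> k"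
      using X_eq \<sigma>_nonneg by auto
    then have "X k \<in> borel_measurable M" using simple_integral_process_measurable[OF S] by simp
    then show "{\<omega>\<in>space M. R \<le> \<bar>X k \<omega>\<bar>} \<in> events"
      by (intro borel_measurable_le borel_measurable_abs borel_measurable_const)
  qed simp
  finally have evX: "{\<omega>\<in>space M. \<exists>k\<le>m. R \<le> \<bar>X k \<omega>\<bar>} \<in> events" .
  have evV: "{\<omega>\<in>space M. \<delta> < V m \<omega>} \<in> events"
    unfolding V_def
  proof (intro borel_measurable_less borel_measurable_const borel_measurable_sum borel_measurable_times
      borel_measurable_power)
    fix j assume "j \<in> {..<m}"
    then show "c j \<in> borel_measurable M" using measurable_F_M[OF cF[of j] \<sigma>_nonneg[of j]] by simp
  qed
  have "{\<omega>\<in>space M. \<delta> < V m \<omega>} \<subseteq> ?V"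
  proof safe
    fix \<omega> assume "\<delta> < V m \<omega>"
    then have "ennreal \<delta> \<le> ennreal (V m \<omega>)" by (intro ennreal_leI) simp
    then show "ennreal \<delta> \<le> (\<integral>\<^sup>+ s\<in>{0..T}. ennreal ((simple_value n \<tau> \<xi> s \<omega>)\<^sup>2) \<partial>lborel)"
      using V_le by (rule order_trans)
  qed
  then have "prob (?X - ?V) \<le> prob ({\<omega>\<in>space M. \<exists>k\<le>m. R \<le> \<bar>X k \<omega>\<bar>} - {\<omega>\<in>space M. \<delta> < V m \<omega>})"
    by (intro finite_measure_mono Diff_mono sub sets.Diff evX evV)
  also have "\<dots> \<le> \<delta> / R\<^sup>2"
    unfolding X_def V_def
    by (rule discrete_martingale_tail[OF _ _ cF cbd R \<delta>]) (use \<sigma>0 \<sigma>_less in simp_all)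
  finally show ?thesis .
qed

end

text \<open>Joint measurability is given on nonnegative times only, hence the detour through the
  restricted measure, which gives the same integral over \<open>{0..T}\<close>.\<close>

lemma nn_integral_square_measurable:
  fixes f :: "real \<Rightarrow> 'w \<Rightarrow> real"
  assumes f: "(\<lambda>(s, \<omega>). f s \<omega>) \<in> borel_measurable (restrict_space lborel {0..} \<Otimes>\<^sub>M M)"
  shows "(\<lambda>\<omega>. \<integral>\<^sup>+ s\<in>{0..T}. ennreal ((f s \<omega>)\<^sup>2) \<partial>lborel) \<in> borel_measurable M"
proof -
  let ?N = "restrict_space lborel {0::real..}"
  interpret sigma_finite_measure ?N
    by (rule sigma_finite_measure_restrict_space[OF sigma_finite_lborel]) simp
  define g where "g p = ennreal ((case_prod f p)\<^sup>2) * indicator {0..T} (fst p)" for p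
  have ind: "(indicator {0..T} :: real \<Rightarrow> ennreal) \<in> borel_measurable ?N"
    by (intro measurable_restrict_space1 borel_measurable_indicator) simp
  have g: "g \<in> borel_measurable (?N \<Otimes>\<^sub>M M)"
    unfolding g_def
    by (intro borel_measurable_times_ennreal measurable_compose[OF measurable_fst ind]
        measurable_compose[OF borel_measurable_power[OF f] measurable_ennreal])
  have "(\<lambda>p. g (snd p, fst p)) \<in> borel_measurable (M \<Otimes>\<^sub>M ?N)"
    by (rule measurable_compose[OF measurable_pair_swap' g, unfolded split_beta', simplified])
  then have "(\<lambda>\<omega>. \<integral>\<^sup>+ s. g (s, \<omega>) \<partial>?N) \<in> borel_measurable M"
    by (intro borel_measurable_nn_integral) (simp add: split_beta')
  moreover have "(\<integral>\<^sup>+ s. g (s, \<omega>) \<partial>?N) = (\<integral>\<^sup>+ s\<in>{0..T}. ennreal ((f s \<omega>)\<^sup>2) \<partial>lborel)" for \<omega>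
    unfolding g_def
    by (subst nn_integral_restrict_space) (auto intro!: nn_integral_cong split: split_indicator)
  ultimately show ?thesis by simp
qed

lemma nn_integral_square_section:
  fixes f :: "real \<Rightarrow> 'w \<Rightarrow> real"
  assumes f: "(\<lambda>(s, \<omega>). f s \<omega>) \<in> borel_measurable (restrict_space lborel {0..} \<Otimes>\<^sub>M M)" and \<omega>: "\<omega> \<in> space M"
  shows "(\<lambda>s. ennreal ((f s \<omega>)\<^sup>2) * indicator {0..T} s) \<in> borel_measurable lborel"
proof -
  have "(\<lambda>s. f s \<omega>) \<in> borel_measurable (restrict_space lborel {0..})"
    using measurable_compose[OF measurable_Pair2'[OF \<omega>] f] by simp
  then have 1: "(\<lambda>s. ennreal ((f s \<omega>)\<^sup>2)) \<in> borel_measurable (restrict_space lborel {0..})"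
    by (intro measurable_compose[OF borel_measurable_power measurable_ennreal])
  have 2: "{0::real..} \<inter> space lborel \<in> sets lborel" by simp
  have "(\<lambda>s. ennreal ((f s \<omega>)\<^sup>2) * indicator {0..} s) \<in> borel_measurable lborel"
    using 1 unfolding borel_measurable_restrict_space_iff_ennreal[OF 2] .
  moreover have "(indicator {0..T} :: real \<Rightarrow> ennreal) \<in> borel_measurable lborel" by simp
  ultimately have "(\<lambda>s. ennreal ((f s \<omega>)\<^sup>2) * indicator {0..} s * indicator {0..T} s) \<in> borel_measurable lborel"
    by (rule borel_measurable_times_ennreal)
  moreover have "(\<lambda>s. ennreal ((f s \<omega>)\<^sup>2) * indicator {0..} s * indicator {0..T} s)
      = (\<lambda>s. ennreal ((f s \<omega>)\<^sup>2) * indicator {0..T} s)"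
    by (rule ext) (simp add: indicator_def)
  ultimately show ?thesis by (simp only:)
qed

context brownian_in_filtration
begin

lemma simple_value_measurable:
  assumes S: "simple_process M F n \<tau> \<xi>"
  shows "(\<lambda>(s, \<omega>). simple_value n \<tau> \<xi> s \<omega>) \<in> borel_measurable (restrict_space lborel {0..} \<Otimes>\<^sub>M M)"
proof -
  have "(\<lambda>p. \<Sum>k<n. \<xi> k (snd p) * indicator {\<tau> k<..\<tau> (Suc k)} (fst p))
      \<in> borel_measurable (restrict_space lborel {0..} \<Otimes>\<^sub>M M)"
  proof (intro borel_measurable_sum borel_measurable_times)
    fix k assume "k \<in> {..<n}"
    then show "(\<lambda>p. \<xi> k (snd p)) \<in> borel_measurable (restrict_space lborel {0..} \<Otimes>\<^sub>M M)"
      using measurable_compose[OF measurable_snd simple_process_measurable[OF S]] by simp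
    have "(\<lambda>x::real. indicator {\<tau> k<..\<tau> (Suc k)} x :: real) \<in> borel_measurable (restrict_space lborel {0..})"
      by (intro measurable_restrict_space1) simp
    from measurable_compose[OF measurable_fst this]
    show "(\<lambda>p. indicator {\<tau> k<..\<tau> (Suc k)} (fst p) :: real)
        \<in> borel_measurable (restrict_space lborel {0..} \<Otimes>\<^sub>M M)" .
  qed
  then show ?thesis unfolding simple_value_def by (simp add: split_beta')
qed

text \<open>The bound for finite sets of times does not depend on their number, so it passes to an
  increasing exhaustion of the rational times. The inequality for the path becomes strict because
  only a strict excess is visible at rational times.\<close>

lemma simple_integral_tail:
  assumes S: "simple_process M F n \<tau> \<xi>" and T: "0 < T" and R: "0 < R" and \<delta>: "0 < \<delta>"
  shows "prob ({\<omega>\<in>space M. \<exists>t\<in>{0..T}. R < \<bar>simple_integral_process B n \<tau> \<xi> t \<omega>\<bar>} -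
      {\<omega>\<in>space M. ennreal \<delta> \<le> (\<integral>\<^sup>+ s\<in>{0..T}. ennreal ((simple_value n \<tau> \<xi> s \<omega>)\<^sup>2) \<partial>lborel)}) \<le> \<delta> / R\<^sup>2"
    (is "prob (_ - ?V) \<le> ?r")
proof -
  let ?I = "simple_integral_process B n \<tau> \<xi>"
  have ev: "?V \<in> events"
    by (intro borel_measurable_le borel_measurable_const
        nn_integral_square_measurable[OF simple_value_measurable[OF S]])
  define Q where "Q = {0..T} \<inter> \<rat>"
  have "0 \<in> Q" using T by (simp add: Q_def)
  then have Q: "countable Q" "Q \<noteq> {}" using countable_rat unfolding Q_def by blast+
  define D where "D k = from_nat_into Q ` {..k::nat}" for k
  have D: "finite (D k)" "D k \<subseteq> {0..T}" for k
    using from_nat_into[OF Q(2)] unfolding D_def Q_def by auto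
  define E where "E k = {\<omega>\<in>space M. \<exists>t\<in>D k. R < \<bar>?I t \<omega>\<bar>}" for k
  have E_ev: "E k \<in> events" for k
  proof -
    have "E k = (\<Union>t\<in>D k. {\<omega>\<in>space M. R < \<bar>?I t \<omega>\<bar>})" unfolding E_def by auto
    also have "\<dots> \<in> events"
    proof (intro sets.finite_UN D)
      fix t assume "t \<in> D k"
      then have "0 \<le> t" using D(2)[of k] by auto
      then show "{\<omega>\<in>space M. R < \<bar>?I t \<omega>\<bar>} \<in> events"
        by (intro borel_measurable_less borel_measurable_abs borel_measurable_const
            simple_integral_process_measurable[OF S])
    qed
    finally show ?thesis .
  qed
  have le: "prob (E k - ?V) \<le> ?r" for k
  proof -
    have "prob (E k - ?V) \<le> prob ({\<omega>\<in>space M. \<exists>t\<in>D k. R \<le> \<bar>?I t \<omega>\<bar>} - ?V)"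
    proof (rule finite_measure_mono)
      have "{\<omega>\<in>space M. \<exists>t\<in>D k. R \<le> \<bar>?I t \<omega>\<bar>} = (\<Union>t\<in>D k. {\<omega>\<in>space M. R \<le> \<bar>?I t \<omega>\<bar>})" by auto
      also have "\<dots> \<in> events"
      proof (intro sets.finite_UN D)
        fix t assume "t \<in> D k"
        then have "0 \<le> t" using D(2)[of k] by auto
        then show "{\<omega>\<in>space M. R \<le> \<bar>?I t \<omega>\<bar>} \<in> events"
          by (intro borel_measurable_le borel_measurable_abs borel_measurable_const
              simple_integral_process_measurable[OF S])
      qed
      finally show "{\<omega>\<in>space M. \<exists>t\<in>D k. R \<le> \<bar>?I t \<omega>\<bar>} - ?V \<in> events" using ev by blast
    qed (auto simp: E_def intro: less_imp_le)
    also have "\<dots> \<le> ?r" by (rule simple_integral_tail_finite[OF S T D R \<delta>])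
    finally show ?thesis .
  qed
  have "{\<omega>\<in>space M. \<exists>t\<in>{0..T}. R < \<bar>?I t \<omega>\<bar>} = {\<omega>\<in>space M. \<exists>t\<in>Q. R < \<bar>?I t \<omega>\<bar>}"
    unfolding Q_def
    using simple_integral_process_continuous[OF S] T unfolding continuous_paths_def
    by (intro Collect_cong conj_cong refl continuous_exceeds_iff_rational) auto
  also have "\<dots> = (\<Union>k. E k)"
  proof -
    have "(\<Union>k. D k) = Q" unfolding D_def using range_from_nat_into[OF Q(2,1)] by blast
    then show ?thesis unfolding E_def by blast
  qed
  finally have U: "{\<omega>\<in>space M. \<exists>t\<in>{0..T}. R < \<bar>?I t \<omega>\<bar>} = (\<Union>k. E k)" .
  have "(\<lambda>k. prob (E k - ?V)) \<longlonglongrightarrow> prob (\<Union>k. E k - ?V)"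
  proof (rule finite_Lim_measure_incseq)
    show "range (\<lambda>k. E k - ?V) \<subseteq> events" using E_ev ev by auto
    show "incseq (\<lambda>k. E k - ?V)" unfolding incseq_def E_def D_def by fastforce
  qed
  moreover have "(\<Union>k. E k - ?V) = (\<Union>k. E k) - ?V" by blast
  ultimately show ?thesis unfolding U using le by (intro LIMSEQ_le_const2[of "\<lambda>k. prob (E k - ?V)"]) auto
qed

text \<open>Lenglart's inequality is transferred from the approximating simple integrals. The
  weakened constants make room for them: \<open>2 * R\<close> splits into \<open>R\<close> for the
  simple integral and \<open>R\<close> for its distance to \<open>J\<close>, and two squared norms
  below \<open>\<delta> / 4\<close> give one below \<open>\<delta>\<close>.\<close>

lemma ito_integral_lenglart:
  assumes J: "has_ito_integral M F B H J" and T: "0 < T" and R: "0 < R" and \<delta>: "0 < \<delta>"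
  shows "prob ({\<omega>\<in>space M. \<exists>t\<in>{0..T}. 2 * R < \<bar>J t \<omega>\<bar>} -
      {\<omega>\<in>space M. ennreal (\<delta> / 4) \<le> (\<integral>\<^sup>+ s\<in>{0..T}. ennreal ((H s \<omega>)\<^sup>2) \<partial>lborel)}) \<le> \<delta> / R\<^sup>2"
proof -
  have H: "(\<lambda>(s, \<omega>). H s \<omega>) \<in> borel_measurable (restrict_space lborel {0..} \<Otimes>\<^sub>M M)"
    and J_ad: "adapted F J" and J_cont: "continuous_paths M J"
    using J unfolding has_ito_integral_def by blast+
  obtain n \<tau> \<xi> where S: "\<And>m::nat. simple_process M F (n m) (\<tau> m) (\<xi> m)"
    and L2: "\<And>T \<epsilon>. 0 < T \<Longrightarrow> 0 < \<epsilon> \<Longrightarrow> (\<lambda>m. prob {\<omega>\<in>space M. ennreal \<epsilon> \<le>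
        (\<integral>\<^sup>+ s\<in>{0..T}. ennreal ((simple_value (n m) (\<tau> m) (\<xi> m) s \<omega> - H s \<omega>)\<^sup>2) \<partial>lborel)}) \<longlonglongrightarrow> 0"
    and ucp: "\<And>T \<epsilon>. 0 < T \<Longrightarrow> 0 < \<epsilon> \<Longrightarrow> (\<lambda>m. prob {\<omega>\<in>space M. \<epsilon> \<le>
        (SUP t\<in>{0..T}. \<bar>simple_integral_process B (n m) (\<tau> m) (\<xi> m) t \<omega> - J t \<omega>\<bar>)}) \<longlonglongrightarrow> 0"
    using J unfolding has_ito_integral_def by blast
  have J_M: "J t \<in> borel_measurable M" if "0 \<le> t" for t
    using J_ad that unfolding adapted_def by (intro measurable_F_M) auto
  define I where "I m = simple_integral_process B (n m) (\<tau> m) (\<xi> m)" for m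
  define v where "v m = simple_value (n m) (\<tau> m) (\<xi> m)" for m
  note I_cont = simple_integral_process_continuous[OF S, folded I_def]
  note I_M = simple_integral_process_measurable[OF S, folded I_def]
  note v_M = simple_value_measurable[OF S, folded v_def]
  have vH_M: "(\<lambda>(s, \<omega>). v m s \<omega> - H s \<omega>) \<in> borel_measurable (restrict_space lborel {0..} \<Otimes>\<^sub>M M)" for m
    using borel_measurable_diff[OF v_M[of m] H] by (simp add: split_beta')
  define A where "A m = {\<omega>\<in>space M. R \<le> (SUP t\<in>{0..T}. \<bar>I m t \<omega> - J t \<omega>\<bar>)}" for m
  define A' where "A' m = {\<omega>\<in>space M. \<exists>t\<in>{0..T}. R < \<bar>I m t \<omega>\<bar>}" for m
  define L where "L m = {\<omega>\<in>space M. ennreal (\<delta> / 4) \<le> (\<integral>\<^sup>+ s\<in>{0..T}. ennreal ((v m s \<omega> - H s \<omega>)\<^sup>2) \<partial>lborel)}" for m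
  define L' where "L' = {\<omega>\<in>space M. ennreal (\<delta> / 4) \<le> (\<integral>\<^sup>+ s\<in>{0..T}. ennreal ((H s \<omega>)\<^sup>2) \<partial>lborel)}"
  define W where "W m = {\<omega>\<in>space M. ennreal \<delta> \<le> (\<integral>\<^sup>+ s\<in>{0..T}. ennreal ((v m s \<omega>)\<^sup>2) \<partial>lborel)}" for m
  define E where "E = {\<omega>\<in>space M. \<exists>t\<in>{0..T}. 2 * R < \<bar>J t \<omega>\<bar>}"
  have IJ_cont: "continuous_paths M (\<lambda>t \<omega>. I m t \<omega> - J t \<omega>)" for m
    using I_cont[of m] J_cont unfolding continuous_paths_def by (auto intro: continuous_on_diff)
  have evA: "A m \<in> events" for m
    unfolding A_def by (intro le_SUP_abs_measurable[OF _ IJ_cont T] borel_measurable_diff I_M J_M)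
  have evA': "A' m \<in> events" for m
    unfolding A'_def by (rule exceeds_measurable[OF I_M I_cont T])
  have evL: "L m \<in> events" for m
    unfolding L_def by (intro borel_measurable_le borel_measurable_const nn_integral_square_measurable vH_M)
  have evW: "W m \<in> events" for m
    unfolding W_def by (intro borel_measurable_le borel_measurable_const nn_integral_square_measurable v_M)
  have sub1: "E \<subseteq> A m \<union> A' m" for m
  proof
    fix \<omega> assume "\<omega> \<in> E"
    then obtain t where t: "\<omega> \<in> space M" "t \<in> {0..T}" "2 * R < \<bar>J t \<omega>\<bar>" unfolding E_def by blast
    show "\<omega> \<in> A m \<union> A' m"
    proof (cases "R < \<bar>I m t \<omega>\<bar>")
      case True
      then show ?thesis using t unfolding A'_def by auto
    next
      case False
      then have ge: "R \<le> \<bar>I m t \<omega> - J t \<omega>\<bar>" using t by linarith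
      have c: "continuous_on {0..} (\<lambda>t. I m t \<omega> - J t \<omega>)"
        using IJ_cont t(1) unfolding continuous_paths_def by blast
      have "R \<le> (SUP t\<in>{0..T}. \<bar>I m t \<omega> - J t \<omega>\<bar>)"
        unfolding le_SUP_abs_iff[OF c T] using ge t(2) by (intro allI bexI[of _ t]) (auto intro: less_le_trans[of _ R])
      then show ?thesis using t unfolding A_def by auto
    qed
  qed
  have sub2: "W m \<subseteq> L m \<union> L'" for m
  proof
    fix \<omega> assume "\<omega> \<in> W m"
    then have \<omega>: "\<omega> \<in> space M" and ge: "ennreal \<delta> \<le> (\<integral>\<^sup>+ s\<in>{0..T}. ennreal ((v m s \<omega>)\<^sup>2) \<partial>lborel)"
      unfolding W_def by auto
    let ?x = "\<integral>\<^sup>+ s\<in>{0..T}. ennreal ((v m s \<omega> - H s \<omega>)\<^sup>2) \<partial>lborel"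
    let ?y = "\<integral>\<^sup>+ s\<in>{0..T}. ennreal ((H s \<omega>)\<^sup>2) \<partial>lborel"
    have "(\<integral>\<^sup>+ s\<in>{0..T}. ennreal ((v m s \<omega>)\<^sup>2) \<partial>lborel)
      \<le> (\<integral>\<^sup>+ s. 2 * (ennreal ((v m s \<omega> - H s \<omega>)\<^sup>2) * indicator {0..T} s)
          + 2 * (ennreal ((H s \<omega>)\<^sup>2) * indicator {0..T} s) \<partial>lborel)"
    proof (rule nn_integral_mono)
      fix s :: real
      \<comment> \<open>The difference of the two sides is the square of
        \<open>v m s \<omega> - 2 * H s \<omega>\<close>.\<close>
      have "(v m s \<omega>)\<^sup>2 \<le> 2 * (v m s \<omega> - H s \<omega>)\<^sup>2 + 2 * (H s \<omega>)\<^sup>2"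
        using zero_le_power2[of "v m s \<omega> - 2 * H s \<omega>"] by (simp add: power2_eq_square algebra_simps)
      then have "ennreal ((v m s \<omega>)\<^sup>2) \<le> ennreal (2 * (v m s \<omega> - H s \<omega>)\<^sup>2 + 2 * (H s \<omega>)\<^sup>2)" by (rule ennreal_leI)
      also have "\<dots> = 2 * ennreal ((v m s \<omega> - H s \<omega>)\<^sup>2) + 2 * ennreal ((H s \<omega>)\<^sup>2)"
        by (simp add: ennreal_plus ennreal_mult)
      finally show "ennreal ((v m s \<omega>)\<^sup>2) * indicator {0..T} s
        \<le> 2 * (ennreal ((v m s \<omega> - H s \<omega>)\<^sup>2) * indicator {0..T} s) + 2 * (ennreal ((H s \<omega>)\<^sup>2) * indicator {0..T} s)"
        by (auto split: split_indicator)
    qed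
    also have "\<dots> = 2 * ?x + 2 * ?y"
      using nn_integral_square_section[OF vH_M \<omega>] nn_integral_square_section[OF H \<omega>]
      by (subst nn_integral_add) (auto simp: nn_integral_cmult intro!: borel_measurable_times_ennreal)
    finally have le: "ennreal \<delta> \<le> 2 * ?x + 2 * ?y" using ge by (rule order_trans[rotated])
    show "\<omega> \<in> L m \<union> L'"
    proof (rule ccontr)
      assume "\<omega> \<notin> L m \<union> L'"
      then have x: "?x < ennreal (\<delta> / 4)" and y: "?y < ennreal (\<delta> / 4)" using \<omega> unfolding L_def L'_def by auto
      obtain x' where x': "?x = ennreal x'" "0 \<le> x'" using x by (cases ?x) auto
      obtain y' where y': "?y = ennreal y'" "0 \<le> y'" using y by (cases ?y) auto
      have eq: "2 * ?x + 2 * ?y = ennreal (2 * x' + 2 * y')"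
        unfolding x' y' using x'(2) y'(2) by (simp add: ennreal_plus ennreal_mult)
      have "\<delta> \<le> 2 * x' + 2 * y'"
        using le x'(2) y'(2) unfolding eq by (subst (asm) ennreal_le_iff) auto
      moreover have "x' < \<delta> / 4" "y' < \<delta> / 4"
        using x y x' y' \<delta> by (auto simp: ennreal_less_iff)
      ultimately show False by linarith
    qed
  qed
  have bound: "prob (E - L') \<le> prob (A m) + (prob (L m) + \<delta> / R\<^sup>2)" for m
  proof -
    have "E - L' \<subseteq> A m \<union> (L m \<union> (A' m - W m))" using sub1[of m] sub2[of m] by blast
    then have "prob (E - L') \<le> prob (A m \<union> (L m \<union> (A' m - W m)))"
      by (intro finite_measure_mono sets.Un sets.Diff evA evA' evL evW)
    also have "\<dots> \<le> prob (A m) + prob (L m \<union> (A' m - W m))"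
      by (intro measure_Un_le sets.Un sets.Diff evA evA' evL evW)
    also have "prob (L m \<union> (A' m - W m)) \<le> prob (L m) + prob (A' m - W m)"
      by (intro measure_Un_le sets.Diff evA' evL evW)
    also have "prob (A' m - W m) \<le> \<delta> / R\<^sup>2"
      using simple_integral_tail[OF S T R \<delta>, of m] unfolding A'_def W_def I_def v_def .
    finally show ?thesis by simp
  qed
  \<comment> \<open>The left side of \<open>bound\<close> does not involve \<open>m\<close>, so both
    approximation errors disappear in the limit.\<close>
  have "(\<lambda>m. prob (A m) + (prob (L m) + \<delta> / R\<^sup>2)) \<longlonglongrightarrow> 0 + (0 + \<delta> / R\<^sup>2)"
    unfolding A_def L_def I_def v_def using R \<delta> T by (intro tendsto_intros ucp L2) auto
  then have "prob (E - L') \<le> 0 + (0 + \<delta> / R\<^sup>2)"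
    using bound by (intro LIMSEQ_le_const[where X = "\<lambda>m. prob (A m) + (prob (L m) + \<delta> / R\<^sup>2)"]) auto
  then show ?thesis unfolding E_def L'_def by simp
qed

end

section \<open>Vanishing of the noise\<close>

lemma brownian_in_filtration_brownian_filtration:
  assumes b: "independent_brownian_motions M I b" and I: "finite I" "i \<in> I"
  shows "brownian_in_filtration M (brownian_filtration M I b) (b i)"
proof -
  let ?F = "brownian_filtration M I b"
  interpret prob_space M using b by (simp add: independent_brownian_motions_def)
  have B: "standard_brownian_motion M (b j)" if "j \<in> I" for j
    using b that by (simp add: independent_brownian_motions_def)
  have meas: "b j r \<in> borel_measurable M" if "j \<in> I" "0 \<le> r" for j r
    using B that by (simp add: standard_brownian_motion_def)
  define G where "G t = null_sets M \<union> {b j r -` A \<inter> space M | j r A. j \<in> I \<and> 0 \<le> r \<and> r \<le> t \<and> A \<in> sets borel}" for t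
  have G_events: "G t \<subseteq> events" for t unfolding G_def using measurable_sets[OF meas] by auto
  have G_Pow: "G t \<subseteq> Pow (space M)" for t using G_events sets.sets_into_space by blast
  have F_eq: "?F t = sigma (space M) (G t)" for t by (simp add: brownian_filtration_def G_def)
  have sets_eq: "sets (?F t) = sigma_sets (space M) (G t)" for t
    unfolding F_eq by (rule sets_measure_of[OF G_Pow])
  have space_eq: "space (?F t) = space M" for t
    unfolding F_eq by (rule space_measure_of[OF G_Pow])
  show ?thesis
  proof
    fix t show "space (?F t) = space M" by (rule space_eq)
    show "sets (?F t) \<subseteq> sets M" unfolding sets_eq by (rule sets.sigma_sets_subset[OF G_events])
    fix s assume "s \<le> t"
    then show "sets (?F s) \<subseteq> sets (?F t)"
      unfolding sets_eq by (intro sigma_sets_mono') (auto simp: G_def intro: order_trans)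
  next
    fix t :: real assume t: "0 \<le> t"
    show "b i t \<in> borel_measurable (?F t)"
    proof (rule measurableI)
      fix A :: "real set" assume "A \<in> sets borel"
      then have "b i t -` A \<inter> space M \<in> G t" using t I unfolding G_def by blast
      then show "b i t -` A \<inter> space (?F t) \<in> sets (?F t)" unfolding space_eq sets_eq by (rule sigma_sets.Basic)
    qed simp
  next
    show "continuous_paths M (b i)" using B[OF I(2)] by (simp add: standard_brownian_motion_def)
  next
    fix s t :: real assume st: "0 \<le> s" "s < t"
    show "distributed M lborel (\<lambda>\<omega>. b i t \<omega> - b i s \<omega>) (\<lambda>x. ennreal (normal_density 0 (sqrt (t - s)) x))"
      using B[OF I(2)] st by (simp add: standard_brownian_motion_def)
    fix A and C :: "real set" assume "A \<in> sets (?F s)" "C \<in> sets borel"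
    then show "prob (A \<inter> {\<omega>\<in>space M. b i t \<omega> - b i s \<omega> \<in> C}) = prob A * prob {\<omega>\<in>space M. b i t \<omega> - b i s \<omega> \<in> C}"
      by (rule brownian_filtration_increment_indep[OF b I st])
  qed
qed

text \<open>A nonnegative coordinate is at most the total mass. The bound is affine in
  \<open>\<epsilon>\<close> and holds for large errors too, as the doubling of the noise threshold
  requires.\<close>

lemma perturbed_solution_le:
  assumes y: "perturbed_solution \<alpha> N a T \<epsilon> y" and \<alpha>: "0 \<le> \<alpha>" and t: "t \<in> {0..T}" and i: "i \<in> {1..N}"
  shows "y i t \<le> (\<Sum>i=1..N. a i) + N * \<epsilon> + (N * \<alpha> + (real N)\<^sup>2) * T"
proof -
  define J where "J i = y i t - a i - (LBINT s:{0..t}. laguerre_drift \<alpha> N (\<lambda>j. y j s) i)" for i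
  have int: "set_integrable lborel {0..t} (\<lambda>s. laguerre_drift \<alpha> N (\<lambda>j. y j s) i)" if "i \<in> {1..N}" for i
  proof (rule set_integrable_subset)
    show "set_integrable lborel {0..T} (\<lambda>s. laguerre_drift \<alpha> N (\<lambda>j. y j s) i)"
      using y that unfolding perturbed_solution_def by blast
  qed (use t in auto)
  have o: "AE s in lborel. s \<in> {0..t} \<longrightarrow> ordered_config N (\<lambda>i. y i s)"
    using perturbed_solution_ordered[OF y] by eventually_elim (use t in auto)
  have "y i t \<le> (\<Sum>i=1..N. y i t)"
    using i y t unfolding perturbed_solution_def by (intro member_le_sum) auto
  also have "\<dots> \<le> (\<Sum>i=1..N. a i) + (\<Sum>i=1..N. J i) + (N * \<alpha> + (real N)\<^sup>2) * t"
    using t int o by (intro sum_solution_le[where Y = "\<lambda>s j. y j s"]) (auto simp: J_def)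
  also have "(\<Sum>i=1..N. J i) \<le> (\<Sum>i=1..N. \<epsilon>)"
    using y t unfolding perturbed_solution_def J_def by (intro sum_mono) (auto simp: abs_le_iff)
  also have "(N * \<alpha> + (real N)\<^sup>2) * t \<le> (N * \<alpha> + (real N)\<^sup>2) * T"
    using t \<alpha> by (intro mult_left_mono) auto
  finally show ?thesis by simp
qed

text \<open>The exceptional set \<open>Q \<rho>\<close> is where the noise exceeds \<open>\<rho>\<close>.
  The quadratic variation of the noise is at most \<open>4 T / \<beta>\<close> times the size of the solution, which
  is in turn controlled by the noise. Hence the noise can only exceed \<open>\<rho>\<close> by exceeding \<open>2 \<rho>\<close>,
  \<open>4 \<rho>\<close>, \dots, up to events with summable probabilities.\<close>

lemma laguerre_noise:
  assumes L: "beta_laguerre_process \<alpha> \<beta> N a M b l" and \<alpha>: "0 \<le> \<alpha>" and N: "1 \<le> N" and \<beta>: "0 < \<beta>"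
    and T: "0 < T" and a: "\<And>i. i \<in> {1..N} \<Longrightarrow> 0 \<le> a i"
  defines "c \<equiv> (\<Sum>i=1..N. a i) + (N * \<alpha> + (real N)\<^sup>2) * T"
  obtains Q where "\<And>\<rho>. Q \<rho> \<in> sets M"
    "\<And>\<rho>. AE \<omega> in M. \<omega> \<notin> Q \<rho> \<longrightarrow> perturbed_solution \<alpha> N a T \<rho> (\<lambda>i t. l i t \<omega>)"
    "\<And>\<rho> \<kappa>. 0 < \<rho> \<Longrightarrow> 0 < \<kappa> \<Longrightarrow> 64 * real N * T * (c + 2 * real N * \<rho>) / (\<kappa> * \<rho>\<^sup>2) < \<beta> \<Longrightarrow> measure M (Q \<rho>) \<le> 2 * \<kappa>"
proof -
  let ?F = "brownian_filtration M {1..N} b"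
  let ?H = "\<lambda>i s \<omega>. 2 / sqrt \<beta> * sqrt (l i s \<omega>)"
  have b: "independent_brownian_motions M {1..N} b" using L by (simp add: beta_laguerre_process_def)
  interpret prob_space M using b by (simp add: independent_brownian_motions_def)
  have "\<forall>i\<in>{1..N}. \<exists>J. has_ito_integral M ?F (b i) (?H i) J \<and>
      (AE \<omega> in M. \<forall>t\<ge>0. l i t \<omega> = a i + J t \<omega> + (LBINT s:{0..t}. laguerre_drift \<alpha> N (\<lambda>j. l j s \<omega>) i))"
    using L unfolding beta_laguerre_process_def by blast
  from bchoice[OF this] obtain J where JJ: "\<forall>i\<in>{1..N}. has_ito_integral M ?F (b i) (?H i) (J i) \<and>
      (AE \<omega> in M. \<forall>t\<ge>0. l i t \<omega> = a i + J i t \<omega> + (LBINT s:{0..t}. laguerre_drift \<alpha> N (\<lambda>j. l j s \<omega>) i))" ..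
  have J: "has_ito_integral M ?F (b i) (?H i) (J i)"
    and eq: "AE \<omega> in M. \<forall>t\<ge>0. l i t \<omega> = a i + J i t \<omega> + (LBINT s:{0..t}. laguerre_drift \<alpha> N (\<lambda>j. l j s \<omega>) i)"
    if "i \<in> {1..N}" for i
    using bspec[OF JJ that] by (rule conjunct1, rule conjunct2)
  have BF: "brownian_in_filtration M ?F (b i)" if "i \<in> {1..N}" for i
    using brownian_in_filtration_brownian_filtration[OF b _ that] by simp
  have J_M: "J i t \<in> borel_measurable M" if "i \<in> {1..N}" "0 \<le> t" for i t
    using J[OF that(1)] that(2) unfolding has_ito_integral_def adapted_def
    by (intro brownian_in_filtration.measurable_F_M[OF BF[OF that(1)]]) auto
  have J_cont: "continuous_paths M (J i)" if "i \<in> {1..N}" for i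
    using J[OF that] unfolding has_ito_integral_def by blast
  define E where "E i \<rho> = {\<omega>\<in>space M. \<exists>t\<in>{0..T}. \<rho> < \<bar>J i t \<omega>\<bar>}" for i \<rho>
  define Q where "Q \<rho> = (\<Union>i\<in>{1..N}. E i \<rho>)" for \<rho>
  have E: "E i \<rho> \<in> events" if "i \<in> {1..N}" for i \<rho>
    unfolding E_def by (rule exceeds_measurable[OF J_M[OF that] J_cont[OF that] T])
  have Q: "Q \<rho> \<in> events" for \<rho> unfolding Q_def using E by (intro sets.finite_UN) auto
  have sol: "AE \<omega> in M. \<omega> \<notin> Q \<rho> \<longrightarrow> perturbed_solution \<alpha> N a T \<rho> (\<lambda>i t. l i t \<omega>)" for \<rho>
  proof -
    have "AE \<omega> in M. \<forall>i\<in>{1..N}. \<forall>t\<ge>0.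
        l i t \<omega> = a i + J i t \<omega> + (LBINT s:{0..t}. laguerre_drift \<alpha> N (\<lambda>j. l j s \<omega>) i)"
      using eq by (intro AE_finite_allI) auto
    moreover have "AE \<omega> in M. \<forall>i\<in>{1..N}. \<forall>T>0. set_integrable lborel {0..T} (\<lambda>s. laguerre_drift \<alpha> N (\<lambda>j. l j s \<omega>) i)"
      using L unfolding beta_laguerre_process_def by (intro AE_finite_allI) auto
    moreover have "AE \<omega> in M. \<forall>t\<ge>0. \<forall>i\<in>{1..N}. 0 \<le> l i t \<omega> \<and> (\<forall>j\<in>{1..N}. i \<le> j \<longrightarrow> l i t \<omega> \<le> l j t \<omega>)"
      "AE \<omega> in M. AE t in lborel. 0 < t \<longrightarrow> inj_on (\<lambda>i. l i t \<omega>) {1..N}"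
      using L unfolding beta_laguerre_process_def by blast+
    moreover have "AE \<omega> in M. \<omega> \<in> space M" by (rule AE_space)
    ultimately show ?thesis
    proof eventually_elim
      case (elim \<omega>)
      show ?case
      proof
        assume nQ: "\<omega> \<notin> Q \<rho>"
        have "continuous_on {0..T} (\<lambda>t. l i t \<omega>)" if "i \<in> {1..N}" for i
        proof -
          have "continuous_on {0..} (\<lambda>t. l i t \<omega>)"
            using L that elim(5) unfolding beta_laguerre_process_def continuous_paths_def by blast
          then show ?thesis by (rule continuous_on_subset) auto
        qed
        moreover have "AE t in lborel. 0 < t \<longrightarrow> t \<le> T \<longrightarrow> inj_on (\<lambda>i. l i t \<omega>) {1..N}"
          using elim(4) by eventually_elim auto
        moreover have "\<bar>l i t \<omega> - a i - (LBINT s:{0..t}. laguerre_drift \<alpha> N (\<lambda>j. l j s \<omega>) i)\<bar> \<le> \<rho>"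
          if "i \<in> {1..N}" "t \<in> {0..T}" for i t
        proof -
          have "l i t \<omega> = a i + J i t \<omega> + (LBINT s:{0..t}. laguerre_drift \<alpha> N (\<lambda>j. l j s \<omega>) i)"
            using elim(1) that by auto
          moreover have "\<bar>J i t \<omega>\<bar> \<le> \<rho>"
            using nQ elim(5) that unfolding Q_def E_def by (auto simp: not_less)
          ultimately show ?thesis by simp
        qed
        ultimately show "perturbed_solution \<alpha> N a T \<rho> (\<lambda>i t. l i t \<omega>)"
          unfolding perturbed_solution_def using elim(2,3) T by auto
      qed
    qed
  qed
  have c0: "0 \<le> c" unfolding c_def using a \<alpha> T by (intro add_nonneg_nonneg sum_nonneg mult_nonneg_nonneg) auto
  \<comment> \<open>Outside \<open>Q r\<close> the solution is at most \<open>c + N * r\<close>, so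
    the quadratic variation up to \<open>T\<close> is at most
    \<open>4 / \<beta> * (c + N * r) * T\<close>. The condition on \<open>r\<close> says that this
    is below \<open>\<delta> / 4\<close>, whence the 16.\<close>
  have qv: "AE \<omega> in M. ennreal (\<delta> / 4) \<le> (\<integral>\<^sup>+ s\<in>{0..T}. ennreal ((?H i s \<omega>)\<^sup>2) \<partial>lborel) \<longrightarrow> \<omega> \<in> Q r"
    if i: "i \<in> {1..N}" and r: "16 * T * (c + real N * r) < \<beta> * \<delta>" for i r \<delta>
    using sol[of r]
  proof eventually_elim
    case (elim \<omega>)
    show ?case
    proof (rule impI, rule ccontr)
      assume ge: "ennreal (\<delta> / 4) \<le> (\<integral>\<^sup>+ s\<in>{0..T}. ennreal ((?H i s \<omega>)\<^sup>2) \<partial>lborel)" and "\<omega> \<notin> Q r"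
      then have y: "perturbed_solution \<alpha> N a T r (\<lambda>i t. l i t \<omega>)" using elim by blast
      have le: "(?H i s \<omega>)\<^sup>2 \<le> 4 / \<beta> * (c + real N * r)" "0 \<le> c + real N * r" if "s \<in> {0..T}" for s
      proof -
        have l0: "0 \<le> l i s \<omega>" using y i that unfolding perturbed_solution_def by blast
        have l1: "l i s \<omega> \<le> c + real N * r" using perturbed_solution_le[OF y \<alpha> that i] unfolding c_def by simp
        have "(?H i s \<omega>)\<^sup>2 = 4 / \<beta> * l i s \<omega>" using l0 \<beta> by (simp add: power_mult_distrib power_divide)
        also have "\<dots> \<le> 4 / \<beta> * (c + real N * r)" using l1 \<beta> by (intro mult_left_mono) auto
        finally show "(?H i s \<omega>)\<^sup>2 \<le> 4 / \<beta> * (c + real N * r)" .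
        show "0 \<le> c + real N * r" using l0 l1 by linarith
      qed
      have c1: "0 \<le> c + real N * r" using le(2)[of 0] T by simp
      have "(\<integral>\<^sup>+ s\<in>{0..T}. ennreal ((?H i s \<omega>)\<^sup>2) \<partial>lborel)
          \<le> (\<integral>\<^sup>+ s\<in>{0..T}. ennreal (4 / \<beta> * (c + real N * r)) \<partial>lborel)"
        using le(1) by (intro nn_integral_mono) (auto split: split_indicator intro!: ennreal_leI)
      also have "\<dots> = ennreal (4 / \<beta> * (c + real N * r) * T)"
        using T \<beta> c1 by (simp add: nn_integral_cmult_indicator ennreal_mult[symmetric])
      finally have "ennreal (\<delta> / 4) \<le> ennreal (4 / \<beta> * (c + real N * r) * T)" using ge by (rule order_trans[rotated])
      then have "\<delta> / 4 \<le> 4 / \<beta> * (c + real N * r) * T"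
        using T \<beta> c1 by (subst (asm) ennreal_le_iff) auto
      then have "\<beta> * \<delta> \<le> 16 * T * (c + real N * r)" using \<beta> by (simp add: field_simps)
      then show False using r by linarith
    qed
  qed
  \<comment> \<open>A large quadratic variation is charged to the event \<open>Q r\<close>; on the
    complement Lenglart's inequality costs \<open>\<delta> / R\<close> squared \<open>R\<close> for
    each coordinate.\<close>
  have step: "prob (Q (2 * R)) \<le> prob (Q r) + N * (\<delta> / R\<^sup>2)"
    if R: "0 < R" and \<delta>: "0 < \<delta>" and r: "16 * T * (c + real N * r) < \<beta> * \<delta>" for R r \<delta>
  proof -
    define K where "K i = {\<omega>\<in>space M. ennreal (\<delta> / 4) \<le> (\<integral>\<^sup>+ s\<in>{0..T}. ennreal ((?H i s \<omega>)\<^sup>2) \<partial>lborel)}" for i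
    have K: "K i \<in> events" if "i \<in> {1..N}" for i
      unfolding K_def
    proof (intro borel_measurable_le borel_measurable_const nn_integral_square_measurable)
      show "(\<lambda>(s, \<omega>). ?H i s \<omega>) \<in> borel_measurable (restrict_space lborel {0..} \<Otimes>\<^sub>M M)"
        using J[OF that] unfolding has_ito_integral_def by blast
    qed
    have EK: "E i (2 * R) - K i \<in> events" if "i \<in> {1..N}" for i using E K that by blast
    then have UN: "(\<Union>i\<in>{1..N}. E i (2 * R) - K i) \<in> events" by (intro sets.finite_UN) auto
    have "AE \<omega> in M. \<forall>i\<in>{1..N}. \<omega> \<in> K i \<longrightarrow> \<omega> \<in> Q r"
    proof (intro AE_finite_allI)
      fix i assume i: "i \<in> {1..N}"
      show "AE \<omega> in M. \<omega> \<in> K i \<longrightarrow> \<omega> \<in> Q r" using qv[OF i r] by eventually_elim (simp add: K_def)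
    qed simp
    then have "AE \<omega> in M. \<omega> \<in> Q (2 * R) \<longrightarrow> \<omega> \<in> Q r \<union> (\<Union>i\<in>{1..N}. E i (2 * R) - K i)"
      by eventually_elim (auto simp: Q_def[of "2 * R"])
    then have "prob (Q (2 * R)) \<le> prob (Q r \<union> (\<Union>i\<in>{1..N}. E i (2 * R) - K i))"
      using Q UN by (intro finite_measure_mono_AE) auto
    also have "\<dots> \<le> prob (Q r) + prob (\<Union>i\<in>{1..N}. E i (2 * R) - K i)" by (rule measure_Un_le[OF Q UN])
    also have "prob (\<Union>i\<in>{1..N}. E i (2 * R) - K i) \<le> (\<Sum>i\<in>{1..N}. prob (E i (2 * R) - K i))"
      using EK by (intro finite_measure_subadditive_finite) auto
    also have "\<dots> \<le> (\<Sum>i\<in>{1..N}. \<delta> / R\<^sup>2)"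
      unfolding E_def K_def
      by (intro sum_mono brownian_in_filtration.ito_integral_lenglart[OF BF J T R \<delta>])
    finally show ?thesis by simp
  qed
  have small: "prob (Q \<rho>) \<le> 2 * \<kappa>"
    if \<rho>: "0 < \<rho>" and \<kappa>: "0 < \<kappa>" and large: "64 * real N * T * (c + 2 * real N * \<rho>) / (\<kappa> * \<rho>\<^sup>2) < \<beta>" for \<rho> \<kappa>
  proof -
    define R where "R m = \<rho> * 2 ^ m" for m :: nat
    have Rstep: "prob (Q (R m)) \<le> prob (Q (R (Suc m))) + \<kappa> / 2 ^ m" for m
    proof -
      \<comment> \<open>Chosen to make the loss of \<open>step\<close> at \<open>R m / 2\<close>
        equal to \<open>\<kappa> / 2 ^ m\<close>. As both sides of the condition in
        \<open>step\<close> then grow like \<open>2 ^ m\<close>, a single lower bound on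
        \<open>\<beta>\<close> serves all levels; its factor \<open>64 * N\<close> is 16 times the
        \<open>4 * N\<close> in this denominator.\<close>
      define \<delta> where "\<delta> = \<kappa> * \<rho>\<^sup>2 * 2 ^ m / (4 * N)"
      have \<delta>: "0 < \<delta>" unfolding \<delta>_def using \<kappa> \<rho> N by simp
      have "64 * real N * T * (c + 2 * real N * \<rho>) < \<beta> * (\<kappa> * \<rho>\<^sup>2)"
        using large \<kappa> \<rho> by (simp add: divide_less_eq)
      then have "64 * real N * T * (c + 2 * real N * \<rho>) * 2 ^ m < \<beta> * (\<kappa> * \<rho>\<^sup>2) * 2 ^ m" by simp
      moreover have "\<beta> * (\<kappa> * \<rho>\<^sup>2) * 2 ^ m = 4 * N * (\<beta> * \<delta>)" unfolding \<delta>_def using N by simp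
      moreover have "64 * real N * T * (c + 2 * real N * \<rho>) * 2 ^ m = 4 * N * (16 * T * (c * 2 ^ m + N * R (Suc m)))"
        unfolding R_def by (simp add: algebra_simps)
      ultimately have "4 * real N * (16 * T * (c * 2 ^ m + N * R (Suc m))) < 4 * real N * (\<beta> * \<delta>)" by (simp only:)
      then have "16 * T * (c * 2 ^ m + N * R (Suc m)) < \<beta> * \<delta>" using N by simp
      moreover have "c * 1 \<le> c * 2 ^ m" using c0 by (intro mult_left_mono) auto
      then have "16 * T * (c + N * R (Suc m)) \<le> 16 * T * (c * 2 ^ m + N * R (Suc m))"
        using T by (intro mult_left_mono add_right_mono) auto
      ultimately have "16 * T * (c + N * R (Suc m)) < \<beta> * \<delta>" by linarith
      moreover have "0 < R m / 2" unfolding R_def using \<rho> by simp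
      ultimately have "prob (Q (2 * (R m / 2))) \<le> prob (Q (R (Suc m))) + N * (\<delta> / (R m / 2)\<^sup>2)"
        using \<delta> by (intro step)
      moreover have "N * (\<delta> / (R m / 2)\<^sup>2) = \<kappa> / 2 ^ m"
        unfolding \<delta>_def R_def using N \<rho> by (simp add: field_simps power2_eq_square)
      ultimately show ?thesis by simp
    qed
    have iter: "prob (Q \<rho>) \<le> prob (Q (R m)) + 2 * \<kappa>" for m
    proof -
      have "prob (Q \<rho>) \<le> prob (Q (R m)) + (\<Sum>k<m. \<kappa> / 2 ^ k)"
      proof (induction m)
        case 0 then show ?case by (simp add: R_def)
      next
        case (Suc m) then show ?case using Rstep[of m] by simp
      qed
      also have "(\<Sum>k<m. \<kappa> / 2 ^ k) \<le> 2 * \<kappa>"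
      proof -
        have "(\<Sum>k<m. \<kappa> / 2 ^ k) = \<kappa> * (2 - 2 / 2 ^ m)"
          by (induction m) (simp_all add: field_simps)
        also have "\<dots> \<le> \<kappa> * 2" using \<kappa> by (intro mult_left_mono) auto
        finally show ?thesis by simp
      qed
      finally show ?thesis by simp
    qed
    have "(\<lambda>m. prob (Q (R m))) \<longlonglongrightarrow> prob (\<Inter>m. Q (R m))"
    proof (rule finite_Lim_measure_decseq)
      show "range (\<lambda>m. Q (R m)) \<subseteq> events" using Q by auto
      have R_mono: "R m \<le> R m'" if "m \<le> m'" for m m' unfolding R_def using that \<rho> by (intro mult_left_mono power_increasing) auto
      show "decseq (\<lambda>m. Q (R m))"
        unfolding decseq_def
      proof (intro allI impI subsetI)
        fix m m' \<omega> assume "m \<le> m'" and "\<omega> \<in> Q (R m')"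
        then obtain i t where "i \<in> {1..N}" "\<omega> \<in> space M" "t \<in> {0..T}" "R m' < \<bar>J i t \<omega>\<bar>" "R m \<le> R m'"
          using R_mono unfolding Q_def E_def by blast
        moreover from this have "R m < \<bar>J i t \<omega>\<bar>" by linarith
        ultimately show "\<omega> \<in> Q (R m)" unfolding Q_def E_def by blast
      qed
    qed
    \<comment> \<open>Each path of the noise is continuous, hence bounded on \<open>{0..T}\<close>,
      and cannot exceed every \<open>R m\<close>. This removes the remainder of the iteration
      without a moment bound.\<close>
    moreover have "(\<Inter>m. Q (R m)) = {}"
    proof (rule ccontr)
      assume "(\<Inter>m. Q (R m)) \<noteq> {}"
      then obtain \<omega> where \<omega>: "\<And>m. \<omega> \<in> Q (R m)" by blast
      then have sp: "\<omega> \<in> space M" unfolding Q_def E_def by auto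
      have "\<forall>i\<in>{1..N}. \<exists>C. \<forall>t\<in>{0..T}. \<bar>J i t \<omega>\<bar> \<le> C"
      proof
        fix i assume i: "i \<in> {1..N}"
        have "continuous_on {0..T} (\<lambda>t. J i t \<omega>)"
          by (rule continuous_on_subset[of "{0..}"]) (use J_cont[OF i] sp in \<open>auto simp: continuous_paths_def\<close>)
        then have "bounded ((\<lambda>t. J i t \<omega>) ` {0..T})" by (intro compact_imp_bounded compact_continuous_image) auto
        then show "\<exists>C. \<forall>t\<in>{0..T}. \<bar>J i t \<omega>\<bar> \<le> C" unfolding bounded_iff by auto
      qed
      from bchoice[OF this] obtain C where C: "\<forall>i\<in>{1..N}. \<forall>t\<in>{0..T}. \<bar>J i t \<omega>\<bar> \<le> C i" ..
      obtain m :: nat where m: "(\<Sum>i=1..N. \<bar>C i\<bar>) / \<rho> < 2 ^ m" using real_arch_pow[of 2] by auto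
      obtain i t where it: "i \<in> {1..N}" "t \<in> {0..T}" "R m < \<bar>J i t \<omega>\<bar>"
        using \<omega>[of m] unfolding Q_def E_def by auto
      have "\<bar>J i t \<omega>\<bar> \<le> \<bar>C i\<bar>" using bspec[OF bspec[OF C it(1)] it(2)] by linarith
      also have "\<dots> \<le> (\<Sum>i=1..N. \<bar>C i\<bar>)" using it(1) by (intro member_le_sum) auto
      also have "\<dots> < R m" using m \<rho> unfolding R_def by (simp add: field_simps)
      finally show False using it(3) by simp
    qed
    ultimately have "(\<lambda>m. prob (Q (R m)) + 2 * \<kappa>) \<longlonglongrightarrow> 0 + 2 * \<kappa>" by (intro tendsto_intros) simp
    then have "prob (Q \<rho>) \<le> 0 + 2 * \<kappa>" using iter by (intro LIMSEQ_le_const) auto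
    then show ?thesis by simp
  qed
  show ?thesis by (rule that[OF Q sol small])
qed

section \<open>Convergence of the processes\<close>

theorem theorem5p2:
  fixes \<alpha> :: real and N :: nat and a :: "nat \<Rightarrow> real"
  assumes "\<alpha> > 0" and "N \<ge> 2"
    and "0 \<le> a 1" and "\<And>i j. 1 \<le> i \<Longrightarrow> i \<le> j \<Longrightarrow> j \<le> N \<Longrightarrow> a i \<le> a j"
  shows "\<exists>x :: nat \<Rightarrow> real \<Rightarrow> real.
    (\<forall>i\<in>{1..N}. continuous_on {0..} (x i)) \<and>
    (\<forall>(M :: real \<Rightarrow> 'w measure) (b :: real \<Rightarrow> nat \<Rightarrow> real \<Rightarrow> 'w \<Rightarrow> real)
        (l :: real \<Rightarrow> nat \<Rightarrow> real \<Rightarrow> 'w \<Rightarrow> real).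
       (\<forall>\<beta>\<ge>1. beta_laguerre_process \<alpha> \<beta> N a (M \<beta>) (b \<beta>) (l \<beta>)) \<longrightarrow>
       (\<forall>T>0. \<forall>i\<in>{1..N}. \<forall>\<epsilon>>0.
          ((\<lambda>\<beta>. measure (M \<beta>)
                  {\<omega>\<in>space (M \<beta>). (SUP t\<in>{0..T}. \<bar>l \<beta> i t \<omega> - x i t\<bar>) \<ge> \<epsilon>}) \<longlongrightarrow> 0) at_top))"
proof -
  have a: "0 \<le> a i" if "i \<in> {1..N}" for i
    using assms(3) assms(4)[of 1 i] that by auto
  have \<alpha>: "0 \<le> \<alpha>" and N: "1 \<le> N" using assms by auto
  define c where "c T = (\<Sum>i=1..N. a i) + (N * \<alpha> + (real N)\<^sup>2) * T" for T
  show ?thesis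
  \<comment> \<open>The functions \<open>x\<close> must be named before any process is given.
    Existence of perturbed solutions is a deterministic question; if it fails, no family of
    processes exists on the type \<open>'w\<close> and any \<open>x\<close> will do.\<close>
  proof (cases "\<forall>T>0. \<forall>\<epsilon>>0. \<exists>y. perturbed_solution \<alpha> N a T \<epsilon> y")
    case True
    obtain x where x: "\<And>i. i \<in> {1..N} \<Longrightarrow> continuous_on {0..} (x i)"
      and close: "\<And>T \<rho>. 0 < T \<Longrightarrow> 0 < \<rho> \<Longrightarrow> \<exists>\<epsilon>>0. \<forall>y. perturbed_solution \<alpha> N a T \<epsilon> y \<longrightarrow>
       (\<forall>i\<in>{1..N}. \<forall>t\<in>{0..T}. \<bar>y i t - x i t\<bar> \<le> \<rho>)"
      using perturbed_solution_limit[OF \<alpha>, of N a] a True by metis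
    show ?thesis
    proof (rule exI[of _ x], intro conjI ballI allI impI x)
      fix M :: "real \<Rightarrow> 'w measure" and b l and T :: real and i and \<epsilon> :: real
      assume L: "\<forall>\<beta>\<ge>1. beta_laguerre_process \<alpha> \<beta> N a (M \<beta>) (b \<beta>) (l \<beta>)"
        and T: "0 < T" and i: "i \<in> {1..N}" and \<epsilon>: "0 < \<epsilon>"
      \<comment> \<open>The distance \<open>\<epsilon> / 2\<close> leaves a margin, since a
        pointwise bound passes to the supremum only as a weak inequality.\<close>
      obtain \<rho> where \<rho>: "0 < \<rho>" and near: "\<And>y i t. perturbed_solution \<alpha> N a T \<rho> y \<Longrightarrow>
          i \<in> {1..N} \<Longrightarrow> t \<in> {0..T} \<Longrightarrow> \<bar>y i t - x i t\<bar> \<le> \<epsilon> / 2"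
        using close[OF T, of "\<epsilon> / 2"] \<epsilon> by auto
      define S where "S \<beta> = {\<omega>\<in>space (M \<beta>). (SUP t\<in>{0..T}. \<bar>l \<beta> i t \<omega> - x i t\<bar>) \<ge> \<epsilon>}" for \<beta>
      have bound: "measure (M \<beta>) (S \<beta>) \<le> 2 * \<kappa>"
        if "1 \<le> \<beta>" "0 < \<kappa>" and large: "64 * real N * T * (c T + 2 * real N * \<rho>) / (\<kappa> * \<rho>\<^sup>2) < \<beta>" for \<beta> \<kappa>
      proof -
        have L\<beta>: "beta_laguerre_process \<alpha> \<beta> N a (M \<beta>) (b \<beta>) (l \<beta>)" and \<beta>: "0 < \<beta>"
          using L that by auto
        interpret prob_space "M \<beta>"
          using L\<beta> by (simp add: beta_laguerre_process_def independent_brownian_motions_def)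
        obtain Q where Q: "\<And>\<rho>. Q \<rho> \<in> sets (M \<beta>)"
          "\<And>\<rho>. AE \<omega> in M \<beta>. \<omega> \<notin> Q \<rho> \<longrightarrow> perturbed_solution \<alpha> N a T \<rho> (\<lambda>i t. l \<beta> i t \<omega>)"
          "\<And>\<rho> \<kappa>. 0 < \<rho> \<Longrightarrow> 0 < \<kappa> \<Longrightarrow> 64 * real N * T * (c T + 2 * real N * \<rho>) / (\<kappa> * \<rho>\<^sup>2) < \<beta> \<Longrightarrow>
            measure (M \<beta>) (Q \<rho>) \<le> 2 * \<kappa>"
          by (rule laguerre_noise[OF L\<beta> \<alpha> N \<beta> T, folded c_def]) (rule a, assumption, rule that)
        have "AE \<omega> in M \<beta>. \<omega> \<in> S \<beta> \<longrightarrow> \<omega> \<in> Q \<rho>"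
          using Q(2)[of \<rho>]
        proof eventually_elim
          case (elim \<omega>)
          show ?case
          proof (rule impI, rule ccontr)
            assume S: "\<omega> \<in> S \<beta>" and "\<omega> \<notin> Q \<rho>"
            then have "\<bar>l \<beta> i t \<omega> - x i t\<bar> \<le> \<epsilon> / 2" if "t \<in> {0..T}" for t
              using elim near[OF _ i that] by auto
            then have "(SUP t\<in>{0..T}. \<bar>l \<beta> i t \<omega> - x i t\<bar>) \<le> \<epsilon> / 2"
              using T by (intro cSUP_least) auto
            then show False using S \<epsilon> unfolding S_def by auto
          qed
        qed
        then have "measure (M \<beta>) (S \<beta>) \<le> measure (M \<beta>) (Q \<rho>)"
          using Q(1) by (intro finite_measure_mono_AE)
        also have "\<dots> \<le> 2 * \<kappa>" using Q(3) \<rho> that by blast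
        finally show ?thesis .
      qed
      have "((\<lambda>\<beta>. measure (M \<beta>) (S \<beta>)) \<longlongrightarrow> 0) at_top"
      proof (rule tendstoI)
        fix e :: real assume e: "0 < e"
        have "\<forall>\<^sub>F \<beta> in at_top. 1 \<le> \<beta> \<and> 64 * real N * T * (c T + 2 * real N * \<rho>) / (e / 4 * \<rho>\<^sup>2) < \<beta>"
          by (intro eventually_conj eventually_ge_at_top eventually_gt_at_top)
        then show "\<forall>\<^sub>F \<beta> in at_top. dist (measure (M \<beta>) (S \<beta>)) 0 < e"
        proof eventually_elim
          case (elim \<beta>)
          \<comment> \<open>With \<open>\<kappa> = e / 4\<close> the bound is \<open>e / 2\<close>,
            strictly below \<open>e\<close>.\<close>
          then have "measure (M \<beta>) (S \<beta>) \<le> 2 * (e / 4)" using e by (intro bound) auto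
          then show ?case using e by (simp add: dist_real_def)
        qed
      qed
      then show "((\<lambda>\<beta>. measure (M \<beta>) {\<omega>\<in>space (M \<beta>). (SUP t\<in>{0..T}. \<bar>l \<beta> i t \<omega> - x i t\<bar>) \<ge> \<epsilon>}) \<longlongrightarrow> 0) at_top"
        unfolding S_def .
    qed
  next
    case False
    then obtain T \<epsilon> where T: "0 < T" and \<epsilon>: "0 < \<epsilon>" and none: "\<And>y. \<not> perturbed_solution \<alpha> N a T \<epsilon> y" by blast
    have contra: False
      if L: "\<forall>\<beta>\<ge>1. beta_laguerre_process \<alpha> \<beta> N a (M \<beta>) (b \<beta>) (l \<beta>)"
      for M :: "real \<Rightarrow> 'w measure" and b l
    proof -
      \<comment> \<open>Large enough for \<open>\<kappa> = 1 / 4\<close>, the summand 1 making the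
        inequality strict. Then \<open>Q \<epsilon>\<close> has probability at most 1/2, yet without
        perturbed solutions it must contain almost every outcome.\<close>
      define \<beta> where "\<beta> = max 1 (64 * real N * T * (c T + 2 * real N * \<epsilon>) / (1 / 4 * \<epsilon>\<^sup>2) + 1)"
      have L\<beta>: "beta_laguerre_process \<alpha> \<beta> N a (M \<beta>) (b \<beta>) (l \<beta>)" and \<beta>: "0 < \<beta>"
        and large: "64 * real N * T * (c T + 2 * real N * \<epsilon>) / (1 / 4 * \<epsilon>\<^sup>2) < \<beta>"
        using L unfolding \<beta>_def by auto
      interpret prob_space "M \<beta>"
        using L\<beta> by (simp add: beta_laguerre_process_def independent_brownian_motions_def)
      obtain Q where Q: "\<And>\<rho>. Q \<rho> \<in> sets (M \<beta>)"
        "\<And>\<rho>. AE \<omega> in M \<beta>. \<omega> \<notin> Q \<rho> \<longrightarrow> perturbed_solution \<alpha> N a T \<rho> (\<lambda>i t. l \<beta> i t \<omega>)"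
        "\<And>\<rho> \<kappa>. 0 < \<rho> \<Longrightarrow> 0 < \<kappa> \<Longrightarrow> 64 * real N * T * (c T + 2 * real N * \<rho>) / (\<kappa> * \<rho>\<^sup>2) < \<beta> \<Longrightarrow>
          measure (M \<beta>) (Q \<rho>) \<le> 2 * \<kappa>"
        by (rule laguerre_noise[OF L\<beta> \<alpha> N \<beta> T, folded c_def]) (rule a, assumption, rule that)
      have "prob (Q \<epsilon>) \<le> 2 * (1 / 4)" using \<epsilon> large by (intro Q(3)) auto
      moreover have "AE \<omega> in M \<beta>. \<omega> \<in> Q \<epsilon>"
        using Q(2)[of \<epsilon>] none by (auto elim!: eventually_mono)
      then have "prob (Q \<epsilon>) = 1" using Q(1) by (simp add: prob_eq_1)
      ultimately show False by simp
    qed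
    show ?thesis
      by (rule exI[of _ "\<lambda>_ _. 0"]) (auto dest: contra)
  qed
qed

end
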